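(* Let $X$ be an infinite-dimensional complex Banach space which is HI$_\xi$ for some $1\le\xi<\omega_1$, and such that $\#\bigl(\mathrm{SP}_{1,w}(X)/\!\approx_\xi\bigr)<\infty$. Then every operator $T\in\mathcal{L}(X)$ which is not a multiple of the identity has a non-trivial hyperinvariant subspace.
   Context: $\mathbb{N}=\{1,2,\dots\}$; $\mathcal{L}(X)$ is the space of bounded linear operators on $X$; $\#$ denotes cardinality; $[x_i]_{i\in F}$ is the closed linear span of $\{x_i\}_{i\in F}$. For finite sets $A,B\subseteq\mathbb{N}$, $A<B$ means $\max A<\min B$, and $n\le A$ means $n\le\min A$ (the empty set satisfies all such relations). A non-trivial hyperinvariant subspace of $T\in\mathcal{L}(X)$ is a closed subspace different from $\{0\}$ and $X$ that is invariant under every operator in $\mathcal{L}(X)$ commuting with $T$. Schreier families. For families $\mathcal{F},\mathcal{G}$ of finite subsets of $\mathbb{N}$ put $\mathcal{F}[\mathcal{G}]=\{\bigcup_{i=1}^n G_i : n\in\mathbb{N},\ G_1<\dots<G_n,\ G_i\in\mathcal{G}\text{ for } i\le n,\ \{\min G_i\}_{i=1}^n\in\mathcal{F}\}$. Let $\mathcal{S}_0=\{\{n\}:n\in\mathbb{N}\}\cup\{\varnothing\}$, $\mathcal{S}_1=\{F\subseteq\mathbb{N}\text{ finite}: \#F\le\min F\}$ (including $\varnothing$), $\mathcal{S}_{\xi+1}=\mathcal{S}_1[\mathcal{S}_\xi]$, and for a countable limit ordinal $\xi$ fix a sequence of ordinals $\xi_n\nearrow\xi$ and let $\mathcal{S}_\xi=\{F: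 n\le F\text{ and }F\in\mathcal{S}_{\xi_n}\text{ for some }n\in\mathbb{N}\}$. A Banach space $X$ is $\mathcal{S}_\xi$-hereditarily indecomposable (HI$_\xi$) if for every $\varepsilon>0$, every infinite-dimensional subspace $Y\subseteq X$ and every basic sequence $(x_n)$ in $X$ there exist $F\in\mathcal{S}_\xi$ and a unit vector $y\in Y$ with $\mathrm{dist}(y,[x_i]_{i\in F})<\varepsilon$. Sequences. Write $a\overset{C}{\approx}b$ if $\frac1C a\le b\le Ca$. A sequence is seminormalized if its norms are bounded above and bounded away from $0$. A seminormalized basic sequence $(x_n)$ in $X$ is Schreier spreading if there is $1\le C<\infty$ such that for all $F=\{f_1<\dots<f_n\}$, $G=\{g_1<\dots<g_n\}$ in $\mathcal{S}_1$ and scalars $(a_i)_{i=1}^n$, $\|\sum_{i=1}^n a_ix_{f_i}\|\overset{C}{\approx}\|\sum_{i=1}^n a_ix_{g_i}\|$. $\mathrm{SP}_{1,w}(X)$ is the set of seminormalized weakly null basic sequences in $X$ that are Schreier spreading, and $(x_n)\approx_\xi(y_n)$ is the equivalence relation on it meaning that there is $1\le K<\infty$ with $\|\sum_{i\in F}a_ix_i\|\overset{K}{\approx}\|\sum_{i\in F}a_iy_i\|$ for all $F\in\mathcal{S}_\xi$ and scalars $(a_i)_{i\in F}$. *)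

theory Defs
  imports "HOL-Analysis.Analysis"
begin

section \<open>Countable ordinals\<close>

text \<open>
  The ordinals below $\omega_1$ are the order types of the well-orders whose field is a set of
  natural numbers.
\<close>

quotient_type omega1 = "nat rel" / partial: "\<lambda>r s. (r, s) \<in> ordIso"
proof (rule part_equivpI)
  show "\<exists>r::nat rel. (r, r) \<in> ordIso"
    by (rule exI[of _ "{}"]) (simp add: ordIso_reflexive)
qed (auto intro!: sympI transpI intro: ordIso_symmetric ordIso_transitive)

instantiation omega1 :: wellorder
begin

lift_definition less_eq_omega1 :: "omega1 \<Rightarrow> omega1 \<Rightarrow> bool" is "\<lambda>r s. (r, s) \<in> ordLeq"
  by (meson ordIso_ordLeq_trans ordIso_symmetric ordLeq_ordIso_trans)

lift_definition less_omega1 :: "omega1 \<Rightarrow> omega1 \<Rightarrow> bool" is "\<lambda>r s. (r, s) \<in> ordLess"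
  by (meson ordIso_ordLess_trans ordIso_symmetric ordLess_ordIso_trans)

lemma ordIso_self_Well_order: "(r, r) \<in> ordIso \<Longrightarrow> Well_order r"
  by (simp add: ordIso_def)

instance
proof
  fix x y z :: omega1
  show "x < y \<longleftrightarrow> x \<le> y \<and> \<not> y \<le> x"
    by transfer (meson not_ordLeq_iff_ordLess ordIso_self_Well_order ordLess_imp_ordLeq)
  show "x \<le> x"
    by transfer (simp add: ordIso_imp_ordLeq)
  show "x \<le> y \<Longrightarrow> y \<le> z \<Longrightarrow> x \<le> z"
    by transfer (rule ordLeq_transitive)
  show "x \<le> y \<Longrightarrow> y \<le> x \<Longrightarrow> x = y"
    by transfer (simp add: ordIso_iff_ordLeq)
  show "x \<le> y \<or> y \<le> x"
    by transfer (simp add: ordIso_self_Well_order ordLeq_total)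
next
  fix P :: "omega1 \<Rightarrow> bool" and a :: omega1
  assume step: "\<And>x. (\<And>y. y < x \<Longrightarrow> P y) \<Longrightarrow> P x"
  have "wf {(x::omega1, y). x < y}"
  proof (rule wf_subset[OF wf_inv_image[OF wf_ordLess, of rep_omega1]])
    show "{(x, y). x < y} \<subseteq> inv_image ordLess rep_omega1"
      by (auto simp: inv_image_def less_omega1.rep_eq)
  qed
  then show "P a"
    by (induction a rule: wf_induct_rule) (auto intro: step)
qed

end

lemma Well_order_rep_omega1: "Well_order (rep_omega1 \<xi>)"
  using Quotient3_rep_reflp[OF Quotient3_omega1, of \<xi>] by (rule ordIso_self_Well_order)

lemma abs_rep_omega1: "abs_omega1 (rep_omega1 \<xi>) = \<xi>"
  by (rule Quotient3_abs_rep[OF Quotient3_omega1])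

lemma less_abs_omega1:
  "Well_order r \<Longrightarrow> Well_order s \<Longrightarrow> abs_omega1 r < abs_omega1 s \<longleftrightarrow> (r, s) \<in> ordLess"
  by (simp add: less_omega1.abs_eq ordIso_reflexive)

lemma abs_omega1_eq: "(r, s) \<in> ordIso \<Longrightarrow> abs_omega1 r = abs_omega1 s"
  by (rule Quotient3_rel_abs[OF Quotient3_omega1])

lemma countable_lessThan_omega1: "countable {..<\<xi>::omega1}"
proof -
  define r where "r = rep_omega1 \<xi>"
  have r: "Well_order r" by (simp add: r_def Well_order_rep_omega1)
  have "{..<\<xi>} \<subseteq> (\<lambda>a. abs_omega1 (Restr r (underS r a))) ` Field r"
  proof
    fix \<zeta> assume "\<zeta> \<in> {..<\<xi>}"
    then have "(rep_omega1 \<zeta>, r) \<in> ordLess" by (simp add: less_omega1.rep_eq r_def)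
    then obtain a where a: "a \<in> Field r" "(rep_omega1 \<zeta>, Restr r (underS r a)) \<in> ordIso"
      using ordLess_iff_ordIso_Restr[OF r Well_order_rep_omega1[of \<zeta>]] by blast
    then have "\<zeta> = abs_omega1 (Restr r (underS r a))"
      using abs_omega1_eq[OF a(2)] by (simp add: abs_rep_omega1)
    then show "\<zeta> \<in> (\<lambda>a. abs_omega1 (Restr r (underS r a))) ` Field r"
      using a(1) by blast
  qed
  then show ?thesis by (rule countable_subset) simp
qed

lemma Well_order_add_top:
  assumes r: "Well_order r" and a: "a \<notin> Field r"
  defines "s \<equiv> r \<union> insert a (Field r) \<times> {a}"
  shows "Well_order s" "(r, s) \<in> ordLess"
proof -
  have F: "Field s = insert a (Field r)"
    unfolding s_def Field_def by auto
  have na: "(x, y) \<in> r \<Longrightarrow> x \<noteq> a \<and> y \<noteq> a" for x y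
    using a by (auto simp: Field_def)
  have r': "refl_on (Field r) r" "trans r" "antisym r" "total_on (Field r) r" "wf (r - Id)"
    using r by (auto simp: well_order_on_def linear_order_on_def partial_order_on_def preorder_on_def)
  have sub: "r \<subseteq> Field r \<times> Field r" by (auto simp: Field_def)
  have "refl_on (Field s) s"
    using r'(1) unfolding F by (auto simp: s_def refl_on_def)
  moreover have "trans s"
    using r'(2) na sub unfolding trans_def s_def by blast
  moreover have "antisym s"
    using r'(3) na unfolding antisym_def s_def by blast
  moreover have "total_on (Field s) s"
    using r'(4) unfolding F by (auto simp: total_on_def s_def)
  moreover have "wf (s - Id)"
  proof -
    have eq: "s - Id = (r - Id) \<union> Field r \<times> {a}"
      unfolding s_def using a by auto
    have "wf (Field r \<times> {a})"
      using a unfolding wf_def by (metis mem_Sigma_iff singletonD)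
    then show ?thesis unfolding eq
      using na by (intro wf_Un r'(5)) auto
  qed
  moreover have "s \<subseteq> Field s \<times> Field s" by (auto simp: Field_def)
  ultimately show s: "Well_order s"
    by (auto simp: well_order_on_def linear_order_on_def partial_order_on_def preorder_on_def)
  have "underS s a = Field r"
    using a by (auto simp: underS_def s_def Field_def)
  moreover have "Restr s (Field r) = r"
    using sub a by (auto simp: s_def)
  ultimately have "r = Restr s (underS s a)" by simp
  moreover have "Field s \<noteq> {}" using F by simp
  ultimately show "(r, s) \<in> ordLess" using underS_Restr_ordLess[OF s, of a] by simp
qed

instance omega1 :: no_top
proof
  fix \<xi> :: omega1
  define r where "r = rep_omega1 \<xi>"
  define r1 where "r1 = dir_image r Suc"
  have r: "Well_order r" by (simp add: r_def Well_order_rep_omega1)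
  have r1: "Well_order r1" "(r, r1) \<in> ordIso"
    by (auto simp: r1_def r Well_order_dir_image dir_image_ordIso)
  have "0 \<notin> Field r1" by (auto simp: r1_def dir_image_def Field_def)
  from Well_order_add_top[OF r1(1) this] obtain s :: "nat rel" where
      s: "Well_order s" "(r1, s) \<in> ordLess" by blast
  have "(r, s) \<in> ordLess" using r1(2) s(2) by (rule ordIso_ordLess_trans)
  then have "abs_omega1 r < abs_omega1 s" using r s(1) by (simp add: less_abs_omega1)
  then show "\<exists>\<zeta>. \<xi> < \<zeta>" by (auto simp: r_def abs_rep_omega1)
qed

definition ord_suc :: "omega1 \<Rightarrow> omega1" where
  "ord_suc \<xi> = (LEAST \<zeta>. \<xi> < \<zeta>)"

lemma less_ord_suc: "\<xi> < ord_suc \<xi>"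
  unfolding ord_suc_def using gt_ex LeastI_ex by metis

lemma ord_suc_le_iff: "ord_suc \<xi> \<le> \<zeta> \<longleftrightarrow> \<xi> < \<zeta>"
  using less_ord_suc[of \<xi>] by (auto simp: ord_suc_def intro: Least_le)

lemma less_ord_suc_iff: "\<zeta> < ord_suc \<xi> \<longleftrightarrow> \<zeta> \<le> \<xi>"
  using ord_suc_le_iff[of \<xi> \<zeta>] by (auto simp flip: not_le)

lemma ord_suc_inject [simp]: "ord_suc \<xi> = ord_suc \<zeta> \<longleftrightarrow> \<xi> = \<zeta>"
  by (metis less_ord_suc less_ord_suc_iff order.antisym)

instantiation omega1 :: "{zero, one}"
begin

definition zero_omega1 :: omega1 where "0 = (LEAST \<xi>::omega1. True)"
definition one_omega1 :: omega1 where "1 = ord_suc 0"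

instance ..

end

lemma zero_le_omega1 [simp]: "0 \<le> (\<xi>::omega1)"
  unfolding zero_omega1_def by (rule Least_le) simp

lemma ord_suc_neq_zero [simp]: "ord_suc \<xi> \<noteq> 0"
  using less_ord_suc[of \<xi>] by (metis not_less zero_le_omega1)

definition limit_ord :: "omega1 \<Rightarrow> bool" where
  "limit_ord \<xi> \<longleftrightarrow> \<xi> \<noteq> 0 \<and> (\<forall>\<zeta>. \<xi> \<noteq> ord_suc \<zeta>)"

text \<open>
  A choice of sequences $\xi_n \nearrow \xi$, one for every countable limit ordinal $\xi$.
  The value at the index 0 is irrelevant.
\<close>

definition fundamental_sequences :: "(omega1 \<Rightarrow> nat \<Rightarrow> omega1) \<Rightarrow> bool" where
  "fundamental_sequences fs \<longleftrightarrow>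
    (\<forall>\<xi>. limit_ord \<xi> \<longrightarrow>
      strict_mono_on {1..} (fs \<xi>) \<and>
      (\<forall>n\<ge>1. fs \<xi> n < \<xi>) \<and>
      (\<forall>\<zeta><\<xi>. \<exists>n\<ge>1. \<zeta> < fs \<xi> n))"

lemma fundamental_sequences_exist: "\<exists>fs. fundamental_sequences fs"
proof -
  have "\<exists>s::nat \<Rightarrow> omega1. strict_mono_on {1..} s \<and> (\<forall>n\<ge>1. s n < \<xi>) \<and> (\<forall>\<zeta><\<xi>. \<exists>n\<ge>1. \<zeta> < s n)"
    if lim: "limit_ord \<xi>" for \<xi>
  proof -
    have suc: "ord_suc \<zeta> < \<xi>" if "\<zeta> < \<xi>" for \<zeta>
      using lim that by (metis limit_ord_def ord_suc_le_iff order_le_less)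
    have "0 < \<xi>" using lim zero_le_omega1[of \<xi>] by (auto simp: limit_ord_def order_le_less)
    then have ne: "{..<\<xi>} \<noteq> {}" by auto
    define c where "c = from_nat_into {..<\<xi>}"
    have c: "c n < \<xi>" for n
      using from_nat_into[OF ne, of n] by (simp add: c_def)
    have c_surj: "\<exists>n. c n = \<zeta>" if "\<zeta> < \<xi>" for \<zeta>
      using from_nat_into_surj[OF countable_lessThan_omega1, of \<zeta> \<xi>] that by (simp add: c_def)
    define s where "s = rec_nat 0 (\<lambda>n \<zeta>. ord_suc (max \<zeta> (c n)))"
    have s_Suc: "s (Suc n) = ord_suc (max (s n) (c n))" and s_0: "s 0 = 0" for n
      by (simp_all add: s_def)
    have "s n < \<xi>" for n
      by (induction n) (auto simp: s_0 s_Suc \<open>0 < \<xi>\<close> c intro!: suc)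
    moreover have "s n < s (Suc n)" "c n < s (Suc n)" for n
      by (auto simp: s_Suc less_ord_suc_iff)
    moreover have "\<exists>n\<ge>1. \<zeta> < s n" if "\<zeta> < \<xi>" for \<zeta>
      using c_surj[OF that] calculation(3) by (metis Suc_eq_plus1 le_add2)
    ultimately show ?thesis
      by (intro exI[of _ s]) (auto simp: strict_mono_on_def intro: lift_Suc_mono_less)
  qed
  then have "\<forall>\<xi>. \<exists>s::nat \<Rightarrow> omega1. limit_ord \<xi> \<longrightarrow>
      strict_mono_on {1..} s \<and> (\<forall>n\<ge>1. s n < \<xi>) \<and> (\<forall>\<zeta><\<xi>. \<exists>n\<ge>1. \<zeta> < s n)"
    by blast
  then show ?thesis
    unfolding fundamental_sequences_def by (rule choice)
qed


section \<open>Schreier families\<close>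

text \<open>
  Families consist of finite subsets of $\{1,2,\dots\}$. Comparing elements pairwise makes the
  empty set satisfy \<open>A < B\<close> trivially. In \<open>family_comp\<close> the order is required of all pairs (not
  only neighbouring ones), so that empty blocks cannot hide overlapping blocks, and the empty
  blocks contribute no minimum.
\<close>

definition set_less :: "nat set \<Rightarrow> nat set \<Rightarrow> bool" where
  "set_less A B \<longleftrightarrow> (\<forall>a\<in>A. \<forall>b\<in>B. a < b)"

definition family_comp :: "nat set set \<Rightarrow> nat set set \<Rightarrow> nat set set" where
  "family_comp \<F> \<G> =
    {\<Union>(set Gs) | Gs. Gs \<noteq> [] \<and> sorted_wrt set_less Gs \<and> set Gs \<subseteq> \<G> \<and>
      Min ` (set Gs - {{}}) \<in> \<F>}"

definition schreier0 :: "nat set set" where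
  "schreier0 = {{n} | n. 1 \<le> n} \<union> {{}}"

definition schreier1 :: "nat set set" where
  "schreier1 = {F. finite F \<and> (F = {} \<or> card F \<le> Min F)}"

lemma family_comp_mono: "\<G> \<subseteq> \<H> \<Longrightarrow> family_comp \<F> \<G> \<subseteq> family_comp \<F> \<H>"
  unfolding family_comp_def by blast

lemma family_comp_mono' [mono]:
  "(\<And>F. P F \<longrightarrow> Q F) \<Longrightarrow> G \<in> family_comp \<F> {F. P F} \<longrightarrow> G \<in> family_comp \<F> {F. Q F}"
  using family_comp_mono[of "{F. P F}" "{F. Q F}" \<F>] by blast

text \<open>The recursion on \<open>\<xi>\<close> is rendered inductively; the three recursion equations are derived below.\<close>

inductive in_schreier :: "(omega1 \<Rightarrow> nat \<Rightarrow> omega1) \<Rightarrow> omega1 \<Rightarrow> nat set \<Rightarrow> bool"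
  for fs :: "omega1 \<Rightarrow> nat \<Rightarrow> omega1" where
  zero: "F \<in> schreier0 \<Longrightarrow> in_schreier fs 0 F"
| suc: "F \<in> family_comp schreier1 {G. in_schreier fs \<xi> G} \<Longrightarrow> in_schreier fs (ord_suc \<xi>) F"
| limit: "limit_ord \<xi> \<Longrightarrow> 1 \<le> n \<Longrightarrow> \<forall>k\<in>F. n \<le> k \<Longrightarrow> in_schreier fs (fs \<xi> n) F \<Longrightarrow>
    in_schreier fs \<xi> F"

definition schreier :: "(omega1 \<Rightarrow> nat \<Rightarrow> omega1) \<Rightarrow> omega1 \<Rightarrow> nat set set" where
  "schreier fs \<xi> = {F. in_schreier fs \<xi> F}"

lemma schreier_0: "schreier fs 0 = schreier0"
  unfolding schreier_def
  by (auto elim: in_schreier.cases intro: in_schreier.zero simp: limit_ord_def)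

lemma schreier_suc: "schreier fs (ord_suc \<xi>) = family_comp schreier1 (schreier fs \<xi>)"
  unfolding schreier_def
  by (auto elim: in_schreier.cases intro: in_schreier.suc simp: limit_ord_def)

lemma schreier_limit:
  "limit_ord \<xi> \<Longrightarrow> schreier fs \<xi> = {F. \<exists>n\<ge>1. (\<forall>k\<in>F. n \<le> k) \<and> F \<in> schreier fs (fs \<xi> n)}"
  unfolding schreier_def limit_ord_def[of \<xi>]
  using in_schreier.simps[of fs \<xi>] by (auto simp: limit_ord_def)

lemma schreier_1: "schreier fs 1 = schreier1"
proof -
  have "family_comp schreier1 schreier0 = schreier1"
  proof (intro equalityI subsetI)
    fix F assume "F \<in> family_comp schreier1 schreier0"
    then obtain Gs where Gs: "F = \<Union>(set Gs)" "set Gs \<subseteq> schreier0"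
      "Min ` (set Gs - {{}}) \<in> schreier1"
      by (auto simp: family_comp_def)
    have sing: "G = {Min G}" if "G \<in> set Gs" "G \<noteq> {}" for G
      using Gs(2) that by (auto simp: schreier0_def)
    have "F = Min ` (set Gs - {{}})"
    proof -
      have "\<Union>(set Gs) = (\<Union>G\<in>set Gs - {{}}. G)" by auto
      also have "\<dots> = (\<Union>G\<in>set Gs - {{}}. {Min G})"
        using sing by (intro SUP_cong) auto
      finally show ?thesis using Gs(1) by auto
    qed
    then show "F \<in> schreier1" using Gs(3) by simp
  next
    fix F assume F: "F \<in> schreier1"
    then have fin: "finite F" by (simp add: schreier1_def)
    have pos: "1 \<le> n" if "n \<in> F" for n
    proof -
      have "0 < card F" using that fin by (auto simp: card_gt_0_iff)
      also have "card F \<le> Min F" using F that by (auto simp: schreier1_def)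
      also have "Min F \<le> n" using that fin by simp
      finally show ?thesis by simp
    qed
    define Gs where "Gs = {} # map (\<lambda>n. {n}) (sorted_list_of_set F)"
    have "sorted_wrt set_less Gs"
      by (auto simp: Gs_def set_less_def sorted_wrt_map)
    moreover have "set Gs \<subseteq> schreier0"
      using pos by (auto simp: Gs_def schreier0_def fin)
    moreover have "Min ` (set Gs - {{}}) = F"
    proof -
      have "set Gs - {{}} = (\<lambda>n. {n}) ` F" by (auto simp: Gs_def fin)
      then show ?thesis by (simp add: image_image)
    qed
    moreover have "\<Union>(set Gs) = F" "Gs \<noteq> []"
      by (auto simp: Gs_def fin)
    ultimately show "F \<in> family_comp schreier1 schreier0"
      using F unfolding family_comp_def by (intro CollectI exI[of _ Gs]) simp
  qed
  then show ?thesis by (simp add: one_omega1_def schreier_suc schreier_0)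
qed


section \<open>Complex Banach spaces\<close>

class complex_normed_vector = real_normed_vector +
  fixes scaleC :: "complex \<Rightarrow> 'a \<Rightarrow> 'a" (infixr "*\<^sub>C" 75)
  assumes scaleC_add_right: "a *\<^sub>C (x + y) = a *\<^sub>C x + a *\<^sub>C y"
    and scaleC_add_left: "(a + b) *\<^sub>C x = a *\<^sub>C x + b *\<^sub>C x"
    and scaleC_scaleC: "a *\<^sub>C b *\<^sub>C x = (a * b) *\<^sub>C x"
    and scaleC_one: "1 *\<^sub>C x = x"
    and scaleC_of_real: "complex_of_real r *\<^sub>C x = r *\<^sub>R x"
    and norm_scaleC: "norm (a *\<^sub>C x) = cmod a * norm x"

class complex_banach = complex_normed_vector + banach

global_interpretation complex_vector: vector_space "scaleC :: complex \<Rightarrow> 'a \<Rightarrow> 'a::complex_normed_vector"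
  by unfold_locales (rule scaleC_add_right scaleC_add_left scaleC_scaleC scaleC_one)+

instantiation complex :: complex_banach
begin

definition scaleC_complex :: "complex \<Rightarrow> complex \<Rightarrow> complex" where
  "scaleC_complex a x = a * x"

instance
  by standard (auto simp: scaleC_complex_def algebra_simps norm_mult scaleR_conv_of_real)

end

definition bounded_clinear :: "('a::complex_normed_vector \<Rightarrow> 'b::complex_normed_vector) \<Rightarrow> bool" where
  "bounded_clinear T \<longleftrightarrow> bounded_linear T \<and> (\<forall>c x. T (c *\<^sub>C x) = c *\<^sub>C T x)"

definition cfinite_dim :: "'a::complex_normed_vector set \<Rightarrow> bool" where
  "cfinite_dim Y \<longleftrightarrow> (\<exists>B. finite B \<and> Y \<subseteq> complex_vector.span B)"

definition closed_cspan :: "'a::complex_normed_vector set \<Rightarrow> 'a set" where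
  "closed_cspan A = closure (complex_vector.span A)"

definition nontrivial_hyperinvariant ::
    "('a::complex_normed_vector \<Rightarrow> 'a) \<Rightarrow> 'a set \<Rightarrow> bool" where
  "nontrivial_hyperinvariant T M \<longleftrightarrow>
    closed M \<and> complex_vector.subspace M \<and> M \<noteq> {0} \<and> M \<noteq> UNIV \<and>
    (\<forall>S. bounded_clinear S \<and> S \<circ> T = T \<circ> S \<longrightarrow> S ` M \<subseteq> M)"


section \<open>Sequences\<close>

text \<open>
  A sequence $(x_n)_{n\in\mathbb{N}}$ with $\mathbb{N}=\{1,2,\dots\}$ is a function \<open>x :: nat \<Rightarrow> 'a\<close> whose value
  at \<open>0\<close> is $x_1$. Thus $x_i$ is \<open>elt x i\<close>; this is used wherever Schreier sets supply the indices.
\<close>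

definition elt :: "(nat \<Rightarrow> 'a) \<Rightarrow> nat \<Rightarrow> 'a" where
  "elt x i = x (i - 1)"

definition basic_sequence :: "(nat \<Rightarrow> 'a::complex_normed_vector) \<Rightarrow> bool" where
  "basic_sequence x \<longleftrightarrow>
    (\<forall>v \<in> closed_cspan (range x). \<exists>!a::nat \<Rightarrow> complex. (\<lambda>n. a n *\<^sub>C x n) sums v)"

definition weakly_null :: "(nat \<Rightarrow> 'a::complex_normed_vector) \<Rightarrow> bool" where
  "weakly_null x \<longleftrightarrow> (\<forall>\<phi>::'a \<Rightarrow> complex. bounded_clinear \<phi> \<longrightarrow> (\<lambda>n. \<phi> (x n)) \<longlonglongrightarrow> 0)"

definition seminormalized :: "(nat \<Rightarrow> 'a::complex_normed_vector) \<Rightarrow> bool" where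
  "seminormalized x \<longleftrightarrow> (\<exists>c>0. \<exists>C. \<forall>n. c \<le> norm (x n) \<and> norm (x n) \<le> C)"

definition approx_by :: "real \<Rightarrow> real \<Rightarrow> real \<Rightarrow> bool" where
  "approx_by C a b \<longleftrightarrow> 1 / C * a \<le> b \<and> b \<le> C * a"

text \<open>\<open>sorted_list_of_set F ! i\<close> is $f_{i+1}$ when $F=\{f_1<\dots<f_n\}$.\<close>

definition schreier_spreading :: "(nat \<Rightarrow> 'a::complex_normed_vector) \<Rightarrow> bool" where
  "schreier_spreading x \<longleftrightarrow>
    (\<exists>C\<ge>1. \<forall>n. \<forall>F\<in>schreier1. \<forall>G\<in>schreier1. \<forall>a::nat \<Rightarrow> complex. card F = n \<and> card G = n \<longrightarrow>
      approx_by C (norm (\<Sum>i<n. a i *\<^sub>C elt x (sorted_list_of_set F ! i)))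
                  (norm (\<Sum>i<n. a i *\<^sub>C elt x (sorted_list_of_set G ! i))))"

definition SP1w :: "(nat \<Rightarrow> 'a::complex_normed_vector) set" where
  "SP1w = {x. basic_sequence x \<and> seminormalized x \<and> weakly_null x \<and> schreier_spreading x}"

definition schreier_equiv ::
    "(omega1 \<Rightarrow> nat \<Rightarrow> omega1) \<Rightarrow> omega1 \<Rightarrow> (nat \<Rightarrow> 'a::complex_normed_vector) rel" where
  "schreier_equiv fs \<xi> =
    {(x, y). x \<in> SP1w \<and> y \<in> SP1w \<and>
      (\<exists>K\<ge>1. \<forall>F\<in>schreier fs \<xi>. \<forall>a::nat \<Rightarrow> complex.
        approx_by K (norm (\<Sum>i\<in>F. a i *\<^sub>C elt x i)) (norm (\<Sum>i\<in>F. a i *\<^sub>C elt y i)))}"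

lemma approx_by_refl: "approx_by 1 a a"
  by (simp add: approx_by_def)

lemma approx_by_sym: "1 \<le> K \<Longrightarrow> approx_by K a b \<Longrightarrow> approx_by K b a"
  by (auto simp: approx_by_def field_simps)

lemma approx_by_trans:
  assumes "1 \<le> K" "1 \<le> L" "approx_by K a b" "approx_by L b c"
  shows "approx_by (K * L) a c"
proof -
  have "a \<le> K * b" "b \<le> L * c" "b \<le> K * a" "c \<le> L * b"
    using assms by (auto simp: approx_by_def field_simps)
  moreover have "K * b \<le> K * (L * c)" "L * b \<le> L * (K * a)"
    using assms(1,2) calculation by (auto intro!: mult_left_mono)
  ultimately have "a \<le> K * L * c" "c \<le> K * L * a"
    by (auto simp: mult_ac)
  then show ?thesis
    using assms(1,2) by (auto simp: approx_by_def field_simps)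
qed

lemma equiv_schreier_equiv:
  "equiv (SP1w :: (nat \<Rightarrow> 'a::complex_normed_vector) set) (schreier_equiv fs \<xi>)"
  (is "equiv ?S ?R")
proof (rule equivI)
  show "?R \<subseteq> ?S \<times> ?S"
    by (auto simp: schreier_equiv_def)
  show "refl_on ?S ?R"
    by (auto simp: refl_on_def schreier_equiv_def intro!: exI[of _ 1] approx_by_refl)
  show "sym ?R"
    unfolding sym_def schreier_equiv_def by (blast intro: approx_by_sym)
  show "trans ?R"
  proof (rule transI)
    fix x y z :: "nat \<Rightarrow> 'a"
    assume "(x, y) \<in> ?R" "(y, z) \<in> ?R"
    then obtain K L where KL: "1 \<le> K" "1 \<le> L" "x \<in> SP1w" "z \<in> SP1w"
      and K: "\<And>F a. F \<in> schreier fs \<xi> \<Longrightarrow>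
        approx_by K (norm (\<Sum>i\<in>F. a i *\<^sub>C elt x i)) (norm (\<Sum>i\<in>F. a i *\<^sub>C elt y i))"
      and L: "\<And>F a. F \<in> schreier fs \<xi> \<Longrightarrow>
        approx_by L (norm (\<Sum>i\<in>F. a i *\<^sub>C elt y i)) (norm (\<Sum>i\<in>F. a i *\<^sub>C elt z i))"
      unfolding schreier_equiv_def by blast
    have "1 \<le> K * L" using mult_mono[of 1 K 1 L] KL(1,2) by simp
    then show "(x, z) \<in> ?R"
      unfolding schreier_equiv_def using KL(3,4) approx_by_trans[OF KL(1,2) K L] by blast
  qed
qed

text \<open>The property \<open>HI\<^sub>\<xi>\<close> of the whole space \<open>'a\<close>.\<close>

definition HI :: "(omega1 \<Rightarrow> nat \<Rightarrow> omega1) \<Rightarrow> omega1 \<Rightarrow> 'a::complex_normed_vector itself \<Rightarrow> bool" where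
  "HI fs \<xi> (_ :: 'a itself) \<longleftrightarrow>
    (\<forall>\<epsilon>>0. \<forall>Y::'a set. \<forall>x::nat \<Rightarrow> 'a.
      complex_vector.subspace Y \<and> \<not> cfinite_dim Y \<and> basic_sequence x \<longrightarrow>
      (\<exists>F\<in>schreier fs \<xi>. \<exists>y\<in>Y. norm y = 1 \<and> infdist y (closed_cspan (elt x ` F)) < \<epsilon>))"

end

(*
A Hahn--Banach and a Mazur selection argument give basic sequences. Since a sequence equivalent to
the l_1 basis contradicts HI_xi, Rosenthal's theorem provides normalized weakly null sequences, and
also a weakly null sequence on which any given non-compact operator is bounded below.

Replacing the norm by the limsup norm on bounded weakly null sequences, T has an approximate
eigenvalue mu there, so T - mu is arbitrarily small on infinite-dimensional subspaces and HI_xi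
makes S = T - mu singular along S_xi. If S^N were not compact, where N is the number of classes of
SP_{1,w}, then x, S x, ..., S^N x would all lie in SP_{1,w} for a suitable weakly null x; two of
them would be equivalent on S_xi, and a power of S would be bounded below there.

So S commutes with the compact operator S^N. If S^N is zero or has a non-zero eigenvalue, a kernel
is hyperinvariant; otherwise S^N is quasinilpotent and Hilden's proof of Lomonosov's theorem applies.
*)

theory Submission
  imports Defs "HOL-Library.Diagonal_Subsequence" "HOL-Library.Ramsey" "HOL-Library.Function_Algebras"
begin

text \<open>The limsup norm ignores finitely many terms and norm null parts. An approximate
  eigenvector for it therefore consists of vectors on which any finitely many functionals are
  eventually small, which is what Mazur's construction needs in order to produce an
  infinite-dimensional subspace; an approximate eigenvector in the space itself might only give a
  finite-dimensional one. The weakly null sequences carry just a seminorm and are not completed, so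
  resolvents are not at hand, and the spectral radius argument is run on lower bounds for 1 - z T.
  It serves a second time at the end, where Riesz's argument supplies the lower bounds for the
  compact power. The exponent N comes from the pigeonhole principle: N classes cannot separate the N
  + 1 sequences x, S x, ..., S^N x. All of these have to be made basic and spreading along one
  common subsequence, since otherwise they would no longer be images of one another under powers of
  S. Compactness of S^N is obtained in the form of Cauchy subsequences; only the last section passes
  to their limits.\<close>

section \<open>Norming functionals\<close>

definition sublinear :: "('a::real_vector \<Rightarrow> real) \<Rightarrow> bool" where
  "sublinear p \<longleftrightarrow> (\<forall>x y. p (x + y) \<le> p x + p y) \<and> (\<forall>t>0. \<forall>x. p (t *\<^sub>R x) = t * p x)"

lemma sublinearD:
  assumes "sublinear p"
  shows sublinear_add: "p (x + y) \<le> p x + p y"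
    and sublinear_scale: "0 \<le> t \<Longrightarrow> p (t *\<^sub>R x) = t * p x"
    and sublinear_zero: "p 0 = 0"
    and sublinear_minus: "- p (- x) \<le> p x"
proof -
  show z: "p 0 = 0"
    using assms[unfolded sublinear_def, THEN conjunct2, rule_format, of 2 0] by simp
  show a: "p (x + y) \<le> p x + p y" for x y using assms by (simp add: sublinear_def)
  show "0 \<le> t \<Longrightarrow> p (t *\<^sub>R x) = t * p x"
    using assms z by (cases "t = 0") (auto simp: sublinear_def)
  show "- p (- x) \<le> p x" using a[of x "-x"] z by simp
qed

text \<open>Applying the inequality to the inverse scalar gives the reverse one.\<close>

lemma sublinearI:
  assumes "\<And>x y. p (x + y) \<le> p x + p y" "\<And>t x. 0 < t \<Longrightarrow> p (t *\<^sub>R x) \<le> t * p x"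
  shows "sublinear p"
  unfolding sublinear_def
proof (intro conjI allI impI assms antisym)
  fix t :: real and x :: 'a assume t: "0 < t"
  have "p x = p (inverse t *\<^sub>R t *\<^sub>R x)" using t by simp
  also have "\<dots> \<le> inverse t * p (t *\<^sub>R x)" using t by (intro assms(2)) simp
  finally show "t * p x \<le> p (t *\<^sub>R x)" using t by (simp add: field_simps)
qed

text \<open>The infimum over t \<ge> 0 of p (x + t y) - t p y pushes \<open>p\<close> down along the
  direction of \<open>y\<close>; t = 1 gives the value at -y. For a minimal \<open>p\<close> this
  forces oddness. For the norm it yields a majorant below which every linear functional attains the
  norm at \<open>y\<close>.\<close>

lemma sublinear_shift:
  assumes p: "sublinear p"
  obtains q where "sublinear q" "q \<le> p" "q (- y) \<le> - p y"
proof -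
  define Q where "Q x t = p (x + t *\<^sub>R y) - t * p y" for x t
  define q where "q x = (INF t\<in>{0..}. Q x t)" for x
  have lb: "- p (- x) \<le> Q x t" if "0 \<le> t" for x t
    using sublinear_add[OF p, of "- x" "x + t *\<^sub>R y"] sublinear_scale[OF p that, of y]
    by (simp add: Q_def)
  have bdd: "bdd_below (Q x ` {0..})" for x
    by (rule bdd_belowI2[where m = "- p (- x)"]) (simp add: lb)
  have le: "q x \<le> Q x t" if "0 \<le> t" for x t
    unfolding q_def by (rule cINF_lower[OF bdd]) (simp add: that)
  have ge: "b \<le> q x" if "\<And>t. 0 \<le> t \<Longrightarrow> b \<le> Q x t" for b x
    unfolding q_def by (rule cINF_greatest) (auto simp: that)
  have "sublinear q"
  proof (rule sublinearI)
    fix x x' :: 'a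
    have "q (x + x') - Q x t \<le> q x'" if t: "0 \<le> t" for t
    proof (rule ge)
      fix s :: real assume s: "0 \<le> s"
      have "q (x + x') \<le> Q (x + x') (t + s)" using t s by (intro le) simp
      also have "\<dots> \<le> Q x t + Q x' s"
        using sublinear_add[OF p, of "x + t *\<^sub>R y" "x' + s *\<^sub>R y"]
        by (simp add: Q_def algebra_simps)
      finally show "q (x + x') - Q x t \<le> Q x' s" by simp
    qed
    then have "q (x + x') - q x' \<le> q x" by (intro ge) (simp add: algebra_simps)
    then show "q (x + x') \<le> q x + q x'" by simp
  next
    fix c :: real and x :: 'a assume c: "0 < c"
    have "q (c *\<^sub>R x) / c \<le> q x"
    proof (rule ge)
      fix t :: real assume t: "0 \<le> t"
      have "q (c *\<^sub>R x) \<le> Q (c *\<^sub>R x) (c * t)" using c t by (intro le) simp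
      also have "\<dots> = c * Q x t"
        using sublinear_scale[OF p, of c "x + t *\<^sub>R y"] c by (simp add: Q_def algebra_simps)
      finally show "q (c *\<^sub>R x) / c \<le> Q x t" using c by (simp add: field_simps)
    qed
    then show "q (c *\<^sub>R x) \<le> c * q x" using c by (simp add: field_simps)
  qed
  moreover have "q \<le> p" using le[of 0] by (simp add: le_fun_def Q_def)
  moreover have "q (- y) \<le> - p y" using le[of 1 "- y"] sublinear_zero[OF p] by (simp add: Q_def)
  ultimately show thesis by (rule that)
qed

text \<open>Zorn's lemma for the reversed order. Every sublinear functional below \<open>p\<close>
  is at least -p (-x), so pointwise infima of chains are finite; subadditivity survives because two
  members of a chain have a common lower bound in it.\<close>

lemma minimal_sublinear:
  assumes p: "sublinear p"
  obtains m where "sublinear m" "m \<le> p" "\<forall>q. sublinear q \<longrightarrow> q \<le> m \<longrightarrow> q = m"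
proof -
  define A where "A = {q. sublinear q \<and> q \<le> p}"
  have "\<exists>m\<in>A. \<forall>a\<in>A. a \<le> m \<longrightarrow> a = m"
  proof (rule predicate_Zorn)
    show "partial_order_on A (relation_of (\<lambda>q r. r \<le> q) A)"
      by (rule partial_order_on_relation_ofI) auto
  next
    fix C assume C: "C \<in> Chains (relation_of (\<lambda>q r. r \<le> q) A)"
    have CA: "q \<in> A" if "q \<in> C" for q
      using C that by (auto simp: Chains_def relation_of_def)
    have chain: "q \<le> r \<or> r \<le> q" if "q \<in> C" "r \<in> C" for q r
      using C that by (auto simp: Chains_def relation_of_def)
    show "\<exists>u\<in>A. \<forall>a\<in>C. u \<le> a"
    proof (cases "C = {}")
      case True
      then show ?thesis using p by (auto simp: A_def)
    next
      case False
      define u where "u x = (INF q\<in>C. q x)" for x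
      have lb: "- p (- x) \<le> q x" if "q \<in> C" for q x
        using sublinear_minus[of q x] CA[OF that] le_funD[of q p "- x"] by (auto simp: A_def)
      have bdd: "bdd_below ((\<lambda>q. q x) ` C)" for x
        by (rule bdd_belowI2[where m = "- p (- x)"]) (simp add: lb)
      have le: "u x \<le> q x" if "q \<in> C" for x q
        unfolding u_def by (rule cINF_lower[OF bdd that])
      have ge: "b \<le> u x" if "\<And>q. q \<in> C \<Longrightarrow> b \<le> q x" for b x
        unfolding u_def by (rule cINF_greatest[OF False]) (rule that)
      have "sublinear u"
      proof (rule sublinearI)
        fix x x' :: 'a
        have "u (x + x') - q x \<le> u x'" if q: "q \<in> C" for q
        proof (rule ge)
          fix r assume r: "r \<in> C"
          obtain s where s: "s \<in> C" "s \<le> q" "s \<le> r" using chain[OF q r] q r by auto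
          have "u (x + x') \<le> s (x + x')" by (rule le[OF s(1)])
          also have "\<dots> \<le> s x + s x'" using CA[OF s(1)] by (auto simp: A_def intro: sublinear_add)
          also have "\<dots> \<le> q x + r x'" using s by (auto simp: le_fun_def intro: add_mono)
          finally show "u (x + x') - q x \<le> r x'" by simp
        qed
        then have "u (x + x') - u x' \<le> u x" by (intro ge) (simp add: algebra_simps)
        then show "u (x + x') \<le> u x + u x'" by simp
      next
        fix c :: real and x :: 'a assume c: "0 < c"
        have "u (c *\<^sub>R x) / c \<le> u x"
        proof (rule ge)
          fix q assume q: "q \<in> C"
          have "u (c *\<^sub>R x) \<le> q (c *\<^sub>R x)" by (rule le[OF q])
          also have "\<dots> = c * q x" using CA[OF q] c by (simp add: A_def sublinear_scale)
          finally show "u (c *\<^sub>R x) / c \<le> q x" using c by (simp add: field_simps)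
        qed
        then show "u (c *\<^sub>R x) \<le> c * u x" using c by (simp add: field_simps)
      qed
      moreover have "u \<le> p"
        using False CA le by (fastforce simp: A_def le_fun_def intro: order_trans)
      ultimately show ?thesis using le by (auto simp: A_def le_fun_def)
    qed
  qed
  then obtain m where m: "m \<in> A" "\<And>a. a \<in> A \<Longrightarrow> a \<le> m \<Longrightarrow> a = m" by blast
  show thesis
  proof (rule that[of m])
    show "sublinear m" and "m \<le> p" using m(1) by (auto simp: A_def)
    then have "q \<in> A" if "sublinear q" "q \<le> m" for q using that by (auto simp: A_def)
    then show "\<forall>q. sublinear q \<longrightarrow> q \<le> m \<longrightarrow> q = m" using m(2) by blast
  qed
qed

text \<open>\<open>sublinear_shift\<close> cannot lower a minimal sublinear functional, which is
  therefore odd and hence linear.\<close>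

lemma sublinear_majorizes_linear:
  assumes p: "sublinear p"
  obtains f where "linear f" "f \<le> p"
proof -
  obtain m where m: "sublinear m" "m \<le> p" and min: "\<forall>q. sublinear q \<longrightarrow> q \<le> m \<longrightarrow> q = m"
    by (rule minimal_sublinear[OF p])
  have minus: "m (- y) = - m y" for y
  proof -
    obtain q where "sublinear q" "q \<le> m" "q (- y) \<le> - m y" by (rule sublinear_shift[OF m(1)])
    then show ?thesis using min[rule_format, of q] sublinear_minus[OF m(1), of "- y"] by auto
  qed
  have "linear m"
  proof (rule linearI)
    fix x y :: 'a
    show "m (x + y) = m x + m y"
      using sublinear_add[OF m(1), of x y] sublinear_add[OF m(1), of "x + y" "- y"] minus[of y]
      by simp
  next
    fix c :: real and x :: 'a
    show "m (c *\<^sub>R x) = c *\<^sub>R m x"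
      using sublinear_scale[OF m(1), of c x] sublinear_scale[OF m(1), of "- c" x] minus[of "c *\<^sub>R x"]
      by (cases "0 \<le> c") auto
  qed
  then show thesis using m(2) by (rule that)
qed

section \<open>Complex functionals\<close>

lemma scaleC_conv_scaleR: "c *\<^sub>C x = Re c *\<^sub>R x + Im c *\<^sub>R (\<i> *\<^sub>C x)"
  for x :: "'a::complex_normed_vector"
proof -
  have "c = complex_of_real (Re c) + complex_of_real (Im c) * \<i>" by (simp add: complex_eq_iff)
  then have "c *\<^sub>C x = (complex_of_real (Re c) + complex_of_real (Im c) * \<i>) *\<^sub>C x" by simp
  then show ?thesis by (simp only: scaleC_add_left scaleC_scaleC[symmetric] scaleC_of_real)
qed

lemma scaleC_scaleR_commute: "c *\<^sub>C r *\<^sub>R x = r *\<^sub>R c *\<^sub>C x"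
  for x :: "'a::complex_normed_vector"
  by (simp add: scaleC_of_real[symmetric] scaleC_scaleC mult.commute)

text \<open>The closed unit ball of the dual. Testing against contractions only keeps operator norms
  out of the estimates.\<close>

definition dual_ball :: "('a::complex_normed_vector \<Rightarrow> complex) set" where
  "dual_ball = {\<phi>. bounded_clinear \<phi> \<and> (\<forall>v. cmod (\<phi> v) \<le> norm v)}"

lemma norming_functional:
  fixes x :: "'a::complex_normed_vector"
  obtains \<phi> where "\<phi> \<in> dual_ball" "\<phi> x = of_real (norm x)"
proof -
  have "sublinear (norm :: 'a \<Rightarrow> real)" by (auto simp: sublinear_def norm_triangle_ineq)
  then obtain p where p: "sublinear p" "p \<le> norm" "p (- x) \<le> - norm x"
    by (rule sublinear_shift)
  obtain f where f: "linear f" "f \<le> p" by (rule sublinear_majorizes_linear[OF p(1)])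
  interpret f: linear f by (rule f(1))
  have fle: "f v \<le> norm v" for v using f(2) p(2) by (auto simp: le_fun_def intro: order_trans)
  \<comment> \<open>The only complex-linear candidate with real part \<open>f\<close>.\<close>
  define \<phi> where "\<phi> v = Complex (f v) (- f (\<i> *\<^sub>C v))" for v
  have ii: "\<i> *\<^sub>C \<i> *\<^sub>C v = - v" for v :: 'a
    using scaleC_of_real[of "-1" v] by (simp add: scaleC_scaleC)
  have add: "\<phi> (u + v) = \<phi> u + \<phi> v" for u v
    by (simp add: \<phi>_def f.add scaleC_add_right complex_eq_iff)
  have scR: "\<phi> (r *\<^sub>R v) = r *\<^sub>R \<phi> v" for r v
    by (simp add: \<phi>_def f.scaleR scaleC_scaleR_commute complex_eq_iff)
  have sci: "\<phi> (\<i> *\<^sub>C v) = \<i> * \<phi> v" for v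
    by (simp add: \<phi>_def ii f.neg complex_eq_iff)
  have sc: "\<phi> (c *\<^sub>C v) = c * \<phi> v" for c v
    by (subst scaleC_conv_scaleR) (simp add: add scR sci complex_eq_iff)
  have nrm: "cmod (\<phi> v) \<le> norm v" for v
  proof (cases "\<phi> v = 0")
    case False
    \<comment> \<open>\<open>c\<close> rotates \<phi> v onto the positive real axis, where the bound
      on the real part \<open>f\<close> applies.\<close>
    define c where "c = cnj (\<phi> v) / cmod (\<phi> v)"
    have c: "cmod c = 1" "c * \<phi> v = cmod (\<phi> v)"
      using False 
        complex_norm_square[of "\<phi> v"] by (auto simp: c_def norm_divide power2_eq_square field_simps)
    have "cmod (\<phi> v) = Re (\<phi> (c *\<^sub>C v))" by (simp add: sc c(2))
    also have "\<dots> = f (c *\<^sub>C v)" by (simp add: \<phi>_def)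
    also have "\<dots> \<le> norm v" using fle[of "c *\<^sub>C v"] c(1) by (simp add: norm_scaleC)
    finally show ?thesis .
  qed simp
  have "bounded_linear \<phi>"
    by (rule bounded_linear_intro[where K = 1]) (auto simp: add scR nrm)
  then have "\<phi> \<in> dual_ball" by (auto simp: dual_ball_def bounded_clinear_def sc nrm scaleC_complex_def)
  moreover have "\<phi> x = norm x"
  proof -
    \<comment> \<open>\<open>p\<close> was lowered at -x, so f x is at least the norm; the modulus
      bound then leaves no room for an imaginary part.\<close>
    have "norm x \<le> Re (\<phi> x)"
      using p(3) f(2) f.neg[of x] by (auto simp: \<phi>_def le_fun_def dest!: spec[of _ "- x"])
    moreover have "Re (\<phi> x) \<le> cmod (\<phi> x)" by (rule complex_Re_le_cmod)
    moreover note nrm[of x]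
    ultimately have "Re (\<phi> x) = norm x" "cmod (\<phi> x) = Re (\<phi> x)" by linarith+
    then show ?thesis using cmod_power2[of "\<phi> x"] by (simp add: complex_eq_iff)
  qed
  ultimately show thesis by (rule that)
qed

section \<open>Basic sequences\<close>

text \<open>Grunblum's condition: the initial projections are bounded by the basis constant
  \<open>C\<close>. It concerns finite sums only, so it can be built up vector by vector and passes
  to subsequences, unlike the expansion property itself.\<close>

definition grunblum :: "real \<Rightarrow> (nat \<Rightarrow> 'a::complex_normed_vector) \<Rightarrow> bool" where
  "grunblum C x \<longleftrightarrow> (\<forall>a::nat \<Rightarrow> complex. \<forall>m n. m \<le> n \<longrightarrow>
    norm (\<Sum>i<m. a i *\<^sub>C x i) \<le> C * norm (\<Sum>i<n. a i *\<^sub>C x i))"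

lemma grunblumD:
  "grunblum C x \<Longrightarrow> m \<le> n \<Longrightarrow> norm (\<Sum>i<m. a i *\<^sub>C x i) \<le> C * norm (\<Sum>i<n. a i *\<^sub>C x i)"
  by (simp add: grunblum_def)

lemma scaleC_minus_left: "(- c) *\<^sub>C x = - (c *\<^sub>C x)" for x :: "'a::complex_normed_vector"
  by (rule complex_vector.scale_minus_left)

lemma bounded_linear_scaleC_left: "bounded_linear (\<lambda>c. c *\<^sub>C (x::'a::complex_normed_vector))"
proof (rule bounded_linear_intro[where K = "norm x"])
  show "(r *\<^sub>R c) *\<^sub>C x = r *\<^sub>R c *\<^sub>C x" for r :: real and c
    by (simp only: scaleR_conv_of_real scaleC_scaleC[symmetric] scaleC_of_real)
qed (simp_all add: scaleC_add_left norm_scaleC)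

text \<open>A term is the difference of two consecutive partial sums, each of which costs a factor
  \<open>C\<close>.\<close>

lemma grunblum_coeff:
  assumes "grunblum C x" "i < n"
  shows "cmod (a i) * norm (x i) \<le> 2 * C * norm (\<Sum>i<n. a i *\<^sub>C x i)"
proof -
  have "cmod (a i) * norm (x i) = norm ((\<Sum>j<Suc i. a j *\<^sub>C x j) - (\<Sum>j<i. a j *\<^sub>C x j))"
    by (simp add: norm_scaleC)
  also have "\<dots> \<le> norm (\<Sum>j<Suc i. a j *\<^sub>C x j) + norm (\<Sum>j<i. a j *\<^sub>C x j)"
    by (rule norm_triangle_ineq4)
  also have "\<dots> \<le> C * norm (\<Sum>i<n. a i *\<^sub>C x i) + C * norm (\<Sum>i<n. a i *\<^sub>C x i)"
    using assms(2) by (intro add_mono grunblumD[OF assms(1)]) auto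
  finally show ?thesis by simp
qed

lemma cspan_finite_image:
  fixes g :: "'i \<Rightarrow> 'a::complex_normed_vector"
  assumes "finite F" "v \<in> complex_vector.span (g ` F)"
  shows "\<exists>a. v = (\<Sum>i\<in>F. a i *\<^sub>C g i)"
  using assms
proof (induction F arbitrary: v rule: finite_induct)
  case (insert j F)
  then obtain k where "v - k *\<^sub>C g j \<in> complex_vector.span (g ` F)"
    by (auto simp: complex_vector.span_breakdown_eq)
  then obtain a where a: "v - k *\<^sub>C g j = (\<Sum>i\<in>F. a i *\<^sub>C g i)" using insert.IH by blast
  have "(\<Sum>i\<in>insert j F. (a(j := k)) i *\<^sub>C g i) = k *\<^sub>C g j + (\<Sum>i\<in>F. (a(j := k)) i *\<^sub>C g i)"
    using insert.hyps by simp
  also have "(\<Sum>i\<in>F. (a(j := k)) i *\<^sub>C g i) = (\<Sum>i\<in>F. a i *\<^sub>C g i)"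
    using insert.hyps by (intro sum.cong) auto
  finally have "v = (\<Sum>i\<in>insert j F. (a(j := k)) i *\<^sub>C g i)"
    using a by (simp add: algebra_simps)
  then show ?case by blast
qed simp

lemma cspan_range:
  fixes x :: "nat \<Rightarrow> 'a::complex_normed_vector"
  assumes "v \<in> complex_vector.span (range x)"
  shows "\<exists>a n. v = (\<Sum>i<n. a i *\<^sub>C x i)"
proof -
  obtain t r where t: "finite t" "t \<subseteq> range x" "v = (\<Sum>u\<in>t. r u *\<^sub>C u)"
    using assms by (auto simp: complex_vector.span_explicit)
  obtain F where F: "finite F" "t = x ` F" using finite_subset_image[OF t(1,2)] by blast
  obtain n where n: "F \<subseteq> {..<n}" using finite_nat_bounded[OF F(1)] by blast
  have "v \<in> complex_vector.span t"
    unfolding t(3) by (intro complex_vector.span_sum complex_vector.span_scale complex_vector.span_base)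
  also have "\<dots> \<subseteq> complex_vector.span (x ` {..<n})"
    using F n by (intro complex_vector.span_mono) auto
  finally show ?thesis using cspan_finite_image[of "{..<n}" v x] by auto
qed

text \<open>If x_n lay in the span of its predecessors, a vanishing combination with last
  coefficient -1 would contradict \<open>grunblum_coeff\<close>.\<close>

lemma grunblum_not_finite_dim:
  assumes g: "grunblum C x" and nz: "\<And>n. x n \<noteq> 0"
  shows "\<not> cfinite_dim (complex_vector.span (range x))"
proof
  assume "cfinite_dim (complex_vector.span (range x))"
  then obtain B where B: "finite B" "complex_vector.span (range x) \<subseteq> complex_vector.span B"
    by (auto simp: cfinite_dim_def)
  have notin: "x n \<notin> complex_vector.span (x ` {..<n})" for n
  proof
    assume "x n \<in> complex_vector.span (x ` {..<n})"
    then obtain a where a: "x n = (\<Sum>i<n. a i *\<^sub>C x i)"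
      using cspan_finite_image[OF finite_lessThan, of "x n" x n] by blast
    define b where "b = a(n := - 1)"
    have "(\<Sum>i<Suc n. b i *\<^sub>C x i) = (\<Sum>i<n. b i *\<^sub>C x i) - x n"
      by (simp add: b_def scaleC_minus_left scaleC_one)
    also have "(\<Sum>i<n. b i *\<^sub>C x i) = (\<Sum>i<n. a i *\<^sub>C x i)" by (intro sum.cong) (auto simp: b_def)
    finally have "(\<Sum>i<Suc n. b i *\<^sub>C x i) = 0" using a by simp
    then have "cmod (b n) * norm (x n) \<le> 0" using grunblum_coeff[OF g, of n "Suc n" b] by simp
    then show False using nz[of n] by (simp add: b_def)
  qed
  have ind: "complex_vector.independent (x ` {..<n}) \<and> card (x ` {..<n}) = n" for n
  proof (induction n)
    case (Suc n)
    have "x n \<notin> x ` {..<n}" using notin[of n] complex_vector.span_base[of "x n" "x ` {..<n}"] by auto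
    then show ?case using Suc notin[of n]
      by (simp add: lessThan_Suc complex_vector.independent_insertI)
  qed (simp add: complex_vector.independent_empty)
  have "x ` {..<Suc (card B)} \<subseteq> complex_vector.span B"
    using B(2) complex_vector.span_superset[of "range x"] by blast
  then have "card (x ` {..<Suc (card B)}) \<le> card B"
    using complex_vector.independent_span_bound[OF B(1)] ind by blast
  then show False using ind[of "Suc (card B)"] by linarith
qed

text \<open>A vector of the closed span is a limit of finite combinations \<open>w k\<close>. Their
  coefficients form Cauchy sequences of scalars, and the estimate for partial sums is uniform in the
  length, so it survives the limit and compares the resulting series with \<open>v\<close>.\<close>

lemma grunblum_basic:
  fixes x :: "nat \<Rightarrow> 'a::complex_normed_vector"
  assumes g: "grunblum C x" and nz: "\<And>n. x n \<noteq> 0"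
  shows "basic_sequence x"
  unfolding basic_sequence_def
proof (intro ballI ex_ex1I)
  have C: "0 \<le> C"
  proof -
    have "norm (x 0) \<le> C * norm (x 0)" using grunblumD[OF g, of 1 1 "\<lambda>_. 1"] by (simp add: scaleC_one)
    moreover have "0 < norm (x 0)" using nz[of 0] by simp
    ultimately have "1 \<le> C" by simp
    then show ?thesis by simp
  qed
  fix v assume "v \<in> closed_cspan (range x)"
  then obtain w where w: "\<And>k. w k \<in> complex_vector.span (range x)" "w \<longlonglongrightarrow> v"
    by (auto simp: closed_cspan_def closure_sequential)
  have "\<forall>k. \<exists>a n. w k = (\<Sum>i<n. a i *\<^sub>C x i)" using cspan_range w(1) by blast
  then obtain a0 N where a0: "\<And>k. w k = (\<Sum>i<N k. a0 k i *\<^sub>C x i)" by metis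
  \<comment> \<open>Padding by zeros makes all partial sums of length at least \<open>N k\<close>
    equal to \<open>w k\<close>.\<close>
  define a where "a k i = (if i < N k then a0 k i else 0)" for k i
  have wk: "(\<Sum>i<m. a k i *\<^sub>C x i) = w k" if "N k \<le> m" for m k
  proof -
    have "(\<Sum>i<m. a k i *\<^sub>C x i) = (\<Sum>i<N k. a0 k i *\<^sub>C x i)"
      using that by (intro sum.mono_neutral_cong_right) (auto simp: a_def)
    then show ?thesis using a0 by simp
  qed
  have part: "norm (\<Sum>i<m. (a k i - a l i) *\<^sub>C x i) \<le> C * norm (w k - w l)" for m k l
  proof -
    define M where "M = max m (max (N k) (N l))"
    have "norm (\<Sum>i<m. (a k i - a l i) *\<^sub>C x i) \<le> C * norm (\<Sum>i<M. (a k i - a l i) *\<^sub>C x i)"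
      by (rule grunblumD[OF g]) (simp add: M_def)
    also have "(\<Sum>i<M. (a k i - a l i) *\<^sub>C x i) = w k - w l"
      using wk[of k M] wk[of l M]
      by (simp add: M_def complex_vector.scale_left_diff_distrib sum_subtractf)
    finally show ?thesis .
  qed
  have "\<exists>b. (\<lambda>k. a k i) \<longlonglongrightarrow> b" for i
  proof -
    have le: "cmod (a k i - a l i) * norm (x i) \<le> 2 * C * norm (w k - w l)" for k l
    proof -
      have "cmod (a k i - a l i) * norm (x i)
          = norm ((\<Sum>j<Suc i. (a k j - a l j) *\<^sub>C x j) - (\<Sum>j<i. (a k j - a l j) *\<^sub>C x j))"
        by (simp add: norm_scaleC)
      also have "\<dots> \<le> C * norm (w k - w l) + C * norm (w k - w l)"
        by (rule order_trans[OF norm_triangle_ineq4]) (intro add_mono part)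
      finally show ?thesis by simp
    qed
    have "Cauchy (\<lambda>k. a k i)"
    proof (rule metric_CauchyI)
      fix e :: real assume e: "0 < e"
      define d where "d = e * norm (x i) / (2 * C + 1)"
      have d: "0 < d" using e nz[of i] C by (simp add: d_def)
      from w(2) have "Cauchy w" by (rule LIMSEQ_imp_Cauchy)
      then obtain M where M: "\<forall>k\<ge>M. \<forall>l\<ge>M. dist (w k) (w l) < d"
        using d metric_CauchyD by blast
      have "dist (a k i) (a l i) < e" if "k \<ge> M" "l \<ge> M" for k l
      proof -
        have "cmod (a k i - a l i) * norm (x i) \<le> 2 * C * d"
          by (rule order_trans[OF le], rule mult_left_mono) (use M that C in \<open>auto simp: dist_norm intro: less_imp_le\<close>)
        also have "\<dots> < (2 * C + 1) * d" using d by (simp add: algebra_simps)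
        also have "\<dots> = e * norm (x i)" using C by (simp add: d_def)
        finally show ?thesis using nz[of i] by (simp add: dist_norm)
      qed
      then show "\<exists>M. \<forall>m\<ge>M. \<forall>n\<ge>M. dist (a m i) (a n i) < e" by blast
    qed
    then show ?thesis using Cauchy_convergent_iff convergent_def by blast
  qed
  then obtain b where b: "\<And>i. (\<lambda>k. a k i) \<longlonglongrightarrow> b i" by metis
  have diff: "norm ((\<Sum>i<m. a k i *\<^sub>C x i) - (\<Sum>i<m. b i *\<^sub>C x i)) \<le> C * norm (w k - v)" for k m
  proof (rule LIMSEQ_le)
    show "(\<lambda>l. norm (\<Sum>i<m. (a k i - a l i) *\<^sub>C x i))
        \<longlonglongrightarrow> norm ((\<Sum>i<m. a k i *\<^sub>C x i) - (\<Sum>i<m. b i *\<^sub>C x i))"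
      unfolding sum_subtractf[symmetric] complex_vector.scale_left_diff_distrib
      by (intro tendsto_intros bounded_linear.tendsto[OF bounded_linear_scaleC_left] b)
    show "(\<lambda>l. C * norm (w k - w l)) \<longlonglongrightarrow> C * norm (w k - v)"
      by (intro tendsto_intros w(2))
    show "\<exists>N. \<forall>l\<ge>N. norm (\<Sum>i<m. (a k i - a l i) *\<^sub>C x i) \<le> C * norm (w k - w l)"
      using part by blast
  qed
  have "(\<lambda>m. \<Sum>i<m. b i *\<^sub>C x i) \<longlonglongrightarrow> v"
  proof (rule metric_LIMSEQ_I)
    fix e :: real assume e: "0 < e"
    have "(\<lambda>k. (C + 1) * norm (w k - v)) \<longlonglongrightarrow> (C + 1) * norm (v - v)"
      by (intro tendsto_intros w(2))
    then have "\<forall>\<^sub>F k in sequentially. (C + 1) * norm (w k - v) < e"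
      using e by (auto dest: order_tendstoD(2)[where a = e])
    then obtain k where k: "(C + 1) * norm (w k - v) < e" by (auto simp: eventually_sequentially)
    have "dist (\<Sum>i<m. b i *\<^sub>C x i) v < e" if "N k \<le> m" for m
    proof -
      have "norm ((\<Sum>i<m. b i *\<^sub>C x i) - v)
          \<le> norm ((\<Sum>i<m. a k i *\<^sub>C x i) - (\<Sum>i<m. b i *\<^sub>C x i)) + norm (w k - v)"
        using norm_triangle_ineq[of "(\<Sum>i<m. b i *\<^sub>C x i) - w k" "w k - v"] wk[OF that]
        by (simp add: norm_minus_commute)
      also have "\<dots> \<le> (C + 1) * norm (w k - v)" using diff[of k m] by (simp add: algebra_simps)
      finally show ?thesis using k by (simp add: dist_norm)
    qed
    then show "\<exists>no. \<forall>m\<ge>no. dist (\<Sum>i<m. b i *\<^sub>C x i) v < e" by blast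
  qed
  then show "\<exists>a. (\<lambda>n. a n *\<^sub>C x n) sums v" by (auto simp: sums_def)
next
  fix v and a b :: "nat \<Rightarrow> complex"
  assume "(\<lambda>n. a n *\<^sub>C x n) sums v" "(\<lambda>n. b n *\<^sub>C x n) sums v"
  from sums_diff[OF this] have s: "(\<lambda>n. \<Sum>i<n. (a i - b i) *\<^sub>C x i) \<longlonglongrightarrow> 0"
    by (simp add: sums_def complex_vector.scale_left_diff_distrib)
  have "cmod (a i - b i) * norm (x i) \<le> 2 * C * norm (0::'a)" for i
  proof (rule LIMSEQ_le_const)
    show "(\<lambda>n. 2 * C * norm (\<Sum>i<n. (a i - b i) *\<^sub>C x i)) \<longlonglongrightarrow> 2 * C * norm (0::'a)"
      by (intro tendsto_intros s)
    show "\<exists>N. \<forall>n\<ge>N. cmod (a i - b i) * norm (x i) \<le> 2 * C * norm (\<Sum>i<n. (a i - b i) *\<^sub>C x i)"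
      using grunblum_coeff[OF g, of i _ "\<lambda>i. a i - b i"] by (intro exI[of _ "Suc i"]) auto
  qed
  then show "a = b" using nz by (auto simp: mult_le_0_iff)
qed

lemma grunblum_subseq:
  assumes g: "grunblum C x" and r: "strict_mono r"
  shows "grunblum C (x \<circ> r)"
  unfolding grunblum_def
proof (intro allI impI)
  fix a :: "nat \<Rightarrow> complex" and m n :: nat assume mn: "m \<le> n"
  have inj: "inj r" using r by (rule strict_mono_imp_inj_on)
  \<comment> \<open>Zero coefficients fill the gaps, so that a partial sum of the subsequence is a
    partial sum of \<open>x\<close>.\<close>
  define b where "b j = (if j \<in> range r then a (inv r j) else 0)" for j
  have eq: "(\<Sum>i<n. a i *\<^sub>C (x \<circ> r) i) = (\<Sum>j<r n. b j *\<^sub>C x j)" for n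
  proof -
    have "(\<Sum>j<r n. b j *\<^sub>C x j) = (\<Sum>j\<in>r ` {..<n}. b j *\<^sub>C x j)"
    proof (intro sum.mono_neutral_right ballI)
      show "r ` {..<n} \<subseteq> {..<r n}" using r by (auto simp: strict_mono_def)
      fix j assume j: "j \<in> {..<r n} - r ` {..<n}"
      have "j \<notin> range r"
        using j r by (auto simp: strict_mono_less)
      then show "b j *\<^sub>C x j = 0" by (simp add: b_def)
    qed simp
    also have "\<dots> = (\<Sum>i<n. b (r i) *\<^sub>C x (r i))"
      using inj by (subst sum.reindex) (auto intro: inj_on_subset)
    finally show ?thesis by (simp add: b_def inv_f_f[OF inj])
  qed
  show "norm (\<Sum>i<m. a i *\<^sub>C (x \<circ> r) i) \<le> C * norm (\<Sum>i<n. a i *\<^sub>C (x \<circ> r) i)"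
    unfolding eq using mn r by (intro grunblumD[OF g]) (simp add: strict_mono_less_eq)
qed

section \<open>Mazur's construction of basic sequences\<close>

lemma compact_coefficient_box:
  fixes y :: "nat \<Rightarrow> 'a::complex_normed_vector"
  shows "compact {\<Sum>i<m. a i *\<^sub>C y i | a. \<forall>i<m. cmod (a i) \<le> R}"
proof (induction m)
  case (Suc m)
  let ?E = "{\<Sum>i<m. a i *\<^sub>C y i | a. \<forall>i<m. cmod (a i) \<le> R}"
  have "compact ((\<lambda>(e, c). e + c *\<^sub>C y m) ` (?E \<times> cball 0 R))"
  proof (intro compact_continuous_image compact_Times Suc compact_cball)
    have "continuous_on UNIV (\<lambda>p. fst p + snd p *\<^sub>C y m)"
      by (intro continuous_intros bounded_linear.continuous_on[OF bounded_linear_scaleC_left])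
    then show "continuous_on (?E \<times> cball 0 R) (\<lambda>(e, c). e + c *\<^sub>C y m)"
      by (auto simp: case_prod_unfold intro: continuous_on_subset)
  qed
  also have "(\<lambda>(e, c). e + c *\<^sub>C y m) ` (?E \<times> cball 0 R)
      = {\<Sum>i<Suc m. a i *\<^sub>C y i | a. \<forall>i<Suc m. cmod (a i) \<le> R}" (is "?L = ?R")
  proof (intro equalityI subsetI)
    fix e assume "e \<in> ?L"
    then obtain a c where *: "\<forall>i<m. cmod (a i) \<le> R" "cmod c \<le> R" "e = (\<Sum>i<m. a i *\<^sub>C y i) + c *\<^sub>C y m"
      by auto
    then have "e = (\<Sum>i<Suc m. (a(m := c)) i *\<^sub>C y i)" by simp
    moreover have "\<forall>i<Suc m. cmod ((a(m := c)) i) \<le> R" using * by auto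
    ultimately show "e \<in> ?R" by blast
  next
    fix e assume "e \<in> ?R"
    then obtain a where a: "e = (\<Sum>i<Suc m. a i *\<^sub>C y i)" "\<forall>i<Suc m. cmod (a i) \<le> R" by blast
    then show "e \<in> ?L" by (intro image_eqI[of _ _ "(\<Sum>i<m. a i *\<^sub>C y i, a m)"]) auto
  qed
  finally show ?case .
qed simp

lemma dual_ballD:
  assumes "\<phi> \<in> dual_ball"
  shows dual_ball_bounded_clinear: "bounded_clinear \<phi>"
    and dual_ball_le: "cmod (\<phi> v) \<le> norm v"
    and dual_ball_add: "\<phi> (u + v) = \<phi> u + \<phi> v"
    and dual_ball_diff: "\<phi> (u - v) = \<phi> u - \<phi> v"
    and dual_ball_scale: "\<phi> (c *\<^sub>C v) = c * \<phi> v"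
  using assms
  by (auto simp: dual_ball_def bounded_clinear_def linear_simps scaleC_complex_def)

text \<open>Finitely many functionals that almost norm the unit sphere of \<open>W\<close> witness Mazur's
  construction: a vector on which all of them are small is almost orthogonal to \<open>W\<close>.\<close>

lemma mazur_step:
  fixes W :: "'a::complex_normed_vector set"
  assumes W: "\<And>e c. e \<in> W \<Longrightarrow> c *\<^sub>C e \<in> W" and E: "compact E" "{e\<in>W. norm e = 1} \<subseteq> E"
    and \<epsilon>: "0 < \<epsilon>" and c: "0 < c"
  obtains \<Phi> \<eta> where "finite \<Phi>" "\<Phi> \<subseteq> dual_ball" "0 < \<eta>"
    "\<forall>v e b. c \<le> norm v \<longrightarrow> (\<forall>\<phi>\<in>\<Phi>. cmod (\<phi> v) \<le> \<eta>) \<longrightarrow> e \<in> W \<longrightarrow>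
      norm e \<le> (1 + \<epsilon>) * norm (e + b *\<^sub>C v)"
proof -
  define \<tau> where "\<tau> = \<epsilon> / (1 + \<epsilon>)"
  have \<tau>: "0 < \<tau>" "\<tau> < 1" "(1 + \<epsilon>) * (1 - \<tau>) = 1"
    using \<epsilon> by (auto simp: \<tau>_def field_simps)
  obtain K where K: "finite K" "E \<subseteq> (\<Union>x\<in>K. ball x (\<tau> / 4))"
  proof (rule compactE_image[OF E(1), of E "\<lambda>x. ball x (\<tau> / 4)"])
    show "E \<subseteq> (\<Union>x\<in>E. ball x (\<tau> / 4))" using \<tau>(1) by auto
  qed auto
  have "\<exists>\<phi>\<in>dual_ball. \<phi> x = of_real (norm x)" for x :: 'a by (metis norming_functional)
  then obtain f where f: "\<And>x::'a. f x \<in> dual_ball" "\<And>x::'a. f x x = of_real (norm x)" by metis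
  \<comment> \<open>For large multiples of \<open>v\<close> the triangle inequality suffices.
    Otherwise |b| c \<le> 2, so |b \<phi>(v)| is at most \<tau>/2; the distance to the net enters
    twice with \<tau>/4, and the total loss is \<tau>.\<close>
  define \<eta> where "\<eta> = c * \<tau> / 4"
  have unit: "1 - \<tau> \<le> norm (e + b *\<^sub>C v)"
    if v: "c \<le> norm v" "\<forall>\<phi>\<in>f ` K. cmod (\<phi> v) \<le> \<eta>" and e: "e \<in> W" "norm e = 1" for v e b
  proof (cases "2 \<le> cmod b * norm v")
    case True
    have "cmod b * norm v - 1 \<le> norm (e + b *\<^sub>C v)"
      using norm_diff_ineq[of "b *\<^sub>C v" e] e(2) by (simp add: norm_scaleC add.commute)
    then show ?thesis using True \<tau>(1) by linarith
  next
    case False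
    have "cmod b * c \<le> cmod b * norm v" using v(1) by (intro mult_left_mono) auto
    then have "cmod b * c \<le> 2" using False by linarith
    obtain x where x: "x \<in> K" "dist x e < \<tau> / 4" using K(2) E(2) e by auto
    note fx = dual_ballD[OF f(1)[of x]]
    have "cmod b * cmod (f x v) \<le> cmod b * (c * \<tau> / 4)"
      using v(2) x(1) by (intro mult_left_mono) (auto simp: \<eta>_def)
    also have "\<dots> \<le> \<tau> / 2" using mult_right_mono[OF \<open>cmod b * c \<le> 2\<close>, of "\<tau> / 4"] \<tau>(1) by simp
    finally have 1: "cmod (b * f x v) \<le> \<tau> / 2" by (simp add: norm_mult)
    have 2: "cmod (f x (x - e)) < \<tau> / 4" using fx(2)[of "x - e"] x(2) by (simp add: dist_norm)
    have "norm x \<ge> 1 - \<tau> / 4"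
      using norm_triangle_ineq2[of e x] x(2) e(2) by (simp add: dist_norm norm_minus_commute)
    then have 3: "cmod (f x x) \<ge> 1 - \<tau> / 4" using f(2)[of x] by simp
    have "f x (e + b *\<^sub>C v) = f x x - f x (x - e) + b * f x v"
      by (simp add: fx(3-5))
    then have "cmod (f x (e + b *\<^sub>C v)) \<ge> cmod (f x x) - cmod (f x (x - e)) - cmod (b * f x v)"
      using norm_diff_ineq[of "f x x - f x (x - e)" "b * f x v"]
        norm_triangle_ineq2[of "f x x" "f x (x - e)"] by simp
    then show ?thesis using 1 2 3 fx(2)[of "e + b *\<^sub>C v"] by linarith
  qed
  show thesis
  proof (rule that[of "f ` K" \<eta>])
    show "finite (f ` K)" "f ` K \<subseteq> dual_ball" "0 < \<eta>"
      using K(1) f(1) c \<tau>(1) by (auto simp: \<eta>_def)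
    have "norm e \<le> (1 + \<epsilon>) * norm (e + b *\<^sub>C v)"
      if v: "c \<le> norm v" "\<forall>\<phi>\<in>f ` K. cmod (\<phi> v) \<le> \<eta>" and e: "e \<in> W" for v e b
    proof (cases "e = 0")
      case True
      then show ?thesis using \<epsilon> by simp
    next
      case False
      define t where "t = complex_of_real (1 / norm e)"
      have t: "cmod t = 1 / norm e" by (simp add: t_def norm_divide)
      have "1 - \<tau> \<le> norm (t *\<^sub>C e + (t * b) *\<^sub>C v)"
        using False by (intro unit v W e) (simp add: norm_scaleC t)
      also have "\<dots> = norm (t *\<^sub>C (e + b *\<^sub>C v))" by (simp add: scaleC_add_right scaleC_scaleC)
      also have "\<dots> = norm (e + b *\<^sub>C v) / norm e" by (simp add: norm_scaleC t)
      finally have "(1 - \<tau>) * norm e \<le> norm (e + b *\<^sub>C v)" using False by (simp add: field_simps)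
      then have "(1 + \<epsilon>) * ((1 - \<tau>) * norm e) \<le> (1 + \<epsilon>) * norm (e + b *\<^sub>C v)"
        using \<epsilon> by (intro mult_left_mono) auto
      then show ?thesis using \<tau>(3) by (simp add: mult.assoc[symmetric])
    qed
    then show "\<forall>v e b. c \<le> norm v \<longrightarrow> (\<forall>\<phi>\<in>f ` K. cmod (\<phi> v) \<le> \<eta>) \<longrightarrow> e \<in> W \<longrightarrow>
      norm e \<le> (1 + \<epsilon>) * norm (e + b *\<^sub>C v)" by blast
  qed
qed

text \<open>\<open>P\<close> carries a side condition between consecutive choices: increasing
  indices when \<open>y\<close> is a given sequence, or a condition on the new vector when the
  indices are the vectors themselves and \<open>y\<close> is the identity.\<close>

lemma mazur_selection:
  fixes y :: "'i \<Rightarrow> 'a::complex_normed_vector" and P :: "nat \<Rightarrow> 'i \<Rightarrow> 'i \<Rightarrow> bool"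
  assumes c: "0 < c"
    and step: "\<And>m i \<Phi> \<eta>. finite \<Phi> \<Longrightarrow> \<Phi> \<subseteq> dual_ball \<Longrightarrow> 0 < \<eta> \<Longrightarrow>
      \<exists>j. P m i j \<and> c \<le> norm (y j) \<and> (\<forall>\<phi>\<in>\<Phi>. cmod (\<phi> (y j)) \<le> \<eta>)"
  obtains s where "\<forall>m. P m (s m) (s (Suc m))" "\<forall>m. c \<le> norm (y (s m))" "grunblum 2 (y \<circ> s)"
proof -
  \<comment> \<open>The basis constants of the finite stages increase strictly, which leaves room
    for each new vector, and stay below 2.\<close>
  define L :: "nat \<Rightarrow> real" where "L n = 2 - 1 / (real n + 1)" for n
  have L1: "1 \<le> L n" and L2: "L n \<le> 2" and Lmono: "L n < L (Suc n)" for n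
    by (auto simp: L_def field_simps)
  \<comment> \<open>Off by one: stage \<open>n\<close> has fixed the n + 1 vectors with indices
    \<open>f 0\<close>, ..., \<open>f n\<close>.\<close>
  define inv where "inv n f \<longleftrightarrow> (\<forall>i\<le>n. c \<le> norm (y (f i))) \<and>
      (\<forall>a j k. j \<le> k \<and> k \<le> Suc n \<longrightarrow>
        norm (\<Sum>i<j. a i *\<^sub>C y (f i)) \<le> L n * norm (\<Sum>i<k. a i *\<^sub>C y (f i)))"
    for n :: nat and f :: "nat \<Rightarrow> 'i"
  have "\<exists>X. \<forall>n. inv n (X n) \<and> (\<exists>j. X (Suc n) = (X n)(Suc n := j) \<and> P n (X n n) j)"
  proof (rule dependent_nat_choice)
    obtain i where i: "c \<le> norm (y i)" using step[of "{}" 1] by auto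
    have "inv 0 (\<lambda>_. i)" unfolding inv_def
    proof (intro conjI allI impI)
      fix a :: "nat \<Rightarrow> complex" and j k assume jk: "j \<le> k \<and> k \<le> Suc 0"
      then consider "j = 0" | "j = 1" "k = 1" by linarith
      then show "norm (\<Sum>i'<j. a i' *\<^sub>C y i) \<le> L 0 * norm (\<Sum>i'<k. a i' *\<^sub>C y i)"
        using L1[of 0] by cases (auto simp: L_def)
    qed (rule i)
    then show "\<exists>f. inv 0 f" by blast
  next
    fix f n assume I: "inv n f"
    define W where "W = range (\<lambda>a. \<Sum>i<Suc n. a i *\<^sub>C y (f i))"
    \<comment> \<open>A compact set containing the unit sphere of the span \<open>W\<close>: partial
      sums of a unit vector have norm at most 2, and a term is the difference of two of them, which
      bounds its coefficient by 4 / c.\<close>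
    define E where "E = {\<Sum>i<Suc n. a i *\<^sub>C y (f i) | a. \<forall>i<Suc n. cmod (a i) \<le> 4 / c}"
    define \<epsilon> where "\<epsilon> = L (Suc n) / L n - 1"
    have \<epsilon>: "0 < \<epsilon>" "(1 + \<epsilon>) * L n = L (Suc n)" using Lmono[of n] L1[of n] by (auto simp: \<epsilon>_def)
    have compE: "compact E" unfolding E_def by (rule compact_coefficient_box)
    have sphere: "{e\<in>W. norm e = 1} \<subseteq> E"
    proof
      fix e assume "e \<in> {e\<in>W. norm e = 1}"
      then obtain a where a: "e = (\<Sum>i<Suc n. a i *\<^sub>C y (f i))" "norm e = 1" by (auto simp: W_def)
      have "cmod (a i) \<le> 4 / c" if "i < Suc n" for i
      proof -
        have le: "norm (\<Sum>i<j. a i *\<^sub>C y (f i)) \<le> 2" if "j \<le> Suc n" for j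
        proof -
          have "norm (\<Sum>i<j. a i *\<^sub>C y (f i)) \<le> L n * norm e"
            using I that unfolding inv_def a(1) by blast
          then show ?thesis using a(2) L2[of n] by simp
        qed
        have "cmod (a i) * c \<le> cmod (a i) * norm (y (f i))"
          using I that by (intro mult_left_mono) (auto simp: inv_def)
        also have "\<dots> = norm ((\<Sum>j<Suc i. a j *\<^sub>C y (f j)) - (\<Sum>j<i. a j *\<^sub>C y (f j)))"
          by (simp add: norm_scaleC)
        also have "\<dots> \<le> 2 + 2"
          by (rule order_trans[OF norm_triangle_ineq4]) (intro add_mono le; use that in simp)
        finally show ?thesis using c by (simp add: field_simps)
      qed
      then show "e \<in> E" using a(1) by (auto simp: E_def)
    qed
    have Wscale: "b *\<^sub>C e \<in> W" if e: "e \<in> W" for e b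
    proof -
      obtain a where "e = (\<Sum>i<Suc n. a i *\<^sub>C y (f i))" using e unfolding W_def by blast
      then have eq: "b *\<^sub>C e = (\<Sum>i<Suc n. (b * a i) *\<^sub>C y (f i))"
        by (simp add: complex_vector.scale_sum_right scaleC_scaleC scaleC_add_right)
      show ?thesis unfolding W_def by (rule range_eqI[where x = "\<lambda>i. b * a i"], rule eq)
    qed
    obtain \<Phi> \<eta> where \<Phi>: "finite \<Phi>" "\<Phi> \<subseteq> dual_ball" "0 < \<eta>"
      and M: "\<forall>v e b. c \<le> norm v \<longrightarrow> (\<forall>\<phi>\<in>\<Phi>. cmod (\<phi> v) \<le> \<eta>) \<longrightarrow> e \<in> W \<longrightarrow>
        norm e \<le> (1 + \<epsilon>) * norm (e + b *\<^sub>C v)"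
      by (rule mazur_step[OF Wscale compE sphere \<epsilon>(1) c])
    obtain j where j: "P n (f n) j" "c \<le> norm (y j)" "\<forall>\<phi>\<in>\<Phi>. cmod (\<phi> (y j)) \<le> \<eta>"
      using step[OF \<Phi>] by blast
    have "inv (Suc n) (f(Suc n := j))" unfolding inv_def
    proof (intro conjI allI impI)
      fix i assume "i \<le> Suc n"
      then show "c \<le> norm (y ((f(Suc n := j)) i))" using j(2) I by (auto simp: inv_def)
    next
      fix a :: "nat \<Rightarrow> complex" and l k assume lk: "l \<le> k \<and> k \<le> Suc (Suc n)"
      let ?S = "\<lambda>k. \<Sum>i<k. a i *\<^sub>C y (f i)" and ?S' = "\<lambda>k. \<Sum>i<k. a i *\<^sub>C y ((f(Suc n := j)) i)"
      have eq: "?S' k = ?S k" if "k \<le> Suc n" for k using that by (intro sum.cong) auto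
      have old: "norm (?S l) \<le> L n * norm (?S k)" if "l \<le> k" "k \<le> Suc n" for l k
        using I that unfolding inv_def by blast
      have LL: "L n \<le> L (Suc n)" "1 \<le> L (Suc n)" using Lmono[of n] L1[of "Suc n"] by auto
      consider "k \<le> Suc n" | "l = Suc (Suc n)" "k = Suc (Suc n)" | "l \<le> Suc n" "k = Suc (Suc n)"
        using lk by linarith
      then show "norm (?S' l) \<le> L (Suc n) * norm (?S' k)"
      proof cases
        case 1
        then have "norm (?S' l) \<le> L n * norm (?S' k)" using old[of l k] lk by (simp add: eq)
        also have "\<dots> \<le> L (Suc n) * norm (?S' k)" using LL by (intro mult_right_mono) auto
        finally show ?thesis .
      next
        case 2
        then show ?thesis using mult_right_mono[OF LL(2) norm_ge_zero, of "?S' k"] by simp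
      next
        case 3
        have "norm (?S' l) \<le> L n * norm (?S (Suc n))" using old[of l "Suc n"] 3 by (simp add: eq)
        also have "\<dots> \<le> L n * ((1 + \<epsilon>) * norm (?S (Suc n) + a (Suc n) *\<^sub>C y j))"
          using L1[of n] j(3) by (intro mult_left_mono M[rule_format] j(2)) (auto simp: W_def)
        also have "?S (Suc n) + a (Suc n) *\<^sub>C y j = ?S' k"
          using 3 by (simp add: eq[of "Suc n", symmetric] del: fun_upd_apply) simp
        finally show ?thesis unfolding \<epsilon>(2)[symmetric] by (simp add: mult_ac)
      qed
    qed
    then show "\<exists>f'. inv (Suc n) f' \<and> (\<exists>j. f' = f(Suc n := j) \<and> P n (f n) j)" using j(1) by blast
  qed
  then obtain X where X: "\<And>n. inv n (X n)"
    and Xs: "\<And>n. \<exists>j. X (Suc n) = (X n)(Suc n := j) \<and> P n (X n n) j" by blast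
  define s where "s n = X n n" for n
  have Xeq: "X n i = s i" if "i \<le> n" for n i
    using that
  proof (induction n)
    case (Suc n)
    show ?case
    proof (cases "i = Suc n")
      case False
      then show ?thesis using Suc Xs[of n] by auto
    qed (simp add: s_def)
  qed (simp add: s_def)
  show thesis
  proof (rule that[of s])
    show "\<forall>m. P m (s m) (s (Suc m))"
    proof
      show "P m (s m) (s (Suc m))" for m using Xs[of m] by (auto simp: s_def)
    qed
    show "\<forall>m. c \<le> norm (y (s m))" using X by (auto simp: s_def inv_def)
    show "grunblum 2 (y \<circ> s)" unfolding grunblum_def
    proof (intro allI impI)
      fix a :: "nat \<Rightarrow> complex" and m n :: nat assume mn: "m \<le> n"
      have eq: "(\<Sum>i<k. a i *\<^sub>C y (X n i)) = (\<Sum>i<k. a i *\<^sub>C (y \<circ> s) i)" if "k \<le> n" for k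
        using that by (intro sum.cong) (auto simp: Xeq)
      have "norm (\<Sum>i<m. a i *\<^sub>C y (X n i)) \<le> L n * norm (\<Sum>i<n. a i *\<^sub>C y (X n i))"
        using X[of n] mn unfolding inv_def by (meson le_SucI order_refl)
      also have "\<dots> \<le> 2 * norm (\<Sum>i<n. a i *\<^sub>C y (X n i))" using L2 by (intro mult_right_mono) auto
      finally show "norm (\<Sum>i<m. a i *\<^sub>C (y \<circ> s) i) \<le> 2 * norm (\<Sum>i<n. a i *\<^sub>C (y \<circ> s) i)"
        using mn by (simp add: eq)
    qed
  qed
qed

section \<open>The Nash-Williams theorem\<close>

definition above :: "nat set \<Rightarrow> nat set \<Rightarrow> nat set" where
  "above s L = {x\<in>L. \<forall>y\<in>s. y < x}"

lemma above_subset: "above s L \<subseteq> L"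
  by (auto simp: above_def)

lemma above_mono: "L \<subseteq> M \<Longrightarrow> above s L \<subseteq> above s M"
  by (auto simp: above_def)

lemma infinite_above:
  assumes "finite s" "infinite L"
  shows "infinite (above s L)"
proof
  assume fin: "finite (above s L)"
  obtain k where k: "s \<subseteq> {..<k}" using finite_nat_bounded[OF assms(1)] by blast
  have "L \<subseteq> above s L \<union> {..k}"
  proof
    fix x assume "x \<in> L"
    then show "x \<in> above s L \<union> {..k}" using k by (cases "x \<le> k") (auto simp: above_def)
  qed
  then have "finite L" using fin finite_subset by blast
  then show False using assms(2) by simp
qed

text \<open>By \<open>mono\<close> the property survives thinning, so finitely many sets can be
  treated one after another.\<close>

lemma finitely_many_stages:
  fixes P :: "nat set \<Rightarrow> nat set \<Rightarrow> bool"
  assumes ex: "\<And>s L. finite s \<Longrightarrow> infinite L \<Longrightarrow> \<exists>L'\<subseteq>L. infinite L' \<and> P s L'"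
    and mono: "\<And>s L M. finite s \<Longrightarrow> P s M \<Longrightarrow> infinite L \<Longrightarrow> above s L \<subseteq> M \<Longrightarrow> P s L"
    and S: "finite S" "\<And>s. s \<in> S \<Longrightarrow> finite s" and L: "infinite L"
  shows "\<exists>L'\<subseteq>L. infinite L' \<and> (\<forall>s\<in>S. P s L')"
  using S
proof (induction S rule: finite_induct)
  case empty
  then show ?case using L by auto
next
  case (insert s S)
  then obtain L' where L': "L' \<subseteq> L" "infinite L'" "\<forall>s\<in>S. P s L'" by auto
  obtain L'' where L'': "L'' \<subseteq> L'" "infinite L''" "P s L''"
    using ex[of s L'] L' insert.prems by auto
  have "P t L''" if "t \<in> S" for t
  proof (rule mono[of t L' L''])
    show "finite t" "P t L'" using that L'(3) insert.prems by auto
    show "above t L'' \<subseteq> L'" using L''(1) above_subset[of t L''] by simp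
  qed (rule L''(2))
  then show ?case using L' L'' by (intro exI[of _ L'']) auto
qed

text \<open>The assumption \<open>mono\<close> says that \<open>P s L\<close> only depends on the part of \<open>L\<close> above \<open>s\<close>, which makes
  a diagonalisation possible.\<close>

lemma fusion:
  fixes P :: "nat set \<Rightarrow> nat set \<Rightarrow> bool"
  assumes ex: "\<And>s L. finite s \<Longrightarrow> infinite L \<Longrightarrow> \<exists>L'\<subseteq>L. infinite L' \<and> P s L'"
    and mono: "\<And>s L M. finite s \<Longrightarrow> P s M \<Longrightarrow> infinite L \<Longrightarrow> above s L \<subseteq> M \<Longrightarrow> P s L"
    and M: "infinite M"
  shows "\<exists>L\<subseteq>M. infinite L \<and> (\<forall>s\<subseteq>L. finite s \<longrightarrow> P s L)"
proof -
  \<comment> \<open>\<open>fst X\<close> is the finite part already fixed, \<open>snd X\<close> the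
    reservoir for all later choices.\<close>
  define good where "good X \<longleftrightarrow> finite (fst X) \<and> infinite (snd X) \<and> snd X \<subseteq> M \<and>
    (\<forall>a\<in>fst X. \<forall>l\<in>snd X. a < l) \<and> (\<forall>s\<subseteq>fst X. P s (snd X))" for X :: "nat set \<times> nat set"
  define ext where "ext X Y \<longleftrightarrow> (\<exists>n\<in>snd X. fst Y = insert n (fst X)) \<and> snd Y \<subseteq> snd X"
    for X Y :: "nat set \<times> nat set"
  have "\<exists>X. \<forall>n::nat. (good (X n) \<and> (n = 0 \<longrightarrow> fst (X n) = {})) \<and> ext (X n) (X (Suc n))"
  proof (rule dependent_nat_choice)
    obtain L where "L \<subseteq> M" "infinite L" "P {} L" using ex[of "{}" M] M by auto
    then show "\<exists>X. good X \<and> ((0::nat) = 0 \<longrightarrow> fst X = {})" by (intro exI[of _ "({}, L)"]) (auto simp: good_def)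
  next
    fix X n assume X: "good X \<and> ((n::nat) = 0 \<longrightarrow> fst X = {})"
    then obtain m where m: "m \<in> snd X" unfolding good_def by (metis ex_in_conv infinite_imp_nonempty)
    define A where "A = insert m (fst X)"
    have fA: "finite A" using X by (auto simp: A_def good_def)
    have inf: "infinite (above A (snd X))" using X fA by (intro infinite_above) (auto simp: good_def)
    have "\<exists>L'\<subseteq>above A (snd X). infinite L' \<and> (\<forall>s\<in>Pow A. P s L')"
    proof (rule finitely_many_stages[where P = P])
      show "\<exists>L'\<subseteq>L. infinite L' \<and> P s L'" if "finite s" "infinite L" for s L by (rule ex[OF that])
      show "P s L" if "finite s" "P s M" "infinite L" "above s L \<subseteq> M" for s L M by (rule mono[OF that])
    qed (use fA inf in \<open>auto intro: finite_subset\<close>)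
    then obtain L' where L': "L' \<subseteq> above A (snd X)" "infinite L'" "\<forall>s\<in>Pow A. P s L'" by blast
    have "good (A, L')" using L' fA X above_subset[of A "snd X"]
      by (auto simp: good_def above_def)
    moreover have "ext X (A, L')" using m L'(1) above_subset[of A "snd X"] by (auto simp: ext_def A_def)
    ultimately show "\<exists>Y. (good Y \<and> (Suc n = 0 \<longrightarrow> fst Y = {})) \<and> ext X Y" by auto
  qed
  then obtain X where X: "\<And>n. good (X n)" "fst (X 0) = {}" "\<And>n. ext (X n) (X (Suc n))" by blast
  define A where "A n = fst (X n)" for n
  define L where "L n = snd (X n)" for n
  have A0: "A 0 = {}" using X(2) by (simp add: A_def)
  have AS: "\<exists>m\<in>L n. A (Suc n) = insert m (A n)" and LS: "L (Suc n) \<subseteq> L n" for n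
    using X(3)[of n] by (auto simp: ext_def A_def L_def)
  have fA: "finite (A n)" and LM: "L n \<subseteq> M"
    and AL: "a \<in> A n \<Longrightarrow> l \<in> L n \<Longrightarrow> a < l" and PA: "s \<subseteq> A n \<Longrightarrow> P s (L n)" for n a l s
    using X(1)[of n] by (auto simp: good_def A_def L_def)
  have Ldec: "L n \<subseteq> L m" if "m \<le> n" for m n by (rule lift_Suc_antimono_le[of L, OF LS that])
  have Ainc: "A m \<subseteq> A n" if "m \<le> n" for m n
    using AS by (intro lift_Suc_mono_le[of A, OF _ that]) blast
  have later: "A n \<subseteq> A k \<union> L k" for n k
  proof (induction n)
    case (Suc n)
    obtain m where m: "m \<in> L n" "A (Suc n) = insert m (A n)" using AS by blast
    show ?case
    proof (cases "k \<le> n")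
      case True
      then show ?thesis using m Suc Ldec[OF True] by auto
    next
      case False
      then show ?thesis using Ainc[of "Suc n" k] by auto
    qed
  qed (simp add: A0)
  have cardA: "card (A n) = n" for n
  proof (induction n)
    case (Suc n)
    obtain m where m: "m \<in> L n" "A (Suc n) = insert m (A n)" using AS by blast
    then have "m \<notin> A n" using AL[of m n m] by auto
    then show ?case using m Suc fA[of n] by simp
  qed (simp add: A0)
  define U where "U = (\<Union>n. A n)"
  have "U \<subseteq> M" using later[of _ 0] LM[of 0] A0 by (auto simp: U_def)
  moreover have infU: "infinite U"
  proof
    assume f: "finite U"
    have "card (A (Suc (card U))) \<le> card U" by (intro card_mono f) (auto simp: U_def)
    then show False by (simp add: cardA)
  qed
  moreover have "P s U" if s: "s \<subseteq> U" "finite s" for s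
  proof -
    have "\<exists>n. s \<subseteq> A n"
      using s(2,1)
    proof (induction s rule: finite_induct)
      case (insert x s)
      then obtain n m where "s \<subseteq> A n" "x \<in> A m" by (auto simp: U_def)
      then show ?case using Ainc[of n "max n m"] Ainc[of m "max n m"] by (intro exI[of _ "max n m"]) auto
    qed simp
    \<comment> \<open>For the least such \<open>k\<close>, if positive, the element added last
      belongs to \<open>s\<close>; whatever lies above \<open>s\<close> was therefore chosen later,
      from the reservoir \<open>L k\<close>.\<close>
    then obtain k where k: "s \<subseteq> A k" "\<And>j. j < k \<Longrightarrow> \<not> s \<subseteq> A j"
      using exists_least_iff[of "\<lambda>n. s \<subseteq> A n"] by blast
    have "above s U \<subseteq> L k"
    proof (cases k)
      case 0
      then show ?thesis using later[of _ 0] A0 by (auto simp: U_def above_def)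
    next
      case (Suc j)
      obtain m where m: "m \<in> L j" "A k = insert m (A j)" using AS Suc by blast
      have "m \<in> s" using k(2)[of j] k(1) m(2) Suc by auto
      show ?thesis
      proof
        fix x assume x: "x \<in> above s U"
        then have "m < x" using \<open>m \<in> s\<close> by (auto simp: above_def)
        then have "x \<notin> A k" using m AL[of x j m] by auto
        then show "x \<in> L k" using x later[of _ k] by (auto simp: above_def U_def)
      qed
    qed
    then show ?thesis using mono[OF s(2) PA[OF k(1)] infU] by blast
  qed
  ultimately show ?thesis by blast
qed

definition initial_segment :: "nat set \<Rightarrow> nat \<Rightarrow> nat set" where
  "initial_segment L k = L \<inter> {..<k}"

text \<open>Combinatorial forcing after Galvin and Prikry. A set accepts \<open>s\<close> if each
  continuation of \<open>s\<close> inside it has an initial segment in \<open>B\<close>, and rejects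
  \<open>s\<close> if none of its infinite subsets accepts \<open>s\<close>. The two alternatives
  correspond to acceptance and rejection of the empty set.\<close>

lemma nash_williams:
  fixes B :: "nat set \<Rightarrow> bool"
  obtains M where "infinite M"
    "(\<forall>s\<subseteq>M. finite s \<longrightarrow> \<not> B s) \<or> (\<forall>L\<subseteq>M. infinite L \<longrightarrow> (\<exists>k. B (initial_segment L k)))"
proof -
  define acc where "acc s M \<longleftrightarrow> (\<forall>L\<subseteq>M. infinite L \<longrightarrow> (\<exists>k. B (initial_segment (s \<union> above s L) k)))" for s M
  define rej where "rej s M \<longleftrightarrow> (\<forall>L\<subseteq>M. infinite L \<longrightarrow> \<not> acc s L)" for s M
  have above_above: "above s (above s L) = above s L" for s L by (auto simp: above_def)
  have acc_mono: "acc s L" if "acc s M" "finite s" "above s L \<subseteq> M" for s L M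
    unfolding acc_def
  proof (intro allI impI)
    fix L0 assume L0: "L0 \<subseteq> L" "infinite L0"
    have "above s L0 \<subseteq> M" using above_mono[OF L0(1), of s] that(3) by blast
    then have "\<exists>k. B (initial_segment (s \<union> above s (above s L0)) k)"
      using that(1) infinite_above[OF that(2) L0(2)] unfolding acc_def by blast
    then show "\<exists>k. B (initial_segment (s \<union> above s L0) k)" by (simp only: above_above)
  qed
  have rej_mono: "rej s L" if "rej s M" "finite s" "above s L \<subseteq> M" for s L M
    unfolding rej_def
  proof (intro allI impI notI)
    fix L0 assume L0: "L0 \<subseteq> L" "infinite L0" "acc s L0"
    have "acc s (above s L0)"
      by (rule acc_mono[OF L0(3) that(2)]) (auto simp: above_def)
    moreover have "above s L0 \<subseteq> M" using above_mono[OF L0(1), of s] that(3) by blast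
    ultimately show False using that(1) infinite_above[OF that(2) L0(2)] by (auto simp: rej_def)
  qed
  have "\<exists>M\<subseteq>UNIV. infinite M \<and> (\<forall>s\<subseteq>M. finite s \<longrightarrow> acc s M \<or> rej s M)"
  proof (rule fusion)
    fix s L :: "nat set" assume s: "finite s" and L: "infinite L"
    show "\<exists>L'\<subseteq>L. infinite L' \<and> (acc s L' \<or> rej s L')"
      using L by (cases "rej s L") (auto simp: rej_def)
  next
    fix s L M assume "finite s" "acc s M \<or> rej s M" "above s L \<subseteq> M"
    then show "acc s L \<or> rej s L" using acc_mono rej_mono by blast
  qed simp
  then obtain M where M: "infinite M" "\<And>s. s \<subseteq> M \<Longrightarrow> finite s \<Longrightarrow> acc s M \<or> rej s M" by blast
  show thesis
  proof (cases "acc {} M")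
    case True
    then have "\<forall>L\<subseteq>M. infinite L \<longrightarrow> (\<exists>k. B (initial_segment L k))"
      by (auto simp: acc_def above_def)
    then show thesis using M(1) that by blast
  next
    case False
    then have rej0: "rej {} M" using M(2)[of "{}"] by auto
    \<comment> \<open>A first fusion has decided every finite subset; this second one makes
      rejection pass to one-point end extensions, hence to all finite subsets.\<close>
    have "\<exists>L\<subseteq>M. infinite L \<and>
      (\<forall>s\<subseteq>L. finite s \<longrightarrow> rej s M \<longrightarrow> (\<forall>n\<in>above s L \<inter> M. \<not> acc (insert n s) M))"
    proof (rule fusion[OF _ _ M(1)])
      fix s L :: "nat set" assume s: "finite s" and L: "infinite L"
      define bad where "bad = {n\<in>above s M. acc (insert n s) M}"
      show "\<exists>L'\<subseteq>L. infinite L' \<and> (rej s M \<longrightarrow> (\<forall>n\<in>above s L' \<inter> M. \<not> acc (insert n s) M))"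
      proof (cases "rej s M")
        case True
        have fin: "finite bad"
        proof (rule ccontr)
          assume inf: "infinite bad"
          \<comment> \<open>A continuation inside \<open>bad\<close> starts with some n for which
            \<open>insert n s\<close> is accepted, and it is also a continuation of that set; so
            \<open>bad\<close> accepts \<open>s\<close>, against rejection.\<close>
          have "acc s bad" unfolding acc_def
          proof (intro allI impI)
            fix L0 assume L0: "L0 \<subseteq> bad" "infinite L0"
            define n where "n = (LEAST n. n \<in> L0)"
            have n: "n \<in> L0" "\<And>m. m \<in> L0 \<Longrightarrow> n \<le> m"
              unfolding n_def using infinite_imp_nonempty[OF L0(2)] by (auto intro: LeastI Least_le)
            have "acc (insert n s) M" using n(1) L0(1) by (auto simp: bad_def)
            moreover have "L0 \<subseteq> M" using L0(1) above_subset[of s M] by (auto simp: bad_def)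
            ultimately obtain k where k: "B (initial_segment (insert n s \<union> above (insert n s) L0) k)"
              using L0(2) unfolding acc_def by blast
            have "above s L0 = insert n (above (insert n s) L0)"
            proof (intro equalityI subsetI)
              fix x assume x: "x \<in> above s L0"
              then have "x = n \<or> n < x" using n(2)[of x] by (auto simp: above_def)
              then show "x \<in> insert n (above (insert n s) L0)" using x by (auto simp: above_def)
            next
              fix x assume "x \<in> insert n (above (insert n s) L0)"
              then show "x \<in> above s L0" using n(1) L0(1) by (auto simp: above_def bad_def)
            qed
            then have "insert n s \<union> above (insert n s) L0 = s \<union> above s L0" by auto
            then show "\<exists>k. B (initial_segment (s \<union> above s L0) k)" using k by auto
          qed
          moreover have "bad \<subseteq> M" using above_subset[of s M] by (auto simp: bad_def)
          ultimately show False using True inf unfolding rej_def by blast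
        qed
        have "infinite (L - bad)" by (rule Diff_infinite_finite[OF fin L])
        moreover have "\<not> acc (insert n s) M" if "n \<in> above s (L - bad) \<inter> M" for n
        proof -
          have "n \<in> above s M" "n \<notin> bad" using that by (auto simp: above_def)
          then show ?thesis unfolding bad_def by blast
        qed
        ultimately show ?thesis by (meson Diff_subset)
      next
        case False
        then show ?thesis using L by blast
      qed
    next
      fix s L L1 :: "nat set"
      assume "rej s M \<longrightarrow> (\<forall>n\<in>above s L1 \<inter> M. \<not> acc (insert n s) M)" "above s L \<subseteq> L1"
      then show "rej s M \<longrightarrow> (\<forall>n\<in>above s L \<inter> M. \<not> acc (insert n s) M)"
        by (auto simp: above_def)
    qed
    then obtain L where L: "L \<subseteq> M" "infinite L"
      and step: "\<forall>s\<subseteq>L. finite s \<longrightarrow> rej s M \<longrightarrow> (\<forall>n\<in>above s L \<inter> M. \<not> acc (insert n s) M)"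
      by blast
    have rejs: "rej s M" if "s \<subseteq> L" "finite s" for s
      using that(2,1)
    proof (induction s rule: finite_linorder_max_induct)
      case empty
      show ?case by (rule rej0)
    next
      case (insert n s)
      have "n \<in> above s L \<inter> M" using insert L(1) by (auto simp: above_def)
      moreover have s: "s \<subseteq> L" "rej s M" using insert by auto
      ultimately have "\<not> acc (insert n s) M" using step insert.hyps(1) by blast
      moreover have "insert n s \<subseteq> M" "finite (insert n s)" using insert.prems insert.hyps(1) L(1) by auto
      ultimately show ?case using M(2) by blast
    qed
    have "\<not> B s" if s: "s \<subseteq> L" "finite s" for s
    proof
      assume B: "B s"
      \<comment> \<open>A member \<open>s\<close> of \<open>B\<close> is itself an initial segment
        of each of its continuations, so it would be accepted.\<close>
      have "\<exists>k. \<forall>L0. initial_segment (s \<union> above s L0) k = s"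
      proof (cases "s = {}")
        case True
        then show ?thesis by (intro exI[of _ 0]) (simp add: initial_segment_def)
      next
        case False
        have "x \<notin> above s L0" if "x \<le> Max s" for x L0
          using Max_in[OF s(2) False] that by (fastforce simp: above_def)
        then show ?thesis using s(2)
          by (intro exI[of _ "Suc (Max s)"]) (auto simp: initial_segment_def less_Suc_eq_le)
      qed
      then obtain k where "initial_segment (s \<union> above s L0) k = s" for L0 by blast
      then have "acc s M" using B by (auto simp: acc_def intro!: exI[of _ k])
      then show False using rejs[OF s] M(1) unfolding rej_def by blast
    qed
    then show thesis using L(2) that by blast
  qed
qed

section \<open>Rosenthal's theorem\<close>

definition weakly_Cauchy :: "(nat \<Rightarrow> 'a::complex_normed_vector) \<Rightarrow> bool" where
  "weakly_Cauchy x \<longleftrightarrow> (\<forall>\<phi>\<in>dual_ball. convergent (\<lambda>n. \<phi> (x n)))"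

text \<open>One point is the limit of some subsequence. As the whole sequence does not converge to
  it, another subsequence stays at distance at least \<open>d\<close>, and a limit taken there is
  the second point.\<close>

lemma two_cluster_points:
  fixes u :: "nat \<Rightarrow> 'b::metric_space"
  assumes K: "compact K" "\<And>n. u n \<in> K" and nc: "\<not> convergent u"
  obtains p q where "p \<noteq> q" "\<And>e. 0 < e \<Longrightarrow> \<exists>\<^sub>F n in sequentially. dist (u n) p < e"
    "\<And>e. 0 < e \<Longrightarrow> \<exists>\<^sub>F n in sequentially. dist (u n) q < e"
proof -
  have freq: "\<exists>\<^sub>F n in sequentially. dist (u n) l < e"
    if r: "strict_mono r" "(u \<circ> r) \<longlonglongrightarrow> l" and e: "0 < e" for r l e
  proof -
    obtain N where N: "\<And>k. k \<ge> N \<Longrightarrow> dist (u (r k)) l < e"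
      using metric_LIMSEQ_D[OF r(2) e] by auto
    show ?thesis unfolding frequently_sequentially
    proof
      fix m
      have "m \<le> r (max m N)" using seq_suble[OF r(1), of "max m N"] by linarith
      then show "\<exists>n\<ge>m. dist (u n) l < e" using N[of "max m N"] by (intro exI[of _ "r (max m N)"]) auto
    qed
  qed
  have sc: "seq_compact K" using K(1) by (simp add: compact_eq_seq_compact_metric)
  obtain p r where r: "strict_mono r" "(u \<circ> r) \<longlonglongrightarrow> p"
    using seq_compactE[OF sc, of u] K(2) by metis
  have "\<not> u \<longlonglongrightarrow> p" using nc by (auto simp: convergent_def)
  then obtain d where d: "0 < d" "\<forall>N. \<exists>n\<ge>N. d \<le> dist (u n) p"
    by (auto simp: lim_sequentially not_less)
  define S where "S = {n. d \<le> dist (u n) p}"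
  have S: "infinite S" using d(2) by (auto simp: S_def infinite_nat_iff_unbounded_le)
  define t where "t = enumerate S"
  have t: "strict_mono t" "\<And>n. d \<le> dist (u (t n)) p"
    using S enumerate_in_set[OF S] by (auto simp: t_def strict_mono_enumerate S_def)
  obtain q r' where r': "strict_mono r'" "((u \<circ> t) \<circ> r') \<longlonglongrightarrow> q"
    using seq_compactE[OF sc, of "u \<circ> t"] K(2) by (metis comp_apply)
  have "d \<le> dist q p"
    by (rule LIMSEQ_le_const[OF tendsto_dist[OF r'(2) tendsto_const]]) (auto simp: t)
  then have "p \<noteq> q" using d(1) by auto
  moreover have "(u \<circ> (t \<circ> r')) \<longlonglongrightarrow> q" using r'(2) by (simp add: o_assoc)
  moreover have "strict_mono (t \<circ> r')" using t(1) r'(1) by (rule strict_mono_o)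
  ultimately show thesis using that freq r by metis
qed

text \<open>The discs are small compared with the distance of their centres because the radii enter as
  errors in \<open>l1_from_independence\<close>.\<close>

lemma oscillating_discs:
  fixes x :: "nat \<Rightarrow> 'a::complex_normed_vector"
  assumes bd: "\<And>n. norm (x n) \<le> b"
    and nwc: "\<And>r. strict_mono r \<Longrightarrow> \<not> weakly_Cauchy (x \<circ> r)"
  obtains p q :: complex and r :: "nat \<Rightarrow> nat" where "p \<noteq> q" "strict_mono r"
    "\<forall>r'. strict_mono r' \<longrightarrow> (\<exists>\<phi>\<in>dual_ball.
      (\<exists>\<^sub>F n in sequentially. dist (\<phi> (x (r (r' n)))) p < dist p q / 16) \<and>
      (\<exists>\<^sub>F n in sequentially. dist (\<phi> (x (r (r' n)))) q < dist p q / 16))"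
proof -
  obtain D :: "complex set" where D: "countable D" "\<And>U. open U \<Longrightarrow> U \<noteq> {} \<Longrightarrow> \<exists>d\<in>D. d \<in> U"
    using countable_dense_exists by blast
  define osc where "osc p q s \<longleftrightarrow> (\<exists>\<phi>\<in>dual_ball.
      (\<exists>\<^sub>F n in sequentially. dist (\<phi> (x (s n))) p < dist p q / 16) \<and>
      (\<exists>\<^sub>F n in sequentially. dist (\<phi> (x (s n))) q < dist p q / 16))"
    for p q :: complex and s :: "nat \<Rightarrow> nat"
  have "\<exists>p q. \<exists>r::nat \<Rightarrow> nat. p \<noteq> q \<and> strict_mono r \<and> (\<forall>r'::nat \<Rightarrow> nat. strict_mono r' \<longrightarrow> osc p q (r \<circ> r'))"
  proof (rule ccontr)
    assume neg: "\<not> ?thesis"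
    \<comment> \<open>By assumption each of the countably many pairs of distinct centres in
      \<open>D\<close> can be kept from oscillating along a subsequence; the diagonal sequence then
      defeats all of them at once.\<close>
    define e where "e = from_nat_into (D \<times> D)"
    define P where "P n s \<longleftrightarrow> (case e n of (p, q) \<Rightarrow> p \<noteq> q \<longrightarrow> \<not> osc p q s)" for n s
    interpret subseqs P
    proof
      fix n and s :: "nat \<Rightarrow> nat" assume s: "strict_mono s"
      obtain p q where pq: "e n = (p, q)" by force
      show "\<exists>r'. strict_mono r' \<and> P n (s \<circ> r')"
      proof (cases "p = q")
        case True
        then show ?thesis using s by (auto simp: P_def pq)
      next
        case False
        then have "\<exists>r'. strict_mono r' \<and> \<not> osc p q (s \<circ> r')" using neg s by blast
        then show ?thesis using False by (simp add: P_def pq)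
      qed
    qed
    have stable: "P n (s \<circ> r)" if r: "strict_mono r" and P: "P n s" for r s n
    proof -
      obtain p q where pq: "e n = (p, q)" by force
      have freq: "\<exists>\<^sub>F n in sequentially. Q (s n)" if Q: "\<exists>\<^sub>F n in sequentially. Q (s (r n))" for Q
        unfolding frequently_sequentially
      proof
        fix m
        obtain k where "k \<ge> m" "Q (s (r k))" using Q by (auto simp: frequently_sequentially)
        then show "\<exists>k\<ge>m. Q (s k)" using seq_suble[OF r, of k] by (intro exI[of _ "r k"]) auto
      qed
      have "osc p q s" if "osc p q (s \<circ> r)"
      proof -
        obtain \<phi> where \<phi>: "\<phi> \<in> dual_ball"
          "\<exists>\<^sub>F n in sequentially. dist (\<phi> (x (s (r n)))) p < dist p q / 16"
          "\<exists>\<^sub>F n in sequentially. dist (\<phi> (x (s (r n)))) q < dist p q / 16"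
          using \<open>osc p q (s \<circ> r)\<close> by (auto simp: osc_def)
        then show ?thesis
          using freq[of "\<lambda>k. dist (\<phi> (x k)) p < dist p q / 16"]
            freq[of "\<lambda>k. dist (\<phi> (x k)) q < dist p q / 16"] by (auto simp: osc_def)
      qed
      then show ?thesis using P by (auto simp: P_def pq)
    qed
    \<comment> \<open>Stage \<open>n\<close> controls the diagonal sequence only from some index on,
      which is enough for a statement about infinitely many terms.\<close>
    have tail: "P n diagseq" for n
    proof -
      obtain p q where pq: "e n = (p, q)" by force
      have freq: "\<exists>\<^sub>F k in sequentially. Q ((diagseq \<circ> (+) (Suc n)) k)" if Q: "\<exists>\<^sub>F k in sequentially. Q (diagseq k)" for Q
        unfolding frequently_sequentially
      proof
        fix m
        obtain k where k: "k \<ge> m + Suc n" "Q (diagseq k)" using Q by (auto simp: frequently_sequentially)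
        then show "\<exists>k\<ge>m. Q ((diagseq \<circ> (+) (Suc n)) k)" by (intro exI[of _ "k - Suc n"]) auto
      qed
      have "osc p q (diagseq \<circ> (+) (Suc n))" if "osc p q diagseq"
      proof -
        obtain \<phi> where \<phi>: "\<phi> \<in> dual_ball"
          "\<exists>\<^sub>F n in sequentially. dist (\<phi> (x (diagseq n))) p < dist p q / 16"
          "\<exists>\<^sub>F n in sequentially. dist (\<phi> (x (diagseq n))) q < dist p q / 16"
          using \<open>osc p q diagseq\<close> by (auto simp: osc_def)
        then show ?thesis
          using freq[of "\<lambda>k. dist (\<phi> (x k)) p < dist p q / 16"]
            freq[of "\<lambda>k. dist (\<phi> (x k)) q < dist p q / 16"] unfolding osc_def by blast
      qed
      then show ?thesis using diagseq_holds[of n, OF stable] by (auto simp: P_def pq)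
    qed
    obtain \<phi> where \<phi>: "\<phi> \<in> dual_ball" "\<not> convergent (\<lambda>n. \<phi> (x (diagseq n)))"
      using nwc[OF subseq_diagseq] by (auto simp: weakly_Cauchy_def)
    have inb: "\<phi> (x (diagseq n)) \<in> cball 0 b" for n
      using dual_ball_le[OF \<phi>(1), of "x (diagseq n)"] bd[of "diagseq n"] by simp
    obtain p q where pq: "p \<noteq> q"
      "\<And>e. 0 < e \<Longrightarrow> \<exists>\<^sub>F n in sequentially. dist (\<phi> (x (diagseq n))) p < e"
      "\<And>e. 0 < e \<Longrightarrow> \<exists>\<^sub>F n in sequentially. dist (\<phi> (x (diagseq n))) q < e"
      by (rule two_cluster_points[OF compact_cball inb \<phi>(2)]) blast
    \<comment> \<open>Moving the centres by less than \<delta> leaves them more than 98 \<delta>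
      apart, and 98 / 16 > 2; so the discs around the new centres contain those of radius \<delta>
      around p and q.\<close>
    define \<delta> where "\<delta> = dist p q / 100"
    have \<delta>: "0 < \<delta>" using pq(1) by (simp add: \<delta>_def)
    obtain p' where p': "p' \<in> D" "dist p p' < \<delta>" using D(2)[of "ball p \<delta>"] \<delta> by auto
    obtain q' where q': "q' \<in> D" "dist q q' < \<delta>" using D(2)[of "ball q \<delta>"] \<delta> by auto
    have "dist p q \<le> dist p p' + dist p' q' + dist q q'"
      using dist_triangle[of p q p'] dist_triangle[of p' q q'] by (simp add: dist_commute)
    then have big: "98 * \<delta> < dist p' q'" using p'(2) q'(2) by (simp add: \<delta>_def)
    have "\<exists>\<^sub>F n in sequentially. dist (\<phi> (x (diagseq n))) p' < dist p' q' / 16"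
      using pq(2)[OF \<delta>]
    proof (rule frequently_elim1)
      fix n assume "dist (\<phi> (x (diagseq n))) p < \<delta>"
      then show "dist (\<phi> (x (diagseq n))) p' < dist p' q' / 16"
        using dist_triangle[of "\<phi> (x (diagseq n))" p' p] p'(2) big \<delta> by linarith
    qed
    moreover have "\<exists>\<^sub>F n in sequentially. dist (\<phi> (x (diagseq n))) q' < dist p' q' / 16"
      using pq(3)[OF \<delta>]
    proof (rule frequently_elim1)
      fix n assume "dist (\<phi> (x (diagseq n))) q < \<delta>"
      then show "dist (\<phi> (x (diagseq n))) q' < dist p' q' / 16"
        using dist_triangle[of "\<phi> (x (diagseq n))" q' q] q'(2) big \<delta> by linarith
    qed
    ultimately have o: "osc p' q' diagseq" using \<phi>(1) unfolding osc_def by blast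
    have cD: "countable (D \<times> D)" "(p', q') \<in> D \<times> D" using D(1) p'(1) q'(1) by auto
    obtain n where "e n = (p', q')" unfolding e_def using from_nat_into_surj[OF cD] by blast
    moreover have "p' \<noteq> q'" using big \<delta> by auto
    ultimately show False using tail[of n] o by (auto simp: P_def)
  qed
  then obtain p q and r :: "nat \<Rightarrow> nat" where pqr: "p \<noteq> q" "strict_mono r"
    "\<forall>r'. strict_mono r' \<longrightarrow> osc p q (r \<circ> r')" by blast
  show thesis by (rule that[OF pqr[unfolded osc_def comp_def]])
qed

lemma card_less_image:
  fixes l :: "nat \<Rightarrow> nat"
  assumes l: "strict_mono l"
  shows "card {j \<in> range l. j < l i} = i"
proof -
  have "{j \<in> range l. j < l i} = l ` {..<i}" using l by (auto simp: strict_mono_less)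
  moreover have "inj_on l {..<i}" using l strict_mono_imp_inj_on inj_on_subset by blast
  ultimately show ?thesis by (simp add: card_image)
qed

text \<open>Independence of the two families of discs is forced by applying the Nash-Williams theorem to
  the finite sets along which no functional visits the two discs alternately; between two
  prescribed indices a dummy index adjusts the parity.\<close>

lemma independent_discs:
  fixes y :: "nat \<Rightarrow> 'a" and G :: "('a \<Rightarrow> 'b::metric_space) set" and p q :: 'b
  assumes osc: "\<And>r. strict_mono r \<Longrightarrow> \<exists>\<phi>\<in>G.
      (\<exists>\<^sub>F n in sequentially. dist (\<phi> (y (r n))) p < \<rho>) \<and>
      (\<exists>\<^sub>F n in sequentially. dist (\<phi> (y (r n))) q < \<rho>)"
  obtains t :: "nat \<Rightarrow> nat" where "strict_mono t"
    "\<forall>S n. \<exists>\<phi>\<in>G. \<forall>i<n. dist (\<phi> (y (t i))) (if i \<in> S then p else q) < \<rho>"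
proof -
  \<comment> \<open>The position of \<open>l\<close> in \<open>s\<close>: even positions call for
    the disc at p, odd ones for the disc at q.\<close>
  define pos where "pos s l = card {j\<in>s. j < l}" for s :: "nat set" and l
  define B where "B s \<longleftrightarrow> \<not> (\<exists>\<phi>\<in>G. \<forall>l\<in>s. dist (\<phi> (y l)) (if even (pos s l) then p else q) < \<rho>)"
    for s :: "nat set"
  obtain M where M: "infinite M"
    "(\<forall>s\<subseteq>M. finite s \<longrightarrow> \<not> B s) \<or> (\<forall>L\<subseteq>M. infinite L \<longrightarrow> (\<exists>k. B (initial_segment L k)))"
    by (rule nash_williams[of B])
  define m where "m = enumerate M"
  have m: "strict_mono m" "range m = M"
    by (simp_all add: m_def strict_mono_enumerate M(1) range_enumerate)
  \<comment> \<open>One oscillating functional alternates along a suitable subsequence, which rules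
    out the second alternative for M.\<close>
  have "\<exists>L\<subseteq>M. infinite L \<and> (\<forall>k. \<not> B (initial_segment L k))"
  proof -
    obtain \<phi> where \<phi>: "\<phi> \<in> G" "\<exists>\<^sub>F n in sequentially. dist (\<phi> (y (m n))) p < \<rho>"
      "\<exists>\<^sub>F n in sequentially. dist (\<phi> (y (m n))) q < \<rho>"
      using osc[OF m(1)] by blast
    have nxt: "\<exists>k>N. dist (\<phi> (y (m k))) (if b then p else q) < \<rho>" for N b
      using \<phi>(2,3) unfolding frequently_sequentially by (metis Suc_le_lessD)
    have "\<exists>h. \<forall>i. dist (\<phi> (y (m (h i)))) (if even i then p else q) < \<rho> \<and> h i < h (Suc i)"
    proof (rule dependent_nat_choice)
      show "\<exists>k. dist (\<phi> (y (m k))) (if even (0::nat) then p else q) < \<rho>" using nxt[of 0 True] by auto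
      show "\<exists>k'. dist (\<phi> (y (m k'))) (if even (Suc i) then p else q) < \<rho> \<and> k < k'" for k i
        using nxt[of k "even (Suc i)"] by auto
    qed
    then obtain h where h: "\<And>i. dist (\<phi> (y (m (h i)))) (if even i then p else q) < \<rho>"
      "\<And>i. h i < h (Suc i)" by blast
    define l where "l = m \<circ> h"
    have l: "strict_mono l"
      unfolding l_def using m(1) h(2) by (intro strict_mono_o) (auto simp: strict_mono_Suc_iff)
    have "\<not> B (initial_segment (range l) k)" for k
    proof -
      have pos_l: "pos (initial_segment (range l) k) (l i) = i" if "l i < k" for i
      proof -
        have "{j \<in> initial_segment (range l) k. j < l i} = {j \<in> range l. j < l i}"
          using that by (auto simp: initial_segment_def)
        then show ?thesis using card_less_image[OF l] by (simp add: pos_def)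
      qed
      have "dist (\<phi> (y w)) (if even (pos (initial_segment (range l) k) w) then p else q) < \<rho>"
        if w: "w \<in> initial_segment (range l) k" for w
        
      proof -
        obtain i where "w = l i" "l i < k" using w by (auto simp: initial_segment_def)
        then show ?thesis using pos_l[of i] h(1)[of i] by (simp add: l_def)
      qed
      then show ?thesis using \<phi>(1) unfolding B_def by blast
    qed
    moreover have "range l \<subseteq> M" using m(2) by (auto simp: l_def)
    moreover have "infinite (range l)" using l strict_mono_imp_inj_on range_inj_infinite by blast
    ultimately show ?thesis by blast
  qed
  then have good: "\<not> B s" if "s \<subseteq> M" "finite s" for s using M(2) that by blast
  \<comment> \<open>The entries of \<open>m\<close> with even index are reserved as dummies.\<close>
  define t where "t i = m (2 * i + 1)" for i
  have t: "strict_mono t" using m(1) by (auto simp: t_def strict_mono_def)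
  have "\<exists>\<phi>\<in>G. \<forall>i<n. dist (\<phi> (y (t i))) (if i \<in> S then p else q) < \<rho>" for S n
  proof -
    have "\<exists>s\<subseteq>m ` {..<2*n}. \<forall>i<n. t i \<in> s \<and> (even (pos s (t i)) \<longleftrightarrow> i \<in> S)"
    proof (induction n)
      case (Suc n)
      then obtain s where s: "s \<subseteq> m ` {..<2*n}" "\<And>i. i < n \<Longrightarrow> t i \<in> s \<and> (even (pos s (t i)) \<longleftrightarrow> i \<in> S)"
        by blast
      have fs: "finite s" using s(1) finite_subset by blast
      have below: "x < m (2 * n)" if "x \<in> s" for x using s(1) that m(1) by (auto simp: strict_mono_less)
      have mt: "m (2 * n) < t n" using m(1) by (simp add: t_def strict_mono_less)
      \<comment> \<open>\<open>t n\<close> gets position card s, or card s + 1 once the dummy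
        precedes it; one of the two has the parity that S prescribes.\<close>
      define s' where "s' = (if even (card s) \<longleftrightarrow> n \<in> S then insert (t n) s
        else insert (t n) (insert (m (2 * n)) s))"
      have "{j\<in>s'. j < t n} = (if even (card s) \<longleftrightarrow> n \<in> S then s else insert (m (2 * n)) s)"
        using below mt by (auto simp: s'_def intro: less_trans)
      moreover have "m (2 * n) \<notin> s" using below by blast
      ultimately have "even (pos s' (t n)) \<longleftrightarrow> n \<in> S" using fs by (auto simp: pos_def)
      moreover have "t i \<in> s' \<and> (even (pos s' (t i)) \<longleftrightarrow> i \<in> S)" if i: "i < n" for i
      proof -
        have "t i < m (2 * n)" "t i < t n" using i m(1) t by (auto simp: t_def strict_mono_less)
        then have "{j\<in>s'. j < t i} = {j\<in>s. j < t i}" by (auto simp: s'_def)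
        then show ?thesis using s(2)[OF i] by (auto simp: pos_def s'_def)
      qed
      moreover have "t n \<in> s'" by (auto simp: s'_def)
      moreover have "s' \<subseteq> m ` {..<2 * Suc n}" using s(1) by (auto simp: s'_def t_def)
      ultimately show ?case using less_Suc_eq by auto
    qed auto
    then obtain s where s: "s \<subseteq> m ` {..<2*n}" "\<And>i. i < n \<Longrightarrow> t i \<in> s \<and> (even (pos s (t i)) \<longleftrightarrow> i \<in> S)"
      by blast
    have "\<not> B s" using s(1) m(2) by (intro good) (auto intro: finite_subset)
    then obtain \<phi> where "\<phi> \<in> G" "\<forall>l\<in>s. dist (\<phi> (y l)) (if even (pos s l) then p else q) < \<rho>"
      unfolding B_def by blast
    then show ?thesis using s(2) by (intro bexI[of _ \<phi>]) (metis | assumption)+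
  qed
  then show thesis using t that by blast
qed

text \<open>The lower l_1 estimate; the upper one comes from boundedness of the sequence.\<close>

definition l1_sequence :: "real \<Rightarrow> (nat \<Rightarrow> 'a::complex_normed_vector) \<Rightarrow> bool" where
  "l1_sequence c x \<longleftrightarrow> (\<forall>(a::nat \<Rightarrow> complex) n. c * (\<Sum>i<n. cmod (a i)) \<le> norm (\<Sum>i<n. a i *\<^sub>C x i))"

lemma dual_ball_sum: "\<phi> \<in> dual_ball \<Longrightarrow> \<phi> (\<Sum>i\<in>A. a i *\<^sub>C x i) = (\<Sum>i\<in>A. a i * \<phi> (x i))"
proof -
  assume \<phi>: "\<phi> \<in> dual_ball"
  have "\<phi> 0 = 0" using dual_ball_scale[OF \<phi>, of 0 0] by simp
  then show ?thesis
    by (induction A rule: infinite_finite_induct) (simp_all add: dual_ball_add[OF \<phi>] dual_ball_scale[OF \<phi>])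
qed

text \<open>Testing against the difference of two functionals with opposite patterns, first for the signs
  of the real parts of the coefficients and then for those of the imaginary parts, handles complex
  scalars directly.\<close>

lemma l1_from_independence:
  fixes z :: "nat \<Rightarrow> 'a::complex_normed_vector" and p q :: complex
  assumes ind: "\<forall>S n. \<exists>\<phi>\<in>dual_ball. \<forall>i<n. dist (\<phi> (z i)) (if i \<in> S then p else q) < dist p q / 16"
  shows "l1_sequence (3 * dist p q / 16) z"
  unfolding l1_sequence_def
proof (intro allI)
  fix a :: "nat \<Rightarrow> complex" and n
  let ?\<delta> = "dist p q" and ?s = "\<Sum>i<n. cmod (a i)" and ?N = "norm (\<Sum>i<n. a i *\<^sub>C z i)"
  \<comment> \<open>\<open>f\<close> will be the real or the imaginary part: after a change of signs
    it adds up the coefficients without cancellation. The error \<delta>/8 stems from two discs of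
    radius \<delta>/16.\<close>
  have key: "?\<delta> * (\<Sum>i<n. \<bar>f (a i)\<bar>) - ?\<delta> / 8 * ?s \<le> 2 * ?N"
    if f: "\<And>s. finite s \<Longrightarrow> \<bar>f (\<Sum>i\<in>s. (if f (a i) \<ge> 0 then a i else - a i))\<bar> = (\<Sum>i\<in>s. \<bar>f (a i)\<bar>)"
      "\<And>c. \<bar>f c\<bar> \<le> cmod c" for f :: "complex \<Rightarrow> real"
  proof -
    define S where "S = {i. 0 \<le> f (a i)}"
    obtain \<phi> where \<phi>: "\<phi> \<in> dual_ball" "\<forall>i<n. dist (\<phi> (z i)) (if i \<in> S then p else q) < ?\<delta> / 16"
      using ind by blast
    obtain \<psi> where \<psi>: "\<psi> \<in> dual_ball" "\<forall>i<n. dist (\<psi> (z i)) (if i \<in> - S then p else q) < ?\<delta> / 16"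
      using ind by blast
    define \<epsilon> where "\<epsilon> i = (if i \<in> S then p - q else q - p)" for i
    define E where "E i = \<phi> (z i) - \<psi> (z i) - \<epsilon> i" for i
    have E: "cmod (E i) \<le> ?\<delta> / 8" if "i < n" for i
    proof -
      have "E i = (\<phi> (z i) - (if i \<in> S then p else q)) - (\<psi> (z i) - (if i \<in> - S then p else q))"
        by (auto simp: E_def \<epsilon>_def)
      also have "cmod \<dots> \<le> cmod (\<phi> (z i) - (if i \<in> S then p else q)) + cmod (\<psi> (z i) - (if i \<in> - S then p else q))"
        by (rule norm_triangle_ineq4)
      also have "\<dots> \<le> ?\<delta> / 16 + ?\<delta> / 16"
        using \<phi>(2)[rule_format, OF that] \<psi>(2)[rule_format, OF that] unfolding dist_norm by linarith
      finally show ?thesis by simp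
    qed
    have "?\<delta> * (\<Sum>i<n. \<bar>f (a i)\<bar>) \<le> cmod (\<Sum>i<n. a i * \<epsilon> i)"
    proof -
      have "(\<Sum>i<n. a i * \<epsilon> i) = (p - q) * (\<Sum>i<n. (if f (a i) \<ge> 0 then a i else - a i))"
        by (auto simp: sum_distrib_left \<epsilon>_def S_def algebra_simps intro!: sum.cong)
      then have "cmod (\<Sum>i<n. a i * \<epsilon> i) = ?\<delta> * cmod (\<Sum>i<n. (if f (a i) \<ge> 0 then a i else - a i))"
        by (simp add: norm_mult dist_norm)
      then show ?thesis
        using f(1)[of "{..<n}"] f(2)[of "\<Sum>i<n. (if f (a i) \<ge> 0 then a i else - a i)"]
        by (simp add: mult_left_mono)
    qed
    moreover have "cmod (\<Sum>i<n. a i * E i) \<le> ?\<delta> / 8 * ?s"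
    proof -
      have "cmod (\<Sum>i<n. a i * E i) \<le> (\<Sum>i<n. cmod (a i) * (?\<delta> / 8))"
      proof (rule sum_norm_le)
        fix i assume "i \<in> {..<n}"
        then show "cmod (a i * E i) \<le> cmod (a i) * (?\<delta> / 8)"
          unfolding norm_mult by (intro mult_left_mono E) auto
      qed
      also have "\<dots> = ?s * (?\<delta> / 8)" by (rule sum_distrib_right[symmetric])
      finally show ?thesis by (simp only: mult.commute)
    qed
    moreover have "cmod (\<phi> (\<Sum>i<n. a i *\<^sub>C z i) - \<psi> (\<Sum>i<n. a i *\<^sub>C z i)) \<le> ?N + ?N"
      using dual_ball_le[OF \<phi>(1)] dual_ball_le[OF \<psi>(1)]
      by (intro order_trans[OF norm_triangle_ineq4] add_mono)
    moreover have "\<phi> (\<Sum>i<n. a i *\<^sub>C z i) - \<psi> (\<Sum>i<n. a i *\<^sub>C z i) = (\<Sum>i<n. a i * \<epsilon> i) + (\<Sum>i<n. a i * E i)"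
      unfolding dual_ball_sum[OF \<phi>(1)] dual_ball_sum[OF \<psi>(1)]
      by (simp add: E_def sum_subtractf[symmetric] sum.distrib[symmetric] algebra_simps)
    then have "cmod (\<Sum>i<n. a i * \<epsilon> i) - cmod (\<Sum>i<n. a i * E i)
        \<le> cmod (\<phi> (\<Sum>i<n. a i *\<^sub>C z i) - \<psi> (\<Sum>i<n. a i *\<^sub>C z i))"
      by (simp only: norm_diff_ineq)
    ultimately show ?thesis by linarith
  qed
  have aux: "\<bar>\<Sum>i\<in>s. \<bar>g i\<bar>\<bar> = (\<Sum>i\<in>s. \<bar>g i :: real\<bar>)" for s :: "nat set" and g
    by (simp add: sum_nonneg)
  have "?\<delta> * (\<Sum>i<n. \<bar>Re (a i)\<bar>) - ?\<delta> / 8 * ?s \<le> 2 * ?N"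
  proof (rule key)
    fix s :: "nat set"
    have "Re (\<Sum>i\<in>s. if 0 \<le> Re (a i) then a i else - a i) = (\<Sum>i\<in>s. \<bar>Re (a i)\<bar>)"
      unfolding Re_sum by (intro sum.cong) auto
    then show "\<bar>Re (\<Sum>i\<in>s. if 0 \<le> Re (a i) then a i else - a i)\<bar> = (\<Sum>i\<in>s. \<bar>Re (a i)\<bar>)"
      by (simp only: aux)
  qed (rule abs_Re_le_cmod)
  moreover have "?\<delta> * (\<Sum>i<n. \<bar>Im (a i)\<bar>) - ?\<delta> / 8 * ?s \<le> 2 * ?N"
  proof (rule key)
    fix s :: "nat set"
    have "Im (\<Sum>i\<in>s. if 0 \<le> Im (a i) then a i else - a i) = (\<Sum>i\<in>s. \<bar>Im (a i)\<bar>)"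
      unfolding Im_sum by (intro sum.cong) auto
    then show "\<bar>Im (\<Sum>i\<in>s. if 0 \<le> Im (a i) then a i else - a i)\<bar> = (\<Sum>i\<in>s. \<bar>Im (a i)\<bar>)"
      by (simp only: aux)
  qed (rule abs_Im_le_cmod)
  moreover have "?\<delta> * ?s \<le> ?\<delta> * (\<Sum>i<n. \<bar>Re (a i)\<bar>) + ?\<delta> * (\<Sum>i<n. \<bar>Im (a i)\<bar>)"
    unfolding distrib_left[symmetric] sum.distrib[symmetric]
    by (intro mult_left_mono sum_mono cmod_le) auto
  \<comment> \<open>The sum of the two estimates is \<delta> s - \<delta> s / 4 \<le> 4 N, whence
    the constant 3/16.\<close>
  ultimately show "3 * ?\<delta> / 16 * ?s \<le> ?N" by simp
qed

theorem rosenthal_l1: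
  fixes x :: "nat \<Rightarrow> 'a::complex_normed_vector"
  assumes bd: "\<And>n. norm (x n) \<le> b"
    and nwc: "\<And>r. strict_mono r \<Longrightarrow> \<not> weakly_Cauchy (x \<circ> r)"
  obtains r c where "strict_mono r" "0 < c" "l1_sequence c (x \<circ> r)"
proof -
  obtain p q :: complex and r :: "nat \<Rightarrow> nat" where pq: "p \<noteq> q" and r: "strict_mono r"
    and osc: "\<forall>r'. strict_mono r' \<longrightarrow> (\<exists>\<phi>\<in>dual_ball.
      (\<exists>\<^sub>F n in sequentially. dist (\<phi> (x (r (r' n)))) p < dist p q / 16) \<and>
      (\<exists>\<^sub>F n in sequentially. dist (\<phi> (x (r (r' n)))) q < dist p q / 16))"
    by (rule oscillating_discs[OF bd nwc])
  then have osc': "\<exists>\<phi>\<in>dual_ball.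
      (\<exists>\<^sub>F n in sequentially. dist (\<phi> ((x \<circ> r) (r' n))) p < dist p q / 16) \<and>
      (\<exists>\<^sub>F n in sequentially. dist (\<phi> ((x \<circ> r) (r' n))) q < dist p q / 16)"
    if "strict_mono r'" for r' using that by simp
  obtain t :: "nat \<Rightarrow> nat" where t: "strict_mono t"
    "\<forall>S n. \<exists>\<phi>\<in>dual_ball. \<forall>i<n. dist (\<phi> ((x \<circ> r) (t i))) (if i \<in> S then p else q) < dist p q / 16"
    by (rule independent_discs[OF osc'])
  then have "l1_sequence (3 * dist p q / 16) (x \<circ> (r \<circ> t))"
    by (intro l1_from_independence) simp
  moreover have "strict_mono (r \<circ> t)" using r t(1) by (rule strict_mono_o)
  ultimately show thesis using pq by (intro that[of "r \<circ> t" "3 * dist p q / 16"]) auto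
qed

section \<open>Sequences with a lower l_1 estimate against HI_xi\<close>

lemma l1_sequence_grunblum:
  assumes l1: "l1_sequence c x" and c: "0 < c" and b: "\<And>n. norm (x n) \<le> b"
  shows "grunblum (b / c) x"
  unfolding grunblum_def
proof (intro allI impI)
  fix a :: "nat \<Rightarrow> complex" and m n :: nat assume mn: "m \<le> n"
  have b0: "0 \<le> b" using b[of 0] norm_ge_zero order_trans by blast
  have "norm (\<Sum>i<m. a i *\<^sub>C x i) \<le> (\<Sum>i<m. cmod (a i) * b)"
    by (rule sum_norm_le) (auto simp: norm_scaleC intro: mult_left_mono b)
  also have "\<dots> \<le> (\<Sum>i<n. cmod (a i) * b)" using mn b0 by (intro sum_mono2) auto
  also have "\<dots> = b / c * (c * (\<Sum>i<n. cmod (a i)))" using c by (simp add: sum_distrib_left mult.commute)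
  also have "\<dots> \<le> b / c * norm (\<Sum>i<n. a i *\<^sub>C x i)"
    using l1 b0 c by (intro mult_left_mono) (auto simp: l1_sequence_def)
  finally show "norm (\<Sum>i<m. a i *\<^sub>C x i) \<le> b / c * norm (\<Sum>i<n. a i *\<^sub>C x i)" .
qed

lemma infdist_closed_cspan_less:
  fixes y :: "'a::complex_normed_vector"
  assumes "infdist y (closed_cspan A) < \<epsilon>"
  obtains z where "z \<in> complex_vector.span A" "norm (y - z) < \<epsilon>"
proof -
  have ne: "closed_cspan A \<noteq> {}"
    using complex_vector.span_zero[of A] closure_subset[of "complex_vector.span A"] by (auto simp: closed_cspan_def)
  obtain w where w: "w \<in> closed_cspan A" "dist y w < \<epsilon>"
    using assms ne unfolding infdist_notempty[OF ne] by (auto simp: cINF_less_iff)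
  have "0 < \<epsilon> - dist y w" using w(2) by simp
  then obtain z where "z \<in> complex_vector.span A" "dist z w < \<epsilon> - dist y w"
    using w(1) unfolding closed_cspan_def closure_approachable by blast
  then show thesis
    using dist_triangle[of y z w] by (intro that[of z]) (auto simp: dist_norm[symmetric] dist_commute)
qed

lemma sum_even_odd: "(\<Sum>j<2*n. f j) = (\<Sum>i<n. f (2 * i)) + (\<Sum>i<n. f (2 * i + 1))"
  for f :: "nat \<Rightarrow> 'b::comm_monoid_add"
  by (induction n) (simp_all add: ac_simps)

text \<open>A unit vector in the span of the even terms has coefficient sum at least 1 / b, and
  subtracting odd terms cannot decrease the coefficient sum; so it keeps distance c / b from their
  span. This contradicts HI for every choice of the finite index set.\<close>

lemma l1_sequence_not_HI:
  fixes x :: "nat \<Rightarrow> 'a::complex_normed_vector"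
  assumes l1: "l1_sequence c x" and c: "0 < c" and b: "\<And>n. norm (x n) \<le> b"
  shows "\<not> HI fs \<xi> TYPE('a)"
proof
  assume HI: "HI fs \<xi> TYPE('a)"
  have low: "c \<le> norm (x n)" for n
    using l1[unfolded l1_sequence_def, rule_format, of "\<lambda>i. if i = n then 1 else 0" "Suc n"]
    by (simp add: if_distrib[of "\<lambda>a. a *\<^sub>C _"] if_distrib[of cmod] scaleC_one cong: if_cong)
  then have nz: "x n \<noteq> 0" for n using c by (metis norm_zero not_le)
  have b0: "0 < b" using low[of 0] b[of 0] c by linarith
  have g: "grunblum (b / c) x" by (rule l1_sequence_grunblum[OF l1 c b])
  define u where "u = x \<circ> (\<lambda>i. 2 * i)"
  define v where "v = x \<circ> (\<lambda>i. 2 * i + 1)"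
  have gu: "grunblum (b / c) u" unfolding u_def by (rule grunblum_subseq[OF g]) (simp add: strict_mono_def)
  have gv: "grunblum (b / c) v" unfolding v_def by (rule grunblum_subseq[OF g]) (simp add: strict_mono_def)
  have "\<not> cfinite_dim (complex_vector.span (range u))"
    by (rule grunblum_not_finite_dim[OF gu]) (simp add: u_def nz)
  moreover have "basic_sequence v" by (rule grunblum_basic[OF gv]) (simp add: v_def nz)
  ultimately obtain F y where F: "y \<in> complex_vector.span (range u)" "norm y = 1"
      "infdist y (closed_cspan (elt v ` F)) < c / b"
    using HI c b0 complex_vector.subspace_span[of "range u"] unfolding HI_def by (metis divide_pos_pos)
  obtain z where z: "z \<in> complex_vector.span (elt v ` F)" "norm (y - z) < c / b"
    by (rule infdist_closed_cspan_less[OF F(3)])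
  have "z \<in> complex_vector.span (range v)"
    using z(1) complex_vector.span_mono[of "elt v ` F" "range v"] by (auto simp: elt_def)
  then obtain \<beta> m where \<beta>: "z = (\<Sum>i<m. \<beta> i *\<^sub>C v i)" using cspan_range by blast
  obtain \<alpha> n where \<alpha>: "y = (\<Sum>i<n. \<alpha> i *\<^sub>C u i)" using cspan_range[OF F(1)] by blast
  define N where "N = max m n"
  \<comment> \<open>Interleaves the coefficients of \<open>y\<close> with those of -z.\<close>
  define \<gamma> where "\<gamma> j = (if even j then (if j div 2 < n then \<alpha> (j div 2) else 0)
    else (if j div 2 < m then - \<beta> (j div 2) else 0))" for j
  have "(\<Sum>i<N. \<gamma> (2 * i) *\<^sub>C x (2 * i)) = y"
    unfolding \<alpha> by (intro sum.mono_neutral_cong_right) (auto simp: N_def \<gamma>_def u_def)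
  moreover have "(\<Sum>i<N. \<gamma> (2 * i + 1) *\<^sub>C x (2 * i + 1)) = - z"
    unfolding \<beta> sum_negf[symmetric]
    by (intro sum.mono_neutral_cong_right) (auto simp: N_def \<gamma>_def v_def scaleC_minus_left)
  ultimately have eq: "(\<Sum>j<2*N. \<gamma> j *\<^sub>C x j) = y - z" unfolding sum_even_odd by simp
  have "1 \<le> b * (\<Sum>i<n. cmod (\<alpha> i))"
  proof -
    have "norm y \<le> (\<Sum>i<n. cmod (\<alpha> i) * b)"
      unfolding \<alpha> by (rule sum_norm_le) (auto simp: u_def norm_scaleC intro: mult_left_mono b)
    then show ?thesis using F(2) by (simp add: sum_distrib_left mult.commute)
  qed
  also have "(\<Sum>i<n. cmod (\<alpha> i)) \<le> (\<Sum>j<2*N. cmod (\<gamma> j))"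
  proof -
    have "(\<Sum>i<n. cmod (\<alpha> i)) = (\<Sum>i<N. cmod (\<gamma> (2 * i)))"
      by (intro sum.mono_neutral_cong_left) (auto simp: N_def \<gamma>_def)
    also have "\<dots> \<le> (\<Sum>j<2*N. cmod (\<gamma> j))" unfolding sum_even_odd by (simp add: sum_nonneg)
    finally show ?thesis .
  qed
  finally have "1 \<le> b * (\<Sum>j<2*N. cmod (\<gamma> j))" using b0 by simp
  then have "c / b \<le> c * (\<Sum>j<2*N. cmod (\<gamma> j))" using b0 c by (simp add: field_simps)
  also have "\<dots> \<le> norm (y - z)" using l1 eq unfolding l1_sequence_def by metis
  finally show False using z(2) by simp
qed

lemma HI_weakly_Cauchy_subseq:
  fixes x :: "nat \<Rightarrow> 'a::complex_normed_vector"
  assumes HI: "HI fs \<xi> TYPE('a)" and b: "\<And>n. norm (x n) \<le> b"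
  obtains r where "strict_mono r" "weakly_Cauchy (x \<circ> r)"
proof -
  have "\<exists>r. strict_mono r \<and> weakly_Cauchy (x \<circ> r)"
  proof (rule ccontr)
    assume "\<nexists>r. strict_mono r \<and> weakly_Cauchy (x \<circ> r)"
    then have nwc: "\<not> weakly_Cauchy (x \<circ> r)" if "strict_mono r" for r using that by blast
    obtain r c where "strict_mono r" "0 < c" "l1_sequence c (x \<circ> r)" by (rule rosenthal_l1[OF b nwc])
    then show False using l1_sequence_not_HI[of c "x \<circ> r" b] HI b by simp
  qed
  then show thesis using that by blast
qed

section \<open>Quasinilpotency from lower bounds\<close>

text \<open>Covers both weakly null sequences with the limsup norm and a compact operator on the
  whole space. The hypotheses are relative to \<open>V\<close> because the limsup norm is
  meaningless for unbounded sequences.\<close>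

locale seminormed_operator = vector_space scale
  for scale :: "complex \<Rightarrow> 'v::ab_group_add \<Rightarrow> 'v" (infixr "*s" 75) +
  fixes V :: "'v set" and q :: "'v \<Rightarrow> real" and T :: "'v \<Rightarrow> 'v" and M :: real
  assumes V: "subspace V"
    and q_add: "u \<in> V \<Longrightarrow> v \<in> V \<Longrightarrow> q (u + v) \<le> q u + q v"
    and q_scale: "u \<in> V \<Longrightarrow> q (a *s u) = cmod a * q u"
    and T_V: "u \<in> V \<Longrightarrow> T u \<in> V"
    and T_add: "u \<in> V \<Longrightarrow> v \<in> V \<Longrightarrow> T (u + v) = T u + T v"
    and T_scale: "u \<in> V \<Longrightarrow> T (a *s u) = a *s T u"
    and T_bound: "u \<in> V \<Longrightarrow> q (T u) \<le> M * q u"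
    and M: "0 \<le> M"
begin

lemmas V_closed [intro, simp] =
  subspace_add[OF V] subspace_diff[OF V] subspace_scale[OF V] subspace_neg[OF V] subspace_0[OF V]
  subspace_sum[OF V]

lemma q_zero: "q 0 = 0"
  using q_scale[of 0 0] by simp

lemma q_diff: "u \<in> V \<Longrightarrow> v \<in> V \<Longrightarrow> q (u - v) \<le> q u + q v"
  using q_add[of u "(-1) *s v"] q_scale[of v "-1"] by simp

lemma q_nonneg: "u \<in> V \<Longrightarrow> 0 \<le> q u"
  using q_diff[of u u] q_zero by simp

lemma q_sum:
  assumes "\<And>i. i \<in> A \<Longrightarrow> f i \<in> V"
  shows "q (\<Sum>i\<in>A. f i) \<le> (\<Sum>i\<in>A. q (f i))"
  using assms
proof (induction A rule: infinite_finite_induct)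
  case (insert i A)
  have "q (f i + sum f A) \<le> q (f i) + q (sum f A)" by (intro q_add) (auto simp: insert)
  then show ?case using insert by fastforce
qed (simp_all add: q_zero)

lemma T_diff: "u \<in> V \<Longrightarrow> v \<in> V \<Longrightarrow> T (u - v) = T u - T v"
  using T_add[of u "(-1) *s v"] T_scale[of v "-1"] by simp

lemma pow_V [intro, simp]: "u \<in> V \<Longrightarrow> (T ^^ n) u \<in> V"
  by (induction n) (auto intro: T_V)

text \<open>A truncated Neumann series, standing in for the resolvent (1 - z T)^-1.\<close>

definition neumann :: "complex \<Rightarrow> nat \<Rightarrow> 'v \<Rightarrow> 'v" where
  "neumann z n u = (\<Sum>m<n. z ^ m *s (T ^^ m) u)"

lemma neumann_V [intro, simp]: "u \<in> V \<Longrightarrow> neumann z n u \<in> V"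
  by (auto simp: neumann_def)

lemma neumann_telescope:
  assumes u: "u \<in> V"
  shows "neumann z n u - z *s T (neumann z n u) = u - z ^ n *s (T ^^ n) u"
proof (induction n)
  case 0
  have "T 0 = 0" using T_scale[of 0 0] by simp
  then show ?case by (simp add: neumann_def)
next
  case (Suc n)
  have eq: "neumann z (Suc n) u = neumann z n u + z ^ n *s (T ^^ n) u" by (simp add: neumann_def)
  have "T (neumann z (Suc n) u) = T (neumann z n u) + z ^ n *s (T ^^ Suc n) u"
    unfolding eq using u by (simp add: T_add T_scale)
  then have "neumann z (Suc n) u - z *s T (neumann z (Suc n) u)
      = (neumann z n u - z *s T (neumann z n u)) + z ^ n *s (T ^^ n) u - z ^ Suc n *s (T ^^ Suc n) u"
    unfolding eq by (simp add: scale_right_distrib algebra_simps)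
  then show ?case unfolding Suc by simp
qed

text \<open>Summing over the n-th roots of unity annihilates every power with exponent strictly
  between 0 and n.\<close>

lemma neumann_average:
  assumes n: "1 \<le> n"
  shows "(\<Sum>k<n. neumann (z * exp (2 * of_real pi * \<i> / of_nat n) ^ k) n u) = of_nat n *s u"
proof -
  define \<omega> where "\<omega> = exp (2 * of_real pi * \<i> / of_nat n)"
  have pow: "\<omega> ^ m = exp (2 * of_real pi * \<i> * of_nat m / of_nat n)" for m
    unfolding \<omega>_def exp_of_nat_mult[symmetric] by (simp add: mult_ac)
  have geo: "(\<Sum>k<n. (\<omega> ^ k) ^ m) = (if m = 0 then of_nat n else 0)" if "m < n" for m
  proof (cases "m = 0")
    case False
    have "\<omega> ^ m \<noteq> 1"
      using complex_root_unity_eq_1[OF n, of m] that False by (auto simp: pow dest: dvd_imp_le)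
    moreover have "(\<omega> ^ m) ^ n = 1"
    proof -
      have "(\<omega> ^ m) ^ n = \<omega> ^ (n * m)" by (simp add: power_mult[symmetric] mult.commute)
      also have "\<dots> = 1" unfolding pow using complex_root_unity_eq_1[OF n, of "n * m"] by simp
      finally show ?thesis .
    qed
    ultimately have "(\<Sum>k<n. (\<omega> ^ m) ^ k) = 0" by (simp add: geometric_sum)
    then show ?thesis using False by (simp add: power_mult[symmetric] mult.commute)
  qed simp
  have "(\<Sum>k<n. neumann (z * \<omega> ^ k) n u) = (\<Sum>m<n. \<Sum>k<n. (z * \<omega> ^ k) ^ m *s (T ^^ m) u)"
    unfolding neumann_def by (rule sum.swap)
  also have "\<dots> = (\<Sum>m<n. (z ^ m * (\<Sum>k<n. (\<omega> ^ k) ^ m)) *s (T ^^ m) u)"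
    by (simp add: power_mult_distrib scale_sum_left sum_distrib_left)
  also have "\<dots> = (\<Sum>m<n. if m = 0 then of_nat n *s u else 0)"
    by (intro sum.cong) (auto simp: geo)
  also have "\<dots> = of_nat n *s u" using n by simp
  finally show ?thesis by (simp add: \<omega>_def)
qed

lemma norm_root_of_unity: "cmod (exp (2 * of_real pi * \<i> / of_nat n) ^ k) = 1"
  by (simp add: norm_power norm_exp_eq_Re)

lemma root_of_unity_pow: "1 \<le> n \<Longrightarrow> (z * exp (2 * of_real pi * \<i> / of_nat n) ^ k) ^ n = z ^ n"
proof -
  assume n: "1 \<le> n"
  have "(exp (2 * of_real pi * \<i> / of_nat n) ^ k) ^ n = exp (2 * of_real pi * \<i> / of_nat n) ^ (n * k)"
    by (simp add: power_mult[symmetric] mult.commute)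
  also have "\<dots> = exp (2 * of_real pi * \<i> * of_nat (n * k) / of_nat n)"
    unfolding exp_of_nat_mult[symmetric] by (simp add: mult_ac)
  also have "\<dots> = 1" using complex_root_unity_eq_1[OF n, of "n * k"] by simp
  finally show ?thesis by (simp add: power_mult_distrib)
qed

text \<open>Adding the remaining error to \<open>u\<close> divides that error by 8. Iteration gives
  only approximate solutions, since the Neumann series may have no sum in \<open>V\<close>.\<close>

lemma approximate_preimage:
  assumes A: "\<And>u. u \<in> V \<Longrightarrow> q (a *s (T ^^ n) u) \<le> q u / 8" and w: "w \<in> V"
  shows "\<exists>u\<in>V. q (w - (u - a *s (T ^^ n) u)) \<le> (1 / 8) ^ N * q w"
proof (induction N)
  case 0
  have "a *s (T ^^ n) 0 = 0"
  proof -
    have "(T ^^ n) 0 = 0"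
    proof (induction n)
      case (Suc n)
      then show ?case using T_scale[of 0 0] by simp
    qed simp
    then show ?thesis by simp
  qed
  then show ?case by (intro bexI[of _ 0]) auto
next
  case (Suc N)
  then obtain u where u: "u \<in> V" "q (w - (u - a *s (T ^^ n) u)) \<le> (1 / 8) ^ N * q w" by blast
  define d where "d = w - (u - a *s (T ^^ n) u)"
  have d: "d \<in> V" unfolding d_def using u(1) w by auto
  have add: "(T ^^ n) (u + d) = (T ^^ n) u + (T ^^ n) d"
    by (induction n) (use u(1) d in \<open>simp_all add: T_add\<close>)
  have "w - ((u + d) - a *s (T ^^ n) (u + d)) = a *s (T ^^ n) d"
    unfolding add by (simp add: d_def scale_right_distrib)
  then have "q (w - ((u + d) - a *s (T ^^ n) (u + d))) \<le> q d / 8" using A[OF d] by simp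
  also have "\<dots> \<le> (1 / 8) ^ Suc N * q w" using u(2) by (simp add: d_def)
  finally show ?case using u(1) d by blast
qed

context
  fixes R c :: real
  assumes c: "0 < c" and below: "\<And>z u. cmod z \<le> R \<Longrightarrow> u \<in> V \<Longrightarrow> c * q u \<le> q (u - z *s T u)"
begin

text \<open>The averaging argument of Rickart's proof of the spectral radius formula, with resolvents
  replaced by lower bounds so that neither completeness nor surjectivity is needed.\<close>

lemma radius_step:
  assumes r: "0 \<le> r'" "r' \<le> r" "r \<le> R" "(r - r') * M \<le> c\<^sup>2 / 32" and n: "1 \<le> n"
    and H: "\<And>u. u \<in> V \<Longrightarrow> r' ^ n * q ((T ^^ n) u) \<le> q u / 8" and u: "u \<in> V"
  shows "r ^ n * q ((T ^^ n) u) \<le> q u / 2"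
proof -
  define \<omega> where "\<omega> k = exp (2 * of_real pi * \<i> / of_nat n) ^ k" for k
  have \<omega>: "cmod (\<omega> k) = 1" "(z * \<omega> k) ^ n = z ^ n" for k z
    using root_of_unity_pow[OF n, of z k] norm_root_of_unity[of n k] by (simp_all add: \<omega>_def)
  define A where "A s v = of_real s ^ n *s (T ^^ n) v" for s :: real and v
  have AV [simp]: "A s v \<in> V" if "v \<in> V" for s v using that by (simp add: A_def)
  have qA: "q (A s v) = s ^ n * q ((T ^^ n) v)" if "0 \<le> s" "v \<in> V" for s v
    using that by (simp add: A_def q_scale norm_power)
  define w where "w = u - A r u"
  have w: "w \<in> V" using u by (simp add: w_def)
  \<comment> \<open>Tolerance for replacing w by w'; it is small relative to both 1 and c, since it
    enters with and without division by c.\<close>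
  define \<tau> where "\<tau> = min 1 c / 64"
  have \<tau>: "0 < \<tau>" "\<tau> \<le> 1 / 64" "\<tau> \<le> c / 64" using c by (auto simp: \<tau>_def)
  obtain N where N: "(1 / 8) ^ N < \<tau>" using real_arch_pow_inv[OF \<tau>(1), of "1 / 8"] by auto
  \<comment> \<open>u' solves (1 - r'^n T^n) u' = w approximately, which the hypothesis at the
    smaller radius r' makes possible.\<close>
  obtain u' where u': "u' \<in> V" "q (w - (u' - A r' u')) \<le> (1 / 8) ^ N * q w"
    using approximate_preimage[of "of_real r' ^ n" n w N] w H qA[OF r(1)] unfolding A_def by auto
  define w' where "w' = u' - A r' u'"
  have w': "w' \<in> V" using u'(1) by (simp add: w'_def)
  have ww': "q (w - w') \<le> \<tau> * q w"
    using u'(2) mult_right_mono[OF less_imp_le[OF N] q_nonneg[OF w]] unfolding w'_def by linarith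
  have qw': "q w' \<le> (1 + \<tau>) * q w"
    using q_diff[of w "w - w'"] w w' ww' by (simp add: algebra_simps)
  \<comment> \<open>Values of the resolvent at n points of the circles of radius r and r', applied
    to w and w'; their averages are u and u'.\<close>
  define e where "e k = neumann (of_real r * \<omega> k) n u" for k
  define e' where "e' k = neumann (of_real r' * \<omega> k) n u'" for k
  have eV [simp]: "e k \<in> V" "e' k \<in> V" for k using u u' by (auto simp: e_def e'_def)
  have e: "e k - (of_real r * \<omega> k) *s T (e k) = w" for k
    unfolding e_def neumann_telescope[OF u] by (simp add: \<omega> w_def A_def)
  have e': "e' k - (of_real r' * \<omega> k) *s T (e' k) = w'" for k
    unfolding e'_def neumann_telescope[OF u'(1)] by (simp add: \<omega> w'_def A_def)
  have diff: "q (e k - e' k) \<le> q w / 16" for k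
  proof -
    have "c * q (e' k) \<le> q w'"
      using below[of "of_real r' * \<omega> k" "e' k"] r by (simp add: norm_mult \<omega> e')
    then have ce': "c * q (e' k) \<le> (1 + \<tau>) * q w" using qw' by linarith
    \<comment> \<open>The resolvent identity. The lower bound is used once for the difference and
      once for \<open>e' k\<close>, whence the c^2 in the admissible step of the radius.\<close>
    have "(e k - e' k) - (of_real r * \<omega> k) *s T (e k - e' k)
        = (e k - (of_real r * \<omega> k) *s T (e k)) - (e' k - (of_real r' * \<omega> k) *s T (e' k))
          + ((of_real r - of_real r') * \<omega> k) *s T (e' k)"
      by (simp add: T_diff scale_right_diff_distrib left_diff_distrib scale_left_diff_distrib)
    also have "\<dots> = (w - w') + ((of_real r - of_real r') * \<omega> k) *s T (e' k)" by (simp only: e e')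
    finally have eq: "(e k - e' k) - (of_real r * \<omega> k) *s T (e k - e' k)
        = (w - w') + ((of_real r - of_real r') * \<omega> k) *s T (e' k)" .
    have "c * q (e k - e' k) \<le> q ((w - w') + ((of_real r - of_real r') * \<omega> k) *s T (e' k))"
      using below[of "of_real r * \<omega> k" "e k - e' k"] r by (simp add: norm_mult \<omega> eq)
    also have "\<dots> \<le> q (w - w') + cmod ((of_real r - of_real r') * \<omega> k) * q (T (e' k))"
      using w w' by (intro order_trans[OF q_add]) (auto simp: q_scale T_V)
    also have "cmod ((of_real r - of_real r') * \<omega> k) = r - r'"
      using r(2) by (simp add: norm_mult \<omega> of_real_diff[symmetric] del: of_real_diff)
    also have "(r - r') * q (T (e' k)) \<le> (r - r') * (M * q (e' k))"
      using r(2) by (intro mult_left_mono T_bound) auto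
    also have "(r - r') * (M * q (e' k)) \<le> c\<^sup>2 / 32 * q (e' k)"
      using mult_right_mono[OF r(4) q_nonneg[OF eV(2)]] by (simp add: mult_ac)
    also have "c\<^sup>2 / 32 * q (e' k) = c / 32 * (c * q (e' k))" by (simp add: power2_eq_square)
    also have "c / 32 * (c * q (e' k)) \<le> c / 32 * ((1 + \<tau>) * q w)"
      using ce' c by (intro mult_left_mono) auto
    finally have "c * q (e k - e' k) \<le> \<tau> * q w + c / 32 * ((1 + \<tau>) * q w)" using ww' by linarith
    also have "\<dots> \<le> c / 64 * q w + c / 32 * ((1 + 1 / 64) * q w)"
      using \<tau> c q_nonneg[OF w] by (intro add_mono mult_left_mono mult_right_mono) auto
    also have "\<dots> \<le> c * (q w / 16)" using c q_nonneg[OF w] by (simp add: field_simps)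
    finally show ?thesis using c by simp
  qed
  have uu': "q (u - u') \<le> q w / 16"
  proof -
    have "of_nat n *s (u - u') = (\<Sum>k<n. e k - e' k)"
      using neumann_average[OF n, of "of_real r" u] neumann_average[OF n, of "of_real r'" u']
      by (simp add: sum_subtractf e_def e'_def \<omega>_def scale_right_diff_distrib)
    then have "real n * q (u - u') = q (\<Sum>k<n. e k - e' k)"
      using q_scale[of "u - u'" "of_nat n"] u u' by simp
    also have "\<dots> \<le> (\<Sum>k<n. q w / 16)"
      by (rule order_trans[OF q_sum]) (auto intro!: sum_mono diff simp del: sum_constant)
    finally show ?thesis using n by simp
  qed
  have A': "q (A r' u') \<le> q u' / 8" using H[OF u'(1)] qA[OF r(1) u'(1)] by simp
  have "q u' \<le> q w' + q (A r' u')"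
    using q_add[of w' "A r' u'"] w' u' by (simp add: w'_def)
  then have "q u' \<le> 8 / 7 * q w'" using A' by linarith
  then have "q (A r' u') \<le> (1 + \<tau>) * q w / 7" using A' qw' by linarith
  also have "\<dots> \<le> (1 + 1 / 64) * q w / 7"
    using \<tau> q_nonneg[OF w] by (intro divide_right_mono mult_right_mono) auto
  finally have A'': "q (A r' u') \<le> 65 / 448 * q w" by simp
  have "\<tau> * q w \<le> 1 / 64 * q w" using \<tau> q_nonneg[OF w] by (intro mult_right_mono)
  \<comment> \<open>The three pieces fit into q w / 4, since 1/16 + 65/448 + 1/64 < 1/4; passing
    from q w to q u then costs another q (A r u), which can be absorbed.\<close>
  moreover have "A r u = (u - u') + (A r' u' - (w - w'))" by (simp add: w_def w'_def)
  then have "q (A r u) \<le> q (u - u') + (q (A r' u') + q (w - w'))"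
    using q_add[of "u - u'" "A r' u' - (w - w')"] q_diff[of "A r' u'" "w - w'"] u u' w w' by simp
  ultimately have "q (A r u) \<le> q w / 4" using uu' A'' ww' q_nonneg[OF w] by linarith
  moreover have "q w \<le> q u + q (A r u)" unfolding w_def using u by (intro q_diff) auto
  ultimately have "q (A r u) \<le> q u / 2" using q_nonneg[OF u] by linarith
  then show ?thesis using qA[of r u] r u by simp
qed

text \<open>The radius grows in steps of length \<delta>, which depends only on \<open>c\<close> and
  \<open>M\<close>, so finitely many steps reach r.\<close>

lemma powers_eventually_small:
  assumes r: "0 \<le> r" "r < R"
  shows "\<exists>N. \<forall>n\<ge>N. \<forall>u\<in>V. r ^ n * q ((T ^^ n) u) \<le> q u / 8"
proof -
  \<comment> \<open>One application of \<open>radius_step\<close> goes from s' to t, a distance of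
    up to 2 \<delta>; M + 1 avoids a division by zero.\<close>
  define \<delta> where "\<delta> = c\<^sup>2 / (64 * (M + 1))"
  have \<delta>: "0 < \<delta>" using c M by (simp add: \<delta>_def)
  have \<delta>M: "2 * \<delta> * M \<le> c\<^sup>2 / 32"
  proof -
    have "2 * \<delta> * M \<le> 2 * \<delta> * (M + 1)" using \<delta> by (intro mult_left_mono) auto
    also have "\<dots> = c\<^sup>2 / 32" using M by (simp add: \<delta>_def field_simps)
    finally show ?thesis .
  qed
  have step: "\<exists>N. \<forall>n\<ge>N. \<forall>u\<in>V. s ^ n * q ((T ^^ n) u) \<le> q u / 8"
    if s: "0 \<le> s'" "s' \<le> s" "s \<le> s' + \<delta>" "s < R"
      and H: "\<exists>N. \<forall>n\<ge>N. \<forall>u\<in>V. s' ^ n * q ((T ^^ n) u) \<le> q u / 8" for s s'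
  proof -
    obtain N where N: "\<And>n u. n \<ge> N \<Longrightarrow> u \<in> V \<Longrightarrow> s' ^ n * q ((T ^^ n) u) \<le> q u / 8" using H by blast
    \<comment> \<open>\<open>radius_step\<close> at the slightly larger radius t leaves only the
      factor 1/2; returning to s gains (s/t)^n < 1/4 and restores 1/8.\<close>
    define t where "t = min R (s + \<delta>)"
    have t: "s < t" "t \<le> R" "t - s' \<le> 2 * \<delta>" "0 < t" using s \<delta> by (auto simp: t_def)
    have tM: "(t - s') * M \<le> c\<^sup>2 / 32" using mult_right_mono[OF t(3) M] \<delta>M by linarith
    have st: "0 \<le> s / t" "s / t < 1" using s t by auto
    then have "(\<lambda>n. (s / t) ^ n) \<longlonglongrightarrow> 0" by (intro LIMSEQ_power_zero) simp
    then have "\<forall>\<^sub>F n in sequentially. (s / t) ^ n < 1 / 4" by (rule order_tendstoD(2)) simp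
    then obtain N' where N': "\<And>n. n \<ge> N' \<Longrightarrow> (s / t) ^ n < 1 / 4"
      unfolding eventually_sequentially by blast
    have "s ^ n * q ((T ^^ n) u) \<le> q u / 8" if n: "n \<ge> max 1 (max N N')" and u: "u \<in> V" for n u
    proof -
      have "t ^ n * q ((T ^^ n) u) \<le> q u / 2"
        using n s t by (intro radius_step[OF s(1) _ t(2) tM _ N u]) auto
      then have "(s / t) ^ n * (t ^ n * q ((T ^^ n) u)) \<le> 1 / 4 * (q u / 2)"
        using N'[of n] n t s u by (intro mult_mono) (auto simp: q_nonneg intro: less_imp_le)
      then show ?thesis using t(4) by (simp add: power_divide)
    qed
    then show ?thesis by blast
  qed
  have "\<exists>N. \<forall>n\<ge>N. \<forall>u\<in>V. s ^ n * q ((T ^^ n) u) \<le> q u / 8"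
    if "0 \<le> s" "s < R" "s \<le> real j * \<delta>" for s j
    using that
  proof (induction j arbitrary: s)
    case 0
    then have "s = 0" by simp
    then show ?case using q_nonneg by (intro exI[of _ 1]) (auto simp: power_0_left)
  next
    case (Suc j)
    show ?case
    proof (rule step[of "max 0 (s - \<delta>)"])
      show "\<exists>N. \<forall>n\<ge>N. \<forall>u\<in>V. max 0 (s - \<delta>) ^ n * q ((T ^^ n) u) \<le> q u / 8"
        using Suc.prems \<delta> by (intro Suc.IH) (auto simp: algebra_simps)
    qed (use Suc.prems \<delta> in auto)
  qed
  moreover obtain j :: nat where "r \<le> real j * \<delta>"
    using reals_Archimedean3[OF \<delta>] by (metis less_imp_le)
  ultimately show ?thesis using r by blast
qed

end

text \<open>A lower bound at one parameter persists, halved, nearby; compactness of the disc does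
  the rest.\<close>

lemma uniformly_bounded_below:
  assumes "\<And>z. \<exists>c>0. \<forall>u\<in>V. c * q u \<le> q (u - z *s T u)"
  obtains c where "0 < c" "\<And>z u. cmod z \<le> R \<Longrightarrow> u \<in> V \<Longrightarrow> c * q u \<le> q (u - z *s T u)"
proof -
  obtain c where c: "\<And>z. 0 < c z" "\<And>z u. u \<in> V \<Longrightarrow> c z * q u \<le> q (u - z *s T u)"
    using assms by metis
  define \<rho> where "\<rho> z = c z / (2 * (M + 1))" for z
  have \<rho>: "0 < \<rho> z" for z using c(1)[of z] M by (simp add: \<rho>_def)
  obtain K where K: "finite K" "cball 0 R \<subseteq> (\<Union>z\<in>K. ball z (\<rho> z))"
  proof (rule compactE_image[OF compact_cball, of "cball 0 R" "\<lambda>z. ball z (\<rho> z)" 0 R])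
    show "cball 0 R \<subseteq> (\<Union>z\<in>cball 0 R. ball z (\<rho> z))" using \<rho> by auto
  qed auto
  define d where "d = Min (insert 1 ((\<lambda>z. c z / 2) ` K))"
  have d: "0 < d" using c(1) K(1) by (simp add: d_def)
  show thesis
  proof (rule that[OF d])
    fix z u assume z: "cmod z \<le> R" and u: "u \<in> V"
    then obtain z' where z': "z' \<in> K" "cmod (z' - z) < \<rho> z'" using K(2) by (auto simp: dist_norm)
    have "cmod (z' - z) * M \<le> \<rho> z' * (M + 1)" using z'(2) M \<rho>[of z'] by (intro mult_mono) auto
    also have "\<dots> = c z' / 2"
    proof -
      have "M + 1 \<noteq> 0" using M by linarith
      then show ?thesis unfolding \<rho>_def by (metis nonzero_mult_divide_mult_cancel_right times_divide_eq_left)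
    qed
    finally have le: "cmod (z' - z) * M \<le> c z' / 2" .
    have "c z' * q u \<le> q (u - z' *s T u)" by (rule c(2)[OF u])
    also have "u - z' *s T u = (u - z *s T u) - (z' - z) *s T u" by (simp add: scale_left_diff_distrib)
    also have "q \<dots> \<le> q (u - z *s T u) + cmod (z' - z) * q (T u)"
      using u by (intro order_trans[OF q_diff]) (auto simp: T_V q_scale)
    also have "cmod (z' - z) * q (T u) \<le> cmod (z' - z) * (M * q u)"
      by (intro mult_left_mono T_bound u) auto
    also have "\<dots> \<le> c z' / 2 * q u"
      using mult_right_mono[OF le q_nonneg[OF u]] by (simp add: mult_ac)
    finally have "c z' / 2 * q u \<le> q (u - z *s T u)" by (simp add: field_simps)
    moreover have "d \<le> c z' / 2" unfolding d_def using K(1) z'(1) by (intro Min_le) auto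
    ultimately show "d * q u \<le> q (u - z *s T u)"
      using mult_right_mono[OF _ q_nonneg[OF u]] by (metis order_trans)
  qed
qed

text \<open>The lower bounds exclude nonzero approximate eigenvalues. Boundary points of a spectrum
  are approximate eigenvalues, so the spectral radius ought to vanish, and the growth estimate
  expresses just that.\<close>

theorem quasinilpotent:
  assumes "\<And>z. \<exists>c>0. \<forall>u\<in>V. c * q u \<le> q (u - z *s T u)" and r: "0 \<le> r"
  shows "\<exists>N. \<forall>n\<ge>N. \<forall>u\<in>V. r ^ n * q ((T ^^ n) u) \<le> q u"
proof -
  obtain c where c: "0 < c" "\<And>z u. cmod z \<le> r + 1 \<Longrightarrow> u \<in> V \<Longrightarrow> c * q u \<le> q (u - z *s T u)"
    using uniformly_bounded_below[OF assms(1)] by metis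
  have "\<exists>N. \<forall>n\<ge>N. \<forall>u\<in>V. r ^ n * q ((T ^^ n) u) \<le> q u / 8"
    by (rule powers_eventually_small[where R = "r + 1", OF c r]) linarith+
  then obtain N where N: "\<And>n u. n \<ge> N \<Longrightarrow> u \<in> V \<Longrightarrow> r ^ n * q ((T ^^ n) u) \<le> q u / 8"
    by blast
  have "r ^ n * q ((T ^^ n) u) \<le> q u" if "n \<ge> N" "u \<in> V" for n u
    using N[OF that] q_nonneg[OF that(2)] by linarith
  then show ?thesis by blast
qed

end

section \<open>Schreier singular perturbations of the identity\<close>

lemma weakly_null_iff_dual_ball:
  "weakly_null x \<longleftrightarrow> (\<forall>\<phi>\<in>dual_ball. (\<lambda>n. \<phi> (x n)) \<longlonglongrightarrow> 0)"
proof
  assume "weakly_null x"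
  then show "\<forall>\<phi>\<in>dual_ball. (\<lambda>n. \<phi> (x n)) \<longlonglongrightarrow> 0"
    by (simp add: weakly_null_def dual_ball_bounded_clinear)
next
  assume *: "\<forall>\<phi>\<in>dual_ball. (\<lambda>n. \<phi> (x n)) \<longlonglongrightarrow> 0"
  show "weakly_null x" unfolding weakly_null_def
  proof (intro allI impI)
    fix \<phi> :: "'a \<Rightarrow> complex" assume \<phi>: "bounded_clinear \<phi>"
    then have bl: "bounded_linear \<phi>" and sc: "\<And>c v. \<phi> (c *\<^sub>C v) = c * \<phi> v"
      by (auto simp: bounded_clinear_def scaleC_complex_def)
    obtain K where K: "0 < K" "\<And>v. cmod (\<phi> v) \<le> norm v * K"
      using bounded_linear.pos_bounded[OF bl] by blast
    define \<psi> where "\<psi> v = \<phi> v / of_real K" for v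
    have "bounded_linear \<psi>" unfolding \<psi>_def by (intro bounded_linear_divide bounded_linear_compose[OF bounded_linear_divide bl])
    moreover have "cmod (\<psi> v) \<le> norm v" for v
      using K(1) K(2)[of v] by (simp add: \<psi>_def norm_divide field_simps)
    ultimately have "\<psi> \<in> dual_ball"
      by (simp add: dual_ball_def bounded_clinear_def sc \<psi>_def scaleC_complex_def)
    then have "(\<lambda>n. of_real K * \<psi> (x n)) \<longlonglongrightarrow> of_real K * 0" using * by (intro tendsto_intros) auto
    then show "(\<lambda>n. \<phi> (x n)) \<longlonglongrightarrow> 0" using K(1) by (simp add: \<psi>_def)
  qed
qed

section \<open>Bounded complex-linear operators\<close>

lemma bounded_clinearD:
  assumes "bounded_clinear T"
  shows bounded_clinear_bounded_linear: "bounded_linear T"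
    and bounded_clinear_scale: "T (c *\<^sub>C v) = c *\<^sub>C T v"
  using assms by (auto simp: bounded_clinear_def)

lemma bounded_clinear_compose:
  assumes "bounded_clinear S" "bounded_clinear T"
  shows "bounded_clinear (\<lambda>x. S (T x))"
  using assms by (auto simp: bounded_clinear_def intro: bounded_linear_compose)

lemma bounded_clinear_sum:
  assumes "bounded_clinear T"
  shows "T (\<Sum>i\<in>A. a i *\<^sub>C x i) = (\<Sum>i\<in>A. a i *\<^sub>C T (x i))"
proof -
  interpret bounded_linear T using assms by (rule bounded_clinear_bounded_linear)
  show ?thesis by (simp add: sum bounded_clinear_scale[OF assms])
qed

lemma bounded_clinear_scaleC: "bounded_clinear (\<lambda>v. c *\<^sub>C v)"
proof -
  have "bounded_linear (\<lambda>v::'a. c *\<^sub>C v)"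
    by (rule bounded_linear_intro[where K = "cmod c"])
      (simp_all add: scaleC_add_right scaleC_scaleR_commute norm_scaleC mult.commute)
  then show ?thesis by (simp add: bounded_clinear_def scaleC_scaleC mult.commute)
qed

lemma bounded_clinear_funpow:
  fixes S :: "'a::complex_normed_vector \<Rightarrow> 'a"
  assumes S: "bounded_clinear S"
  shows "bounded_clinear (S ^^ n)"
proof (induction n)
  case 0
  show ?case by (simp add: bounded_clinear_def id_def bounded_linear_ident)
next
  case (Suc n)
  then show ?case using bounded_clinear_compose[OF S Suc] by (simp add: o_def)
qed

lemma bounded_clinear_diff:
  assumes "bounded_clinear S" "bounded_clinear T"
  shows "bounded_clinear (\<lambda>x. S x - T x)"
  using assms
  by (auto simp: bounded_clinear_def complex_vector.scale_right_diff_distrib intro: bounded_linear_sub)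

lemma weakly_null_image:
  fixes T :: "'a::complex_normed_vector \<Rightarrow> 'b::complex_normed_vector"
  assumes "weakly_null x" "bounded_clinear T"
  shows "weakly_null (\<lambda>n. T (x n))"
  unfolding weakly_null_def
proof (intro allI impI)
  fix \<phi> :: "'b \<Rightarrow> complex" assume "bounded_clinear \<phi>"
  then have "bounded_clinear (\<lambda>v. \<phi> (T v))" using assms(2) by (rule bounded_clinear_compose)
  then show "(\<lambda>n. \<phi> (T (x n))) \<longlonglongrightarrow> 0" using assms(1) unfolding weakly_null_def by blast
qed

lemma weakly_null_subseq:
  assumes "weakly_null x" "strict_mono r"
  shows "weakly_null (x \<circ> r)"
  using assms LIMSEQ_subseq_LIMSEQ by (fastforce simp: weakly_null_def o_def)

section \<open>Separated sequences and weakly null differences\<close>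

lemma kernel_not_finite_dim:
  fixes \<Phi> :: "('a::complex_normed_vector \<Rightarrow> complex) set"
  assumes "\<not> cfinite_dim (UNIV :: 'a set)" "finite \<Phi>" "\<Phi> \<subseteq> dual_ball"
  shows "\<not> cfinite_dim {v. \<forall>\<phi>\<in>\<Phi>. \<phi> v = 0}"
  using assms(2,3)
proof (induction \<Phi> rule: finite_induct)
  case empty
  then show ?case using assms(1) by simp
next
  case (insert \<phi> \<Phi>)
  define W where "W = {v. \<forall>\<psi>\<in>\<Phi>. \<psi> v = 0}"
  have \<phi>: "\<phi> \<in> dual_ball" and \<Phi>: "\<And>\<psi>. \<psi> \<in> \<Phi> \<Longrightarrow> \<psi> \<in> dual_ball" using insert.prems by auto
  show ?case
  proof
    assume "cfinite_dim {v. \<forall>\<psi>\<in>insert \<phi> \<Phi>. \<psi> v = 0}"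
    then obtain B where B: "finite B" "{v. \<forall>\<psi>\<in>insert \<phi> \<Phi>. \<psi> v = 0} \<subseteq> complex_vector.span B"
      by (auto simp: cfinite_dim_def)
    have "cfinite_dim W"
    proof (cases "\<exists>w\<in>W. \<phi> w \<noteq> 0")
      case True
      then obtain w where w: "w \<in> W" "\<phi> w \<noteq> 0" by blast
      have "v \<in> complex_vector.span (insert w B)" if v: "v \<in> W" for v
      proof -
        have "v - (\<phi> v / \<phi> w) *\<^sub>C w \<in> {v. \<forall>\<psi>\<in>insert \<phi> \<Phi>. \<psi> v = 0}"
          using v w \<Phi> \<phi> by (auto simp: W_def dual_ball_diff dual_ball_scale)
        then have "v - (\<phi> v / \<phi> w) *\<^sub>C w \<in> complex_vector.span B" using B(2) by blast
        then show ?thesis by (auto simp: complex_vector.span_breakdown_eq)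
      qed
      then show ?thesis using B(1) unfolding cfinite_dim_def by (intro exI[of _ "insert w B"]) auto
    next
      case False
      then have "W \<subseteq> complex_vector.span B" using B(2) by (auto simp: W_def)
      then show ?thesis using B(1) by (auto simp: cfinite_dim_def)
    qed
    then show False using insert by (auto simp: W_def)
  qed
qed

lemma unit_vector_in_kernel:
  fixes \<Phi> :: "('a::complex_normed_vector \<Rightarrow> complex) set"
  assumes "\<not> cfinite_dim (UNIV :: 'a set)" "finite \<Phi>" "\<Phi> \<subseteq> dual_ball"
  obtains v where "norm v = 1" "\<forall>\<phi>\<in>\<Phi>. \<phi> v = 0"
proof -
  have "\<not> {v. \<forall>\<phi>\<in>\<Phi>. \<phi> v = 0} \<subseteq> {0}"
  proof
    assume "{v. \<forall>\<phi>\<in>\<Phi>. \<phi> v = 0} \<subseteq> {0}"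
    then have "cfinite_dim {v. \<forall>\<phi>\<in>\<Phi>. \<phi> v = 0}"
      unfolding cfinite_dim_def by (intro exI[of _ "{}"]) simp
    then show False using kernel_not_finite_dim[OF assms] by simp
  qed
  then obtain w where w: "\<forall>\<phi>\<in>\<Phi>. \<phi> w = 0" "w \<noteq> 0" by auto
  define v where "v = complex_of_real (1 / norm w) *\<^sub>C w"
  have "norm v = 1" using w(2) by (simp add: v_def norm_scaleC norm_divide)
  moreover have "\<phi> v = 0" if "\<phi> \<in> \<Phi>" for \<phi>
  proof -
    have "\<phi> \<in> dual_ball" using that assms(3) by auto
    then show ?thesis using w(1) that by (simp add: v_def dual_ball_scale)
  qed
  ultimately show thesis using that by blast
qed

lemma unit_vectors_without_Cauchy_subseq:
  assumes "\<not> cfinite_dim (UNIV :: 'a::complex_normed_vector set)"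
  obtains s :: "nat \<Rightarrow> 'a::complex_normed_vector" where "\<forall>n. norm (s n) = 1" "\<forall>r. strict_mono r \<longrightarrow> \<not> Cauchy (s \<circ> r)"
proof -
  have step: "\<exists>j. norm j = 1 \<and> 1 \<le> norm (id j) \<and> (\<forall>\<phi>\<in>\<Phi>. cmod (\<phi> (id j)) \<le> \<eta>)"
    if \<Phi>: "finite \<Phi>" "\<Phi> \<subseteq> dual_ball" and \<eta>: "0 < \<eta>" for \<Phi> :: "('a \<Rightarrow> complex) set" and \<eta> :: real
  proof -
    obtain v where "norm v = 1" "\<forall>\<phi>\<in>\<Phi>. \<phi> v = 0"
      by (rule unit_vector_in_kernel[OF assms \<Phi>])
    then show ?thesis using \<eta> by (intro exI[of _ v]) auto
  qed
  obtain s' :: "nat \<Rightarrow> 'a" where s': "\<forall>m. norm (s' (Suc m)) = 1" "\<forall>m. 1 \<le> norm (id (s' m))" "grunblum 2 (id \<circ> s')"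
    by (rule mazur_selection[OF zero_less_one step])
  \<comment> \<open>The side condition speaks of successors only, so the first vector need not have
    norm 1 and is dropped.\<close>
  define s where "s = s' \<circ> Suc"
  have g: "grunblum 2 s" unfolding s_def using grunblum_subseq[of 2 s' Suc] s'(3) by (simp add: strict_mono_def)
  have n1: "norm (s n) = 1" for n using s'(1) by (simp add: s_def)
  \<comment> \<open>1 / (2 C) for the basis constant C = 2.\<close>
  have sep: "1 / 4 \<le> norm (s m - s n)" if "m < n" for m n
  proof -
    define a :: "nat \<Rightarrow> complex" where "a i = (if i = m then 1 else if i = n then -1 else 0)" for i
    have "(\<Sum>i<Suc n. a i *\<^sub>C s i) = (\<Sum>i\<in>{m, n}. a i *\<^sub>C s i)"
      using that by (intro sum.mono_neutral_right) (auto simp: a_def)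
    also have "\<dots> = s m - s n" using that by (simp add: a_def scaleC_one scaleC_minus_left)
    finally have "cmod (a m) * norm (s m) \<le> 2 * 2 * norm (s m - s n)"
      using grunblum_coeff[OF g, of m "Suc n" a] that by simp
    then show ?thesis by (simp add: a_def n1)
  qed
  have "\<not> Cauchy (s \<circ> r)" if r: "strict_mono r" for r
  proof
    assume "Cauchy (s \<circ> r)"
    then obtain N where N: "\<forall>m\<ge>N. \<forall>n\<ge>N. dist ((s \<circ> r) m) ((s \<circ> r) n) < 1 / 4"
      using metric_CauchyD[of "s \<circ> r" "1 / 4"] by auto
    then have "dist (s (r N)) (s (r (Suc N))) < 1 / 4" by simp
    moreover have "r N < r (Suc N)" using r by (simp add: strict_mono_def)
    ultimately show False using sep[of "r N" "r (Suc N)"] by (simp add: dist_norm)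
  qed
  then show thesis using n1 that by blast
qed

text \<open>Differences of far terms of a weakly Cauchy sequence are weakly null, and failure of the
  Cauchy property keeps their images away from zero. Used for the identity and for a power of an
  operator.\<close>

lemma weakly_null_differences:
  fixes x :: "nat \<Rightarrow> 'a::complex_normed_vector" and U :: "'a \<Rightarrow> 'a"
  assumes HI: "HI fs \<xi> TYPE('a)" and b: "\<And>n. norm (x n) \<le> b" and U: "bounded_linear U"
    and nc: "\<And>r. strict_mono r \<Longrightarrow> \<not> Cauchy (\<lambda>n. U (x (r n)))"
  obtains d \<epsilon> where "weakly_null d" "\<forall>n. norm (d n) \<le> 2 * b" "0 < \<epsilon>" "\<forall>n. \<epsilon> \<le> norm (U (d n))"
proof -
  obtain r where r: "strict_mono r" "weakly_Cauchy (x \<circ> r)" by (rule HI_weakly_Cauchy_subseq[OF HI b])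
  obtain \<epsilon> where \<epsilon>: "0 < \<epsilon>" "\<forall>N. \<exists>m\<ge>N. \<exists>n\<ge>N. \<epsilon> \<le> dist (U (x (r m))) (U (x (r n)))"
    using nc[OF r(1)] by (auto simp: Cauchy_def not_less)
  then obtain k l where kl: "\<And>N. k N \<ge> N" "\<And>N. l N \<ge> N" "\<And>N. \<epsilon> \<le> dist (U (x (r (k N)))) (U (x (r (l N))))"
    by metis
  define d where "d N = x (r (k N)) - x (r (l N))" for N
  have top: "filterlim k at_top sequentially" "filterlim l at_top sequentially"
    using kl(1,2) by (auto intro!: filterlim_at_top_mono[OF filterlim_ident])
  have "weakly_null d" unfolding weakly_null_iff_dual_ball
  proof
    fix \<phi> :: "'a \<Rightarrow> complex" assume \<phi>: "\<phi> \<in> dual_ball"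
    obtain L where L: "(\<lambda>n. \<phi> (x (r n))) \<longlonglongrightarrow> L"
      using r(2) \<phi> by (auto simp: weakly_Cauchy_def convergent_def)
    have "(\<lambda>N. \<phi> (x (r (k N))) - \<phi> (x (r (l N)))) \<longlonglongrightarrow> L - L"
      by (intro tendsto_diff filterlim_compose[OF L] top)
    then show "(\<lambda>n. \<phi> (d n)) \<longlonglongrightarrow> 0" by (simp add: d_def dual_ball_diff[OF \<phi>])
  qed
  moreover have "norm (d n) \<le> 2 * b" for n
    using norm_triangle_ineq4[of "x (r (k n))" "x (r (l n))"] b[of "r (k n)"] b[of "r (l n)"]
    by (simp add: d_def)
  moreover have "\<epsilon> \<le> norm (U (d n))" for n
    using kl(3)[of n] by (simp add: d_def dist_norm linear_diff[OF bounded_linear.linear[OF U]])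
  ultimately show thesis using \<epsilon>(1) that by blast
qed

text \<open>The limit superior of the norms, for bounded sequences. As an infimum of eventual bounds
  it is estimated by exhibiting one bound.\<close>

definition asymptotic_norm :: "(nat \<Rightarrow> 'a::real_normed_vector) \<Rightarrow> real" where
  "asymptotic_norm x = Inf {B. 0 \<le> B \<and> (\<forall>\<^sub>F n in sequentially. norm (x n) \<le> B)}"

lemma asymptotic_norm_le:
  assumes "0 \<le> B" "\<forall>\<^sub>F n in sequentially. norm (x n) \<le> B"
  shows "asymptotic_norm x \<le> B"
  unfolding asymptotic_norm_def by (rule cInf_lower) (use assms in \<open>auto intro: bdd_belowI[of _ 0]\<close>)

lemma asymptotic_norm_bounds:
  assumes "\<forall>n. norm (x n) \<le> b"
  shows asymptotic_norm_nonneg: "0 \<le> asymptotic_norm x"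
    and eventually_less_asymptotic_norm:
      "asymptotic_norm x < B \<Longrightarrow> \<forall>\<^sub>F n in sequentially. norm (x n) < B"
proof -
  let ?S = "{B. 0 \<le> B \<and> (\<forall>\<^sub>F n in sequentially. norm (x n) \<le> B)}"
  have "0 \<le> b" using assms norm_ge_zero order_trans by blast
  then have ne: "?S \<noteq> {}" using assms by (auto intro!: exI[of _ b])
  then show "0 \<le> asymptotic_norm x" unfolding asymptotic_norm_def by (rule cInf_greatest) auto
  assume "asymptotic_norm x < B"
  then obtain B' where B': "B' \<in> ?S" "B' < B" using cInf_lessD[OF ne] unfolding asymptotic_norm_def by blast
  then show "\<forall>\<^sub>F n in sequentially. norm (x n) < B" by (auto elim: eventually_mono)
qed

lemma asymptotic_norm_mono:
  assumes x: "\<forall>n. norm (x n) \<le> b" and M: "0 \<le> M" and le: "\<And>n. norm (y n) \<le> M * norm (x n)"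
  shows "asymptotic_norm y \<le> M * asymptotic_norm x"
proof (rule field_le_epsilon)
  fix e :: real assume e: "0 < e"
  define d where "d = e / (M + 1)"
  have d: "0 < d" "M * d \<le> e" using e M by (auto simp: d_def field_simps)
  have "\<forall>\<^sub>F n in sequentially. norm (x n) < asymptotic_norm x + d"
    using d by (intro eventually_less_asymptotic_norm[OF x]) simp
  then have "\<forall>\<^sub>F n in sequentially. norm (y n) \<le> M * (asymptotic_norm x + d)"
    by eventually_elim (use M in \<open>auto intro!: order_trans[OF le] mult_left_mono\<close>)
  then have "asymptotic_norm y \<le> M * (asymptotic_norm x + d)"
    using M d asymptotic_norm_nonneg[OF x] by (intro asymptotic_norm_le) auto
  then show "asymptotic_norm y \<le> M * asymptotic_norm x + e" using d by (simp add: distrib_left)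
qed

lemma asymptotic_norm_add:
  assumes x: "\<forall>n. norm (x n) \<le> b" and y: "\<forall>n. norm (y n) \<le> b'"
  shows "asymptotic_norm (\<lambda>n. x n + y n) \<le> asymptotic_norm x + asymptotic_norm y"
proof (rule field_le_epsilon)
  fix e :: real assume e: "0 < e"
  have "\<forall>\<^sub>F n in sequentially. norm (x n) < asymptotic_norm x + e / 2"
    using e by (intro eventually_less_asymptotic_norm[OF x]) simp
  moreover have "\<forall>\<^sub>F n in sequentially. norm (y n) < asymptotic_norm y + e / 2"
    using e by (intro eventually_less_asymptotic_norm[OF y]) simp
  ultimately have "\<forall>\<^sub>F n in sequentially. norm (x n + y n) \<le> asymptotic_norm x + asymptotic_norm y + e"
  proof eventually_elim
    case (elim n)
    then show ?case using norm_triangle_ineq[of "x n" "y n"] by simp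
  qed
  then show "asymptotic_norm (\<lambda>n. x n + y n) \<le> asymptotic_norm x + asymptotic_norm y + e"
    using e asymptotic_norm_nonneg[OF x] asymptotic_norm_nonneg[OF y] by (intro asymptotic_norm_le) auto
qed

lemma asymptotic_norm_scale:
  fixes x :: "nat \<Rightarrow> 'a::complex_normed_vector"
  assumes x: "\<forall>n. norm (x n) \<le> b"
  shows "asymptotic_norm (\<lambda>n. a *\<^sub>C x n) = cmod a * asymptotic_norm x"
proof (rule antisym)
  show "asymptotic_norm (\<lambda>n. a *\<^sub>C x n) \<le> cmod a * asymptotic_norm x"
    by (rule asymptotic_norm_mono[OF x]) (simp_all add: norm_scaleC)
  show "cmod a * asymptotic_norm x \<le> asymptotic_norm (\<lambda>n. a *\<^sub>C x n)"
  proof (cases "a = 0")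
    case True
    have "\<forall>n. norm (a *\<^sub>C x n) \<le> 0" using True by (simp add: norm_scaleC)
    then show ?thesis using True asymptotic_norm_nonneg[of "\<lambda>n. a *\<^sub>C x n" 0] by simp
  next
    case False
    have ax: "\<forall>n. norm (a *\<^sub>C x n) \<le> cmod a * b" using x by (auto simp: norm_scaleC intro: mult_left_mono)
    have "asymptotic_norm x \<le> inverse (cmod a) * asymptotic_norm (\<lambda>n. a *\<^sub>C x n)"
      by (rule asymptotic_norm_mono[OF ax]) (use False in \<open>simp_all add: norm_scaleC field_simps\<close>)
    then show ?thesis using False by (simp add: field_simps)
  qed
qed

definition weakly_null_space :: "(nat \<Rightarrow> 'a::complex_normed_vector) set" where
  "weakly_null_space = {x. (\<exists>b. \<forall>n. norm (x n) \<le> b) \<and> weakly_null x}"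

text \<open>An approximate eigenvalue of the operator induced on the weakly null sequences modulo the norm
  null ones.\<close>

lemma asymptotic_approximate_eigenvalue:
  fixes T :: "'a::complex_normed_vector \<Rightarrow> 'a" and d :: "nat \<Rightarrow> 'a"
  assumes T: "bounded_clinear T" and d: "d \<in> weakly_null_space" "0 < asymptotic_norm d"
  obtains \<mu> where "\<And>c. 0 < c \<Longrightarrow> \<exists>x\<in>weakly_null_space.
    asymptotic_norm (\<lambda>n. T (x n) - \<mu> *\<^sub>C x n) < c * asymptotic_norm (x :: nat \<Rightarrow> 'a)"
proof (rule ccontr)
  assume no: "\<not> thesis"
  \<comment> \<open>The failure for \<mu> \<noteq> 0 will make T quasinilpotent, while the failure
    for \<mu> = 0 bounds T below and thereby forbids it.\<close>
  have below: "\<exists>c>0. \<forall>x\<in>weakly_null_space. c * asymptotic_norm x \<le> asymptotic_norm (\<lambda>n. T (x n) - \<mu> *\<^sub>C x n)"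
    for \<mu>
    using no that[of \<mu>] by (meson not_less)
  interpret T: bounded_linear T by (rule bounded_clinear_bounded_linear[OF T])
  obtain K where K: "0 < K" "\<And>v. norm (T v) \<le> norm v * K" using T.pos_bounded by blast
  interpret seminormed_operator "\<lambda>a (x :: nat \<Rightarrow> 'a) n. a *\<^sub>C x n" weakly_null_space asymptotic_norm
    "\<lambda>x n. T (x n)" K
  proof unfold_locales
    show "module.subspace (\<lambda>a (x :: nat \<Rightarrow> 'a) n. a *\<^sub>C x n) weakly_null_space"
    proof -
      interpret vs: vector_space "\<lambda>a (x :: nat \<Rightarrow> 'a) n. a *\<^sub>C x n"
        by unfold_locales (auto simp: fun_eq_iff scaleC_add_right scaleC_add_left scaleC_scaleC scaleC_one)
      show ?thesis
      proof (rule vs.subspaceI)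
        show "(0 :: nat \<Rightarrow> 'a) \<in> weakly_null_space"
          by (auto simp: weakly_null_space_def weakly_null_iff_dual_ball zero_fun_def dual_ball_def
            bounded_clinear_def linear_simps)
        show "x + y \<in> weakly_null_space" if xy: "x \<in> weakly_null_space" "y \<in> weakly_null_space" for x y :: "nat \<Rightarrow> 'a"
        proof -
          obtain b b' where "\<forall>n. norm (x n) \<le> b" "\<forall>n. norm (y n) \<le> b'"
            using xy by (auto simp: weakly_null_space_def)
          then have "\<forall>n. norm (x n + y n) \<le> b + b'" by (meson add_mono norm_triangle_ineq order_trans)
          moreover have "(\<lambda>n. \<phi> (x n + y n)) \<longlonglongrightarrow> 0" if "\<phi> \<in> dual_ball" for \<phi>
            using xy that tendsto_add[of "\<lambda>n. \<phi> (x n)" 0 sequentially "\<lambda>n. \<phi> (y n)" 0]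
            by (auto simp: weakly_null_space_def weakly_null_iff_dual_ball dual_ball_add)
          ultimately show ?thesis
            by (auto simp: weakly_null_space_def weakly_null_iff_dual_ball plus_fun_def)
        qed
        show "(\<lambda>n. a *\<^sub>C x n) \<in> weakly_null_space" if x: "x \<in> weakly_null_space" for a and x :: "nat \<Rightarrow> 'a"
        proof -
          obtain b where "\<forall>n. norm (x n) \<le> b" using x by (auto simp: weakly_null_space_def)
          then have "\<forall>n. norm (a *\<^sub>C x n) \<le> cmod a * b" by (auto simp: norm_scaleC intro: mult_left_mono)
          then show ?thesis using x weakly_null_image[OF _ bounded_clinear_scaleC]
            by (auto simp: weakly_null_space_def)
        qed
      qed
    qed
  next
    fix x y :: "nat \<Rightarrow> 'a" assume "x \<in> weakly_null_space" "y \<in> weakly_null_space"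
    then show "asymptotic_norm (x + y) \<le> asymptotic_norm x + asymptotic_norm y"
      by (auto simp: weakly_null_space_def plus_fun_def intro: asymptotic_norm_add)
  next
    fix x :: "nat \<Rightarrow> 'a" and a :: complex assume x: "x \<in> weakly_null_space"
    then obtain b where b: "\<forall>n. norm (x n) \<le> b" by (auto simp: weakly_null_space_def)
    show "asymptotic_norm (\<lambda>n. a *\<^sub>C x n) = cmod a * asymptotic_norm x"
      by (rule asymptotic_norm_scale[OF b])
    show "asymptotic_norm (\<lambda>n. T (x n)) \<le> K * asymptotic_norm x"
      by (rule asymptotic_norm_mono[OF b]) (use K in \<open>auto simp: mult.commute\<close>)
    have "\<forall>n. norm (T (x n)) \<le> b * K"
      using b K by (meson mult_right_mono order_trans less_imp_le)
    then show "(\<lambda>n. T (x n)) \<in> weakly_null_space"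
      using x weakly_null_image[OF _ T] by (auto simp: weakly_null_space_def)
  qed (use K in \<open>auto simp: fun_eq_iff scaleC_add_right scaleC_add_left scaleC_scaleC scaleC_one T.add
      bounded_clinear_scale[OF T]\<close>)
  have bz: "\<exists>c>0. \<forall>u\<in>weakly_null_space. c * asymptotic_norm u \<le> asymptotic_norm (u - (\<lambda>n. z *\<^sub>C T (u n)))" for z
  proof (cases "z = 0")
    case True
    then show ?thesis by (intro exI[of _ 1]) (auto simp: fun_diff_def)
  next
    case False
    obtain c where c: "0 < c" "\<And>x. x \<in> weakly_null_space \<Longrightarrow>
        c * asymptotic_norm x \<le> asymptotic_norm (\<lambda>n. T (x n) - (1 / z) *\<^sub>C x n)"
      using below[of "1 / z"] by blast
    have "cmod z * c * asymptotic_norm u \<le> asymptotic_norm (u - (\<lambda>n. z *\<^sub>C T (u n)))"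
      if u: "u \<in> weakly_null_space" for u
    proof -
      obtain b where b: "\<forall>n. norm (u n) \<le> b" using u by (auto simp: weakly_null_space_def)
      have "\<forall>n. norm (T (u n) - (1 / z) *\<^sub>C u n) \<le> b * K + cmod (1 / z) * b"
      proof
        fix n
        have "norm (T (u n)) \<le> b * K" using b K by (meson mult_right_mono order_trans less_imp_le)
        moreover have "norm ((1 / z) *\<^sub>C u n) \<le> cmod (1 / z) * b"
          using b by (auto simp: norm_scaleC intro: mult_left_mono)
        ultimately show "norm (T (u n) - (1 / z) *\<^sub>C u n) \<le> b * K + cmod (1 / z) * b"
          using norm_triangle_ineq4[of "T (u n)" "(1 / z) *\<^sub>C u n"] by linarith
      qed
      from asymptotic_norm_scale[OF this, of "- z"]
      have "asymptotic_norm (\<lambda>n. (- z) *\<^sub>C (T (u n) - (1 / z) *\<^sub>C u n))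
          = cmod z * asymptotic_norm (\<lambda>n. T (u n) - (1 / z) *\<^sub>C u n)" by simp
      also have "(\<lambda>n. (- z) *\<^sub>C (T (u n) - (1 / z) *\<^sub>C u n)) = u - (\<lambda>n. z *\<^sub>C T (u n))"
        using False by (simp add: fun_eq_iff complex_vector.scale_right_diff_distrib scaleC_scaleC scaleC_minus_left scaleC_one)
      finally show ?thesis using mult_left_mono[OF c(2)[OF u], of "cmod z"] by (simp add: mult.assoc fun_diff_def)
    qed
    then show ?thesis using c(1) False by (intro exI[of _ "cmod z * c"]) auto
  qed
  obtain c where c: "0 < c" "\<And>x. x \<in> weakly_null_space \<Longrightarrow> c * asymptotic_norm x \<le> asymptotic_norm (\<lambda>n. T (x n))"
    using below[of 0] by auto
  have low: "c ^ n * asymptotic_norm d \<le> asymptotic_norm (((\<lambda>x n. T (x n)) ^^ n) d)" for n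
  proof (induction n)
    case (Suc n)
    have "c * (c ^ n * asymptotic_norm d) \<le> c * asymptotic_norm (((\<lambda>x n. T (x n)) ^^ n) d)"
      using Suc c(1) by (intro mult_left_mono) auto
    also have "\<dots> \<le> asymptotic_norm (\<lambda>k. T ((((\<lambda>x n. T (x n)) ^^ n) d) k))"
      by (intro c(2) pow_V d(1))
    finally show ?case by (simp add: mult_ac)
  qed simp
  \<comment> \<open>The lower bound \<open>c\<close> for T gives at least c^n after n applications;
    the radius 2 / c turns this into growth by 2^n.\<close>
  obtain N where N: "\<And>n. n \<ge> N \<Longrightarrow> (2 / c) ^ n * asymptotic_norm (((\<lambda>x n. T (x n)) ^^ n) d) \<le> asymptotic_norm d"
    using quasinilpotent[OF bz, of "2 / c"] c(1) d(1) by fastforce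
  define n where "n = Suc N"
  have "2 ^ n * asymptotic_norm d = (2 / c) ^ n * (c ^ n * asymptotic_norm d)"
    using c(1) by (simp add: power_divide)
  also have "\<dots> \<le> (2 / c) ^ n * asymptotic_norm (((\<lambda>x n. T (x n)) ^^ n) d)"
    using c(1) by (intro mult_left_mono low) auto
  also have "\<dots> \<le> asymptotic_norm d" by (rule N) (simp add: n_def)
  finally have "2 ^ n * asymptotic_norm d \<le> 1 * asymptotic_norm d" by simp
  then have "(2::real) ^ n \<le> 1" using d(2) by (simp only: mult_le_cancel_right_pos)
  moreover have "(1::real) < 2 ^ n" by (rule one_less_power) (simp_all add: n_def)
  ultimately show False by simp
qed

section \<open>Strict singularity along Schreier families\<close>

lemma in_schreier_finite: "in_schreier fs \<xi> F \<Longrightarrow> finite F"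
proof (induction rule: in_schreier.induct)
  case (zero F)
  then show ?case by (auto simp: schreier0_def)
next
  case (suc F \<xi>)
  then show ?case by (auto simp: family_comp_def)
qed

text \<open>Strict singularity with a restriction on the support: on every basic sequence, vectors
  supported on a single set of the family already defeat any lower bound.\<close>

definition schreier_singular :: "(omega1 \<Rightarrow> nat \<Rightarrow> omega1) \<Rightarrow> omega1 \<Rightarrow>
    ('a::complex_normed_vector \<Rightarrow> 'a) \<Rightarrow> bool" where
  "schreier_singular fs \<xi> S \<longleftrightarrow> (\<forall>x \<epsilon>. basic_sequence x \<longrightarrow> 0 < \<epsilon> \<longrightarrow>
    (\<exists>F\<in>schreier fs \<xi>. \<exists>a. (\<Sum>i\<in>F. a i *\<^sub>C elt x i) \<noteq> 0 \<and>
      norm (S (\<Sum>i\<in>F. a i *\<^sub>C elt x i)) \<le> \<epsilon> * norm (\<Sum>i\<in>F. a i *\<^sub>C elt x i)))"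

lemma HI_decomposition:
  fixes T :: "'a::complex_normed_vector \<Rightarrow> 'a"
  assumes HI: "HI fs \<xi> TYPE('a)" and inf: "\<not> cfinite_dim (UNIV :: 'a set)" and T: "bounded_clinear T"
  obtains \<mu> where "schreier_singular fs \<xi> (\<lambda>x. T x - \<mu> *\<^sub>C x)"
proof -
  obtain s :: "nat \<Rightarrow> 'a" where s: "\<forall>n. norm (s n) = 1" "\<forall>r. strict_mono r \<longrightarrow> \<not> Cauchy (s \<circ> r)"
    by (rule unit_vectors_without_Cauchy_subseq[OF inf])
  have s1: "norm (s n) \<le> 1" for n using s(1) by simp
  have nC: "\<not> Cauchy (\<lambda>n. s (r n))" if "strict_mono r" for r using s(2) that by (simp add: o_def)
  obtain d :: "nat \<Rightarrow> 'a" and \<epsilon> where d: "weakly_null d" "\<forall>n. norm (d n) \<le> 2 * 1" "0 < \<epsilon>" "\<forall>n. \<epsilon> \<le> norm (d n)"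
    by (rule weakly_null_differences[OF HI s1 bounded_linear_ident nC])
  have dV: "d \<in> weakly_null_space" using d(1,2) by (auto simp: weakly_null_space_def)
  have "0 < asymptotic_norm d"
  proof (rule ccontr)
    assume "\<not> 0 < asymptotic_norm d"
    then have "\<forall>\<^sub>F n in sequentially. norm (d n) < \<epsilon>"
      using d(2,3) by (intro eventually_less_asymptotic_norm[of _ 2]) auto
    then show False using d(4) by (auto simp: eventually_sequentially not_less[symmetric])
  qed
  then obtain \<mu> where \<mu>: "\<And>c. 0 < c \<Longrightarrow> \<exists>x\<in>weakly_null_space.
    asymptotic_norm (\<lambda>n. T (x n) - \<mu> *\<^sub>C x n) < c * asymptotic_norm (x :: nat \<Rightarrow> 'a)"
    using asymptotic_approximate_eigenvalue[OF T dV] by blast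
  define U where "U x = T x - \<mu> *\<^sub>C x" for x
  have U: "bounded_clinear U" unfolding U_def by (intro bounded_clinear_diff T bounded_clinear_scaleC)
  interpret U: bounded_linear U by (rule bounded_clinear_bounded_linear[OF U])
  obtain K where K: "0 < K" "\<And>v. norm (U v) \<le> norm v * K" using U.pos_bounded by blast
  \<comment> \<open>Normalized terms of an asymptotic approximate eigenvector meet the requirement
    of \<open>mazur_selection\<close>, thanks to weak nullity.\<close>
  have small: "\<exists>v. norm v = 1 \<and> norm (U v) \<le> c \<and> (\<forall>\<phi>\<in>\<Phi>. cmod (\<phi> v) \<le> \<eta>)"
    if c: "0 < c" and \<Phi>: "finite \<Phi>" "\<Phi> \<subseteq> dual_ball" and \<eta>: "0 < \<eta>" for c \<eta> and \<Phi> :: "('a \<Rightarrow> complex) set"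
  proof -
    \<comment> \<open>Half of \<open>c\<close>, because the chosen terms are only known to have norm
      above Q / 2.\<close>
    obtain x where x: "x \<in> weakly_null_space" "asymptotic_norm (\<lambda>n. U (x n)) < c / 2 * asymptotic_norm x"
      using \<mu>[of "c / 2"] c by (auto simp: U_def)
    obtain b where b: "\<forall>n. norm (x n) \<le> b" using x(1) by (auto simp: weakly_null_space_def)
    have Ub: "\<forall>n. norm (U (x n)) \<le> b * K" using b K by (meson mult_right_mono order_trans less_imp_le)
    define Q where "Q = asymptotic_norm x"
    have "0 < c / 2 * Q" using asymptotic_norm_nonneg[OF Ub] x(2) by (simp add: Q_def)
    then have Q: "0 < Q" using c by (simp add: zero_less_mult_iff)
    have "\<not> (\<forall>\<^sub>F n in sequentially. norm (x n) \<le> Q / 2)"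
      using asymptotic_norm_le[of "Q / 2" x] Q by (auto simp: Q_def)
    then have fr: "\<exists>\<^sub>F n in sequentially. Q / 2 < norm (x n)" by (simp add: frequently_def not_less)
    have ev1: "\<forall>\<^sub>F n in sequentially. norm (U (x n)) < c / 2 * Q"
      using x(2) by (intro eventually_less_asymptotic_norm[OF Ub]) (simp add: Q_def)
    have ev2: "\<forall>\<^sub>F n in sequentially. \<forall>\<phi>\<in>\<Phi>. cmod (\<phi> (x n)) < \<eta> * Q / 2"
    proof (rule eventually_ball_finite[OF \<Phi>(1)], rule ballI)
      fix \<phi> assume "\<phi> \<in> \<Phi>"
      then have "(\<lambda>n. \<phi> (x n)) \<longlonglongrightarrow> 0"
        using x(1) \<Phi>(2) by (auto simp: weakly_null_space_def weakly_null_iff_dual_ball)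
      then have "(\<lambda>n. cmod (\<phi> (x n))) \<longlonglongrightarrow> 0" by (rule tendsto_norm_zero)
      then show "\<forall>\<^sub>F n in sequentially. cmod (\<phi> (x n)) < \<eta> * Q / 2"
        using \<eta> Q by (intro order_tendstoD(2)) auto
    qed
    obtain n where n: "Q / 2 < norm (x n)" "norm (U (x n)) < c / 2 * Q"
        "\<And>\<phi>. \<phi> \<in> \<Phi> \<Longrightarrow> cmod (\<phi> (x n)) < \<eta> * Q / 2"
      using frequently_ex[OF frequently_eventually_conj[OF fr eventually_conj[OF ev1 ev2]]] by blast
    define t where "t = complex_of_real (1 / norm (x n))"
    have xn: "0 < norm (x n)" using n(1) Q by linarith
    have t: "cmod t = 1 / norm (x n)" by (simp add: t_def norm_divide)
    have "norm (t *\<^sub>C x n) = 1" using xn by (simp add: norm_scaleC t)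
    moreover have "norm (U (t *\<^sub>C x n)) \<le> c"
    proof -
      have "norm (U (x n)) \<le> c * norm (x n)"
        using n(2) mult_strict_left_mono[OF n(1) c] by simp
      then show ?thesis using xn by (simp add: bounded_clinear_scale[OF U] norm_scaleC t field_simps)
    qed
    moreover have "cmod (\<phi> (t *\<^sub>C x n)) \<le> \<eta>" if "\<phi> \<in> \<Phi>" for \<phi>
    proof -
      have "\<phi> \<in> dual_ball" using that \<Phi>(2) by auto
      moreover have "cmod (\<phi> (x n)) \<le> \<eta> * norm (x n)"
        using n(3)[OF that] mult_strict_left_mono[OF n(1) \<eta>] by simp
      ultimately show ?thesis using xn by (simp add: dual_ball_scale norm_mult t field_simps)
    qed
    ultimately show ?thesis by blast
  qed
  \<comment> \<open>The constant 8 is 4 times 2: with basis constant 2 and unit vectors the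
    coefficients are at most 4 norm y, and the geometric weights sum to at most 2.\<close>
  have subspace: "\<exists>Y. complex_vector.subspace Y \<and> \<not> cfinite_dim Y \<and> (\<forall>y\<in>Y. norm (U y) \<le> 8 * \<delta> * norm y)"
    if \<delta>: "0 < \<delta>" for \<delta>
  proof -
    have step: "\<exists>j. (norm j = 1 \<and> norm (U j) \<le> \<delta> * (1 / 2) ^ m) \<and> 1 \<le> norm (id j) \<and> (\<forall>\<phi>\<in>\<Phi>. cmod (\<phi> (id j)) \<le> \<eta>)"
      if \<Phi>: "finite \<Phi>" "\<Phi> \<subseteq> dual_ball" "0 < \<eta>" for m \<eta> and \<Phi> :: "('a \<Rightarrow> complex) set"
      using small[OF _ \<Phi>, of "\<delta> * (1 / 2) ^ m"] \<delta> by auto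
    obtain s' :: "nat \<Rightarrow> 'a" where s': "\<forall>m. norm (s' (Suc m)) = 1 \<and> norm (U (s' (Suc m))) \<le> \<delta> * (1 / 2) ^ m"
      "\<forall>m. 1 \<le> norm (id (s' m))" "grunblum 2 (id \<circ> s')"
      by (rule mazur_selection[OF zero_less_one step])
    define s where "s = s' \<circ> Suc"
    have s: "norm (s n) = 1" "norm (U (s n)) \<le> \<delta> * (1 / 2) ^ n" for n using s'(1) by (auto simp: s_def)
    have g: "grunblum 2 s" unfolding s_def using grunblum_subseq[of 2 s' Suc] s'(3) by (simp add: strict_mono_def)
    have "norm (U y) \<le> 8 * \<delta> * norm y" if y: "y \<in> complex_vector.span (range s)" for y
    proof -
      obtain a n where a: "y = (\<Sum>i<n. a i *\<^sub>C s i)" using cspan_range[OF y] by blast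
      have "norm (U y) \<le> (\<Sum>i<n. 4 * norm y * (\<delta> * (1 / 2) ^ i))"
        unfolding a bounded_clinear_sum[OF U]
      proof (rule sum_norm_le)
        fix i assume "i \<in> {..<n}"
        then have "cmod (a i) \<le> 4 * norm (\<Sum>i<n. a i *\<^sub>C s i)"
          using grunblum_coeff[OF g, of i n a] s(1)[of i] by simp
        then show "norm (a i *\<^sub>C U (s i)) \<le> 4 * norm (\<Sum>i<n. a i *\<^sub>C s i) * (\<delta> * (1 / 2) ^ i)"
          unfolding norm_scaleC using s(2)[of i] by (intro mult_mono) auto
      qed
      also have "\<dots> = 4 * norm y * \<delta> * (\<Sum>i<n. (1 / 2) ^ i)" by (simp add: sum_distrib_left mult_ac)
      also have "\<dots> \<le> 4 * norm y * \<delta> * 2"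
      proof (intro mult_left_mono)
        show "(\<Sum>i<n. (1 / 2) ^ i) \<le> (2::real)" by (simp add: sum_gp_strict)
      qed (use \<delta> in auto)
      finally show ?thesis by (simp add: mult_ac)
    qed
    moreover have "\<not> cfinite_dim (complex_vector.span (range s))"
    proof (rule grunblum_not_finite_dim[OF g])
      show "s n \<noteq> 0" for n using s(1)[of n] by auto
    qed
    ultimately show ?thesis using complex_vector.subspace_span by blast
  qed
  have "schreier_singular fs \<xi> U" unfolding schreier_singular_def
  proof (intro allI impI)
    fix x :: "nat \<Rightarrow> 'a" and \<epsilon> :: real assume x: "basic_sequence x" and \<epsilon>: "0 < \<epsilon>"
    \<comment> \<open>The approximant z keeps norm at least 1/2, and U (y - z) costs \<epsilon>/4; U
      y contributes another \<epsilon>/4, in total at most \<epsilon> norm z.\<close>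
    define e where "e = min (1 / 2) (\<epsilon> / (4 * K))"
    have e: "0 < e" "e \<le> 1 / 2" "e * K \<le> \<epsilon> / 4"
    proof -
      have "e * K \<le> \<epsilon> / (4 * K) * K" using K(1) by (intro mult_right_mono) (auto simp: e_def)
      then show "e * K \<le> \<epsilon> / 4" using K(1) by simp
    qed (use K(1) \<epsilon> in \<open>auto simp: e_def\<close>)
    obtain Y where Y: "complex_vector.subspace Y" "\<not> cfinite_dim Y" "\<forall>y\<in>Y. norm (U y) \<le> 8 * (\<epsilon> / 32) * norm y"
      using subspace[of "\<epsilon> / 32"] \<epsilon> by auto
    obtain F y where F: "F \<in> schreier fs \<xi>" "y \<in> Y" "norm y = 1" "infdist y (closed_cspan (elt x ` F)) < e"
      using HI[unfolded HI_def] e(1) Y(1,2) x by blast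
    obtain z where z: "z \<in> complex_vector.span (elt x ` F)" "norm (y - z) < e"
      by (rule infdist_closed_cspan_less[OF F(4)])
    have "finite F" using F(1) by (simp add: schreier_def in_schreier_finite)
    then obtain a where a: "z = (\<Sum>i\<in>F. a i *\<^sub>C elt x i)" using cspan_finite_image[OF _ z(1)] by blast
    have "norm z \<ge> 1 / 2" using norm_triangle_ineq2[of y "y - z"] F(3) z(2) e(2) by simp
    moreover have "norm (U z) \<le> \<epsilon> / 2"
    proof -
      have "norm (U (y - z)) \<le> e * K"
        using K z(2) by (meson mult_right_mono order_trans less_imp_le)
      moreover have "norm (U y) \<le> \<epsilon> / 4" using Y(3) F(2,3) by fastforce
      moreover have "norm (U z) \<le> norm (U y) + norm (U (y - z))"
        using norm_triangle_ineq4[of "U y" "U (y - z)"] by (simp add: U.diff)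
      ultimately show ?thesis using e(3) by linarith
    qed
    moreover have "\<epsilon> * (1 / 2) \<le> \<epsilon> * norm z" using calculation(1) \<epsilon> by (intro mult_left_mono) auto
    ultimately have "z \<noteq> 0" "norm (U z) \<le> \<epsilon> * norm z" by auto
    then show "\<exists>F\<in>schreier fs \<xi>. \<exists>a. (\<Sum>i\<in>F. a i *\<^sub>C elt x i) \<noteq> 0 \<and>
        norm (U (\<Sum>i\<in>F. a i *\<^sub>C elt x i)) \<le> \<epsilon> * norm (\<Sum>i\<in>F. a i *\<^sub>C elt x i)"
      using F(1) a by blast
  qed
  then show thesis unfolding U_def by (rule that)
qed

section \<open>Schreier spreading subsequences\<close>

text \<open>Schreier spreading for indices starting at 0: only the first n values of f and g count,
  and n \<le> Suc (f 0) is the condition # F \<le> min F after the shift. Using infinite increasing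
  sequences makes passing to subsequences a mere composition.\<close>

definition increasing_spreading :: "(nat \<Rightarrow> 'a::complex_normed_vector) \<Rightarrow> bool" where
  "increasing_spreading x \<longleftrightarrow> (\<forall>n (a::nat \<Rightarrow> complex) f g. strict_mono f \<longrightarrow> strict_mono g \<longrightarrow>
    n \<le> Suc (f 0) \<longrightarrow> n \<le> Suc (g 0) \<longrightarrow>
    norm (\<Sum>i<n. a i *\<^sub>C x (f i)) \<le> 2 * norm (\<Sum>i<n. a i *\<^sub>C x (g i)))"

lemma increasing_spreading_subseq:
  assumes "increasing_spreading x" "strict_mono r"
  shows "increasing_spreading (x \<circ> r)"
  unfolding increasing_spreading_def
proof (intro allI impI)
  fix n and a :: "nat \<Rightarrow> complex" and f g :: "nat \<Rightarrow> nat"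
  assume "strict_mono f" "strict_mono g" "n \<le> Suc (f 0)" "n \<le> Suc (g 0)"
  then have "strict_mono (r \<circ> f)" "strict_mono (r \<circ> g)" "n \<le> Suc ((r \<circ> f) 0)" "n \<le> Suc ((r \<circ> g) 0)"
    using assms(2) seq_suble[OF assms(2), of "f 0"] seq_suble[OF assms(2), of "g 0"]
    by (auto intro: strict_mono_o)
  then have "norm (\<Sum>i<n. a i *\<^sub>C x ((r \<circ> f) i)) \<le> 2 * norm (\<Sum>i<n. a i *\<^sub>C x ((r \<circ> g) i))"
    using assms(1) unfolding increasing_spreading_def by blast
  then show "norm (\<Sum>i<n. a i *\<^sub>C (x \<circ> r) (f i)) \<le> 2 * norm (\<Sum>i<n. a i *\<^sub>C (x \<circ> r) (g i))"
    by simp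
qed

lemma schreier1_enumeration:
  assumes F: "F \<in> schreier1" "card F = n"
  obtains f :: "nat \<Rightarrow> nat" where "strict_mono f" "n \<le> Suc (f 0)"
    "\<forall>i<n. sorted_list_of_set F ! i - 1 = f i"
proof -
  define L where "L = sorted_list_of_set F"
  have fin: "finite F" using F(1) by (simp add: schreier1_def)
  have L: "length L = n" "set L = F" "sorted_wrt (<) L" using fin F(2) by (simp_all add: L_def)
  have big: "n \<le> L ! i \<and> 1 \<le> L ! i \<and> L ! i \<le> Max F" if "i < n" for i
  proof -
    have "L ! i \<in> F" using L that nth_mem by blast
    moreover have "n \<le> Min F" using F that by (auto simp: schreier1_def)
    ultimately show ?thesis using fin that Min_le[of F "L ! i"] Max_ge[of F "L ! i"] by linarith
  qed
  have inc: "L ! i < L ! j" if "i < j" "j < n" for i j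
    using sorted_wrt_nth_less[OF L(3)] that L(1) by simp
  \<comment> \<open>Subtracting 1 is the index shift of \<open>elt\<close>; beyond n the values
    merely continue the enumeration increasingly.\<close>
  define f where "f i = (if i < n then L ! i - 1 else Max F + n + i)" for i
  have "f i < f (Suc i)" for i
  proof (cases "Suc i < n")
    case True
    then have "L ! i - 1 < L ! Suc i - 1" using inc[of i "Suc i"] big[of i] by (intro diff_less_mono) auto
    then show ?thesis using True by (simp add: f_def)
  next
    case False
    then show ?thesis using big[of i] by (auto simp: f_def)
  qed
  then have "strict_mono f" by (simp add: strict_mono_Suc_iff)
  moreover have "n \<le> Suc (f 0)" using big[of 0] by (auto simp: f_def)
  moreover have "\<forall>i<n. sorted_list_of_set F ! i - 1 = f i" by (simp add: f_def L_def)
  ultimately show thesis by (rule that)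
qed

lemma increasing_spreading_imp_schreier_spreading:
  assumes "increasing_spreading x"
  shows "schreier_spreading x"
  unfolding schreier_spreading_def
proof (intro exI[of _ 2] conjI allI ballI impI)
  fix n F G and a :: "nat \<Rightarrow> complex"
  assume F: "F \<in> schreier1" and G: "G \<in> schreier1" and n: "card F = n \<and> card G = n"
  obtain f where f: "strict_mono f" "n \<le> Suc (f 0)" "\<forall>i<n. sorted_list_of_set F ! i - 1 = f i"
    using schreier1_enumeration[OF F, of n] n by blast
  obtain g where g: "strict_mono g" "n \<le> Suc (g 0)" "\<forall>i<n. sorted_list_of_set G ! i - 1 = g i"
    using schreier1_enumeration[OF G, of n] n by blast
  have eq: "(\<Sum>i<n. a i *\<^sub>C elt x (sorted_list_of_set F ! i)) = (\<Sum>i<n. a i *\<^sub>C x (f i))"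
    "(\<Sum>i<n. a i *\<^sub>C elt x (sorted_list_of_set G ! i)) = (\<Sum>i<n. a i *\<^sub>C x (g i))"
    using f(3) g(3) by (auto simp: elt_def intro!: sum.cong)
  have "norm (\<Sum>i<n. a i *\<^sub>C x (f i)) \<le> 2 * norm (\<Sum>i<n. a i *\<^sub>C x (g i))"
    "norm (\<Sum>i<n. a i *\<^sub>C x (g i)) \<le> 2 * norm (\<Sum>i<n. a i *\<^sub>C x (f i))"
    using assms f g unfolding increasing_spreading_def by blast+
  then show "approx_by 2 (norm (\<Sum>i<n. a i *\<^sub>C elt x (sorted_list_of_set F ! i)))
      (norm (\<Sum>i<n. a i *\<^sub>C elt x (sorted_list_of_set G ! i)))"
    unfolding eq approx_by_def by simp
qed simp

text \<open>Colour an n-set by the integer part of h / \<epsilon>: boundedness leaves finitely many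
  colours, and values of equal colour differ by at most \<epsilon>.\<close>

lemma ramsey_real_coloring:
  fixes h :: "(nat \<Rightarrow> nat) \<Rightarrow> real"
  assumes local: "\<And>f g. (\<forall>i<n. f i = g i) \<Longrightarrow> h f = h g"
    and bd: "\<And>f. 0 \<le> h f" "\<And>f. h f \<le> B" and \<epsilon>: "0 < \<epsilon>"
  obtains r :: "nat \<Rightarrow> nat" where "strict_mono r"
    "\<forall>f g. strict_mono f \<longrightarrow> strict_mono g \<longrightarrow> \<bar>h (r \<circ> f) - h (r \<circ> g)\<bar> \<le> \<epsilon>"
proof -
  define col where "col X = nat \<lfloor>h (\<lambda>i. sorted_list_of_set X ! i) / \<epsilon>\<rfloor>" for X :: "nat set"
  have "col X < nat \<lfloor>B / \<epsilon>\<rfloor> + 1" for X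
  proof -
    have "h (\<lambda>i. sorted_list_of_set X ! i) / \<epsilon> \<le> B / \<epsilon>" using bd \<epsilon> by (intro divide_right_mono) auto
    then have "col X \<le> nat \<lfloor>B / \<epsilon>\<rfloor>" unfolding col_def by (intro nat_mono floor_mono)
    then show ?thesis by simp
  qed
  then have "\<forall>X. X \<subseteq> UNIV \<and> finite X \<and> card X = n \<longrightarrow> col X < nat \<lfloor>B / \<epsilon>\<rfloor> + 1" by blast
  from Ramsey[OF infinite_UNIV_nat this] obtain Y t where Y: "infinite Y"
    "\<forall>X. X \<subseteq> Y \<and> finite X \<and> card X = n \<longrightarrow> col X = t" by blast
  define r where "r = enumerate Y"
  have r: "strict_mono r" "range r = Y" by (simp_all add: r_def strict_mono_enumerate Y(1) range_enumerate)
  have val: "nat \<lfloor>h (r \<circ> f) / \<epsilon>\<rfloor> = t" if f: "strict_mono f" for f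
  proof -
    define X where "X = (r \<circ> f) ` {..<n}"
    have rf: "strict_mono (r \<circ> f)" using r(1) f by (rule strict_mono_o)
    have "sorted_list_of_set X = map (r \<circ> f) [0..<n]"
    proof (rule sorted_distinct_set_unique)
      have "sorted_wrt (<) (map (r \<circ> f) [0..<n])"
        using strict_monoD[OF rf] by (auto simp: sorted_wrt_iff_nth_less)
      then show "sorted (map (r \<circ> f) [0..<n])" "distinct (map (r \<circ> f) [0..<n])"
        by (simp_all add: strict_sorted_iff)
      show "set (sorted_list_of_set X) = set (map (r \<circ> f) [0..<n])"
        by (auto simp: X_def)
    qed simp_all
    then have "h (\<lambda>i. sorted_list_of_set X ! i) = h (r \<circ> f)" by (intro local) simp
    moreover have "card X = n" unfolding X_def using rf
      by (subst card_image) (auto intro: inj_on_subset[OF strict_mono_imp_inj_on])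
    moreover have "X \<subseteq> Y" using r(2) by (auto simp: X_def)
    moreover have "finite X" by (simp add: X_def)
    ultimately show ?thesis using Y(2) by (auto simp: col_def)
  qed
  have "\<bar>h (r \<circ> f) - h (r \<circ> g)\<bar> \<le> \<epsilon>" if fg: "strict_mono f" "strict_mono g" for f g
  proof -
    have "0 \<le> \<lfloor>h (r \<circ> f) / \<epsilon>\<rfloor>" "0 \<le> \<lfloor>h (r \<circ> g) / \<epsilon>\<rfloor>" using bd(1) \<epsilon> by auto
    then have "\<lfloor>h (r \<circ> f) / \<epsilon>\<rfloor> = \<lfloor>h (r \<circ> g) / \<epsilon>\<rfloor>" using val[OF fg(1)] val[OF fg(2)] by linarith
    then have "\<bar>h (r \<circ> f) / \<epsilon> - h (r \<circ> g) / \<epsilon>\<bar> \<le> 1" by linarith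
    then show ?thesis using \<epsilon> by (simp add: diff_divide_distrib[symmetric] field_simps)
  qed
  then show thesis using r(1) that by blast
qed

lemma simultaneous_ramsey:
  fixes x :: "nat \<Rightarrow> 'a::complex_normed_vector" and N :: "(nat \<Rightarrow> complex) set"
  assumes b: "\<And>i. norm (x i) \<le> b" and \<epsilon>: "0 < \<epsilon>" and N: "finite N"
  shows "\<exists>r::nat \<Rightarrow> nat. strict_mono r \<and> (\<forall>a\<in>N. \<forall>f g. strict_mono f \<longrightarrow> strict_mono g \<longrightarrow>
    \<bar>norm (\<Sum>i<n. a i *\<^sub>C x (r (f i))) - norm (\<Sum>i<n. a i *\<^sub>C x (r (g i)))\<bar> \<le> \<epsilon>)"
  using N
proof (induction N rule: finite_induct)
  case empty
  show ?case by (intro exI[of _ id]) (simp add: strict_mono_def)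
next
  case (insert a N)
  then obtain r :: "nat \<Rightarrow> nat" where r: "strict_mono r" "\<forall>a\<in>N. \<forall>f g. strict_mono f \<longrightarrow> strict_mono g \<longrightarrow>
    \<bar>norm (\<Sum>i<n. a i *\<^sub>C x (r (f i))) - norm (\<Sum>i<n. a i *\<^sub>C x (r (g i)))\<bar> \<le> \<epsilon>" by blast
  define h where "h f = norm (\<Sum>i<n. a i *\<^sub>C x (r (f i)))" for f
  have "h f \<le> (\<Sum>i<n. cmod (a i) * b)" for f unfolding h_def
    by (rule sum_norm_le) (auto simp: norm_scaleC intro: mult_left_mono b)
  moreover have "h f = h g" if "\<forall>i<n. f i = g i" for f g
    using that unfolding h_def by (intro arg_cong[where f = norm] sum.cong) auto
  ultimately obtain r' :: "nat \<Rightarrow> nat" where r': "strict_mono r'"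
    "\<forall>f g. strict_mono f \<longrightarrow> strict_mono g \<longrightarrow> \<bar>h (r' \<circ> f) - h (r' \<circ> g)\<bar> \<le> \<epsilon>"
    using ramsey_real_coloring[of n h "\<Sum>i<n. cmod (a i) * b" \<epsilon>] \<epsilon> by (auto simp: h_def)
  have "\<bar>norm (\<Sum>i<n. a' i *\<^sub>C x ((r \<circ> r') (f i))) - norm (\<Sum>i<n. a' i *\<^sub>C x ((r \<circ> r') (g i)))\<bar> \<le> \<epsilon>"
    if a': "a' \<in> insert a N" and fg: "strict_mono f" "strict_mono g" for a' f g
  proof (cases "a' = a")
    case True
    then show ?thesis using r'(2) fg by (simp add: h_def)
  next
    case False
    then have "a' \<in> N" using a' by simp
    moreover have "strict_mono (r' \<circ> f)" "strict_mono (r' \<circ> g)" using r'(1) fg by (auto intro: strict_mono_o)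
    ultimately have "\<bar>norm (\<Sum>i<n. a' i *\<^sub>C x (r ((r' \<circ> f) i))) - norm (\<Sum>i<n. a' i *\<^sub>C x (r ((r' \<circ> g) i)))\<bar> \<le> \<epsilon>"
      using r(2) by blast
    then show ?thesis by simp
  qed
  then show ?case using strict_mono_o[OF r(1) r'(1)] by blast
qed

lemma unit_polydisc_net:
  assumes \<delta>: "0 < \<delta>"
  obtains N :: "(nat \<Rightarrow> complex) set" where "finite N"
    "\<forall>a. (\<forall>i<n. cmod (a i) \<le> 1) \<longrightarrow> (\<exists>a'\<in>N. \<forall>i<n. cmod (a i - a' i) \<le> \<delta>)"
proof -
  obtain D :: "complex set" where D: "finite D" "cball 0 1 \<subseteq> (\<Union>z\<in>D. ball z \<delta>)"
  proof (rule compactE_image[OF compact_cball, of "cball (0::complex) 1" "\<lambda>z. ball z \<delta>" 0 1])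
    show "cball (0::complex) 1 \<subseteq> (\<Union>z\<in>cball 0 1. ball z \<delta>)" using \<delta> by auto
  qed auto
  have "\<exists>a'\<in>{..<n} \<rightarrow>\<^sub>E D. \<forall>i<n. cmod (a i - a' i) \<le> \<delta>" if a: "\<forall>i<n. cmod (a i) \<le> 1" for a
  proof -
    have "\<forall>i<n. \<exists>z\<in>D. cmod (a i - z) \<le> \<delta>"
    proof (intro allI impI)
      fix i assume "i < n"
      then have "a i \<in> cball 0 1" using a by simp
      then obtain z where "z \<in> D" "dist z (a i) < \<delta>" using D(2) by auto
      then show "\<exists>z\<in>D. cmod (a i - z) \<le> \<delta>" by (intro bexI[of _ z]) (auto simp: dist_norm norm_minus_commute)
    qed
    then obtain k where k: "\<forall>i<n. k i \<in> D \<and> cmod (a i - k i) \<le> \<delta>" by metis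
    then show ?thesis by (intro bexI[of _ "restrict k {..<n}"]) auto
  qed
  moreover have "finite ({..<n} \<rightarrow>\<^sub>E D)" using D(1) by (intro finite_PiE) auto
  ultimately show thesis using that by blast
qed

text \<open>After Brunel and Sucheston: Ramsey's theorem makes the norms of the combinations with coefficients
  in a finite net almost constant, and the lower bound from the basis constant absorbs the error.\<close>

lemma stabilize_fixed_size:
  fixes x :: "nat \<Rightarrow> 'a::complex_normed_vector"
  assumes g: "grunblum 2 x" and c: "0 < c" "\<And>i. c \<le> norm (x i)" and b: "\<And>i. norm (x i) \<le> b"
  shows "\<exists>r::nat \<Rightarrow> nat. strict_mono r \<and> (\<forall>(a::nat \<Rightarrow> complex) (f::nat \<Rightarrow> nat) g. strict_mono f \<longrightarrow> strict_mono g \<longrightarrow>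
    norm (\<Sum>i<n. a i *\<^sub>C x (r (f i))) \<le> 2 * norm (\<Sum>i<n. a i *\<^sub>C x (r (g i))))"
proof (cases "n = 0")
  case True
  then show ?thesis by (intro exI[of _ id]) (simp add: strict_mono_def)
next
  case False
  have b0: "0 < b" using c(1) c(2)[of 0] b[of 0] by linarith
  \<comment> \<open>With n \<delta> b = c/16, two net errors and the Ramsey error c/8 add up to c/4,
    which by the coefficient bound is at most the norm on the right-hand side.\<close>
  define \<delta> where "\<delta> = c / (16 * real n * b)"
  have \<delta>: "0 < \<delta>" using c b0 False by (simp add: \<delta>_def)
  have \<delta>n: "real n * (\<delta> * b) = c / 16" using b0 False by (simp add: \<delta>_def)
  obtain N :: "(nat \<Rightarrow> complex) set" where N: "finite N"
    "\<forall>a. (\<forall>i<n. cmod (a i) \<le> 1) \<longrightarrow> (\<exists>a'\<in>N. \<forall>i<n. cmod (a i - a' i) \<le> \<delta>)"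
    by (rule unit_polydisc_net[OF \<delta>])
  have c8: "0 < c / 8" using c(1) by simp
  obtain r :: "nat \<Rightarrow> nat" where r: "strict_mono r" "\<forall>a\<in>N. \<forall>f g. strict_mono f \<longrightarrow> strict_mono g \<longrightarrow>
    \<bar>norm (\<Sum>i<n. a i *\<^sub>C x (r (f i))) - norm (\<Sum>i<n. a i *\<^sub>C x (r (g i)))\<bar> \<le> c / 8"
    using simultaneous_ramsey[where x = x and n = n, OF b c8 N(1)] by blast
  have unit: "norm (\<Sum>i<n. a i *\<^sub>C x (r (f i))) \<le> 2 * norm (\<Sum>i<n. a i *\<^sub>C x (r (g i)))"
    if a: "\<forall>i<n. cmod (a i) \<le> 1" "\<exists>i<n. cmod (a i) = 1" and fg: "strict_mono f" "strict_mono g" for a f g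
  proof -
    obtain a' where a': "a' \<in> N" "\<forall>i<n. cmod (a i - a' i) \<le> \<delta>" using N(2) a(1) by blast
    have near: "\<bar>norm (\<Sum>i<n. a i *\<^sub>C x (r (f i))) - norm (\<Sum>i<n. a' i *\<^sub>C x (r (f i)))\<bar> \<le> c / 16" for f
    proof -
      have "norm ((\<Sum>i<n. a i *\<^sub>C x (r (f i))) - (\<Sum>i<n. a' i *\<^sub>C x (r (f i)))) \<le> (\<Sum>i<n. \<delta> * b)"
        unfolding sum_subtractf[symmetric] complex_vector.scale_left_diff_distrib[symmetric]
      proof (rule sum_norm_le)
        fix i assume "i \<in> {..<n}"
        then show "norm ((a i - a' i) *\<^sub>C x (r (f i))) \<le> \<delta> * b"
          unfolding norm_scaleC using a'(2) b \<delta> by (intro mult_mono) auto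
      qed
      then show ?thesis using \<delta>n norm_triangle_ineq3[of "\<Sum>i<n. a i *\<^sub>C x (r (f i))" "\<Sum>i<n. a' i *\<^sub>C x (r (f i))"]
        by simp
    qed
    have "\<bar>norm (\<Sum>i<n. a' i *\<^sub>C x (r (f i))) - norm (\<Sum>i<n. a' i *\<^sub>C x (r (g i)))\<bar> \<le> c / 8"
      using r(2) a'(1) fg by blast
    then have d: "norm (\<Sum>i<n. a i *\<^sub>C x (r (f i))) \<le> norm (\<Sum>i<n. a i *\<^sub>C x (r (g i))) + c / 4"
      using near[of f] near[of g] by linarith
    obtain i where i: "i < n" "cmod (a i) = 1" using a(2) by blast
    have "grunblum 2 (x \<circ> (r \<circ> g))" using grunblum_subseq[OF assms(1)] strict_mono_o[OF r(1) fg(2)] by blast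
    from grunblum_coeff[OF this i(1), of a] have "c / 4 \<le> norm (\<Sum>i<n. a i *\<^sub>C x (r (g i)))"
      using i(2) c(2)[of "r (g i)"] by simp
    then show ?thesis using d by linarith
  qed
  have "norm (\<Sum>i<n. a i *\<^sub>C x (r (f i))) \<le> 2 * norm (\<Sum>i<n. a i *\<^sub>C x (r (g i)))"
    if fg: "strict_mono f" "strict_mono g" for a f g
  proof -
    \<comment> \<open>By homogeneity the largest coefficient may be assumed to have modulus
      1.\<close>
    define m where "m = Max ((\<lambda>i. cmod (a i)) ` {..<n})"
    have m: "cmod (a i) \<le> m" if "i < n" for i using that by (simp add: m_def)
    have "m \<in> (\<lambda>i. cmod (a i)) ` {..<n}" unfolding m_def using False by (intro Max_in) auto
    then obtain j where j: "j < n" "cmod (a j) = m" by auto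
    show ?thesis
    proof (cases "m = 0")
      case True
      then have "a i = 0" if "i < n" for i using m[OF that] by simp
      then have "(\<Sum>i<n. a i *\<^sub>C x (r (f i))) = 0" by simp
      then show ?thesis by simp
    next
      case False
      have m0: "0 < m" using False j(2) norm_ge_zero[of "a j"] by linarith
      define a' where "a' i = a i / of_real m" for i
      have sc: "norm (\<Sum>i<n. a i *\<^sub>C x (r (f i))) = m * norm (\<Sum>i<n. a' i *\<^sub>C x (r (f i)))" for f
      proof -
        have "(\<Sum>i<n. a i *\<^sub>C x (r (f i))) = of_real m *\<^sub>C (\<Sum>i<n. a' i *\<^sub>C x (r (f i)))"
          unfolding complex_vector.scale_sum_right scaleC_scaleC using m0 by (simp add: a'_def)
        then show ?thesis using m0 by (simp add: norm_scaleC)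
      qed
      have "norm (\<Sum>i<n. a' i *\<^sub>C x (r (f i))) \<le> 2 * norm (\<Sum>i<n. a' i *\<^sub>C x (r (g i)))"
        using m m0 j by (intro unit fg) (auto simp: a'_def norm_divide)
      then show ?thesis unfolding sc using m0 by simp
    qed
  qed
  then show ?thesis using r(1) by blast
qed

text \<open>Diagonalization over the number n of vectors, each estimate being stable under
  subsequences.\<close>

lemma increasing_spreading_exists:
  fixes x :: "nat \<Rightarrow> 'a::complex_normed_vector"
  assumes g: "grunblum 2 x" and c: "0 < c" "\<And>i. c \<le> norm (x i)" and b: "\<And>i. norm (x i) \<le> b"
  shows "\<exists>r::nat \<Rightarrow> nat. strict_mono r \<and> increasing_spreading (x \<circ> r)"
proof -
  define P where "P n s \<longleftrightarrow> (\<forall>(a::nat \<Rightarrow> complex) (f::nat \<Rightarrow> nat) g. strict_mono f \<longrightarrow> strict_mono g \<longrightarrow>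
    norm (\<Sum>i<n. a i *\<^sub>C x (s (f i))) \<le> 2 * norm (\<Sum>i<n. a i *\<^sub>C x (s (g i))))"
    for n and s :: "nat \<Rightarrow> nat"
  have P_estimate: "norm (\<Sum>i<n. a i *\<^sub>C x (s (f i))) \<le> 2 * norm (\<Sum>i<n. a i *\<^sub>C x (s (g i)))"
    if "P n s" "strict_mono f" "strict_mono g" for n s f g and a :: "nat \<Rightarrow> complex"
    using that unfolding P_def by blast
  interpret subseqs P
  proof
    fix n and s :: "nat \<Rightarrow> nat" assume s: "strict_mono s"
    have "grunblum 2 (x \<circ> s)" by (rule grunblum_subseq[OF g s])
    from stabilize_fixed_size[OF this c(1), of b n] c(2) b
    show "\<exists>r'. strict_mono r' \<and> P n (s \<circ> r')" by (auto simp: P_def)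
  qed
  have stable: "P n (s \<circ> r)" if r: "strict_mono r" and P: "P n s" for r s n
    unfolding P_def
  proof (intro allI impI)
    fix a :: "nat \<Rightarrow> complex" and f g :: "nat \<Rightarrow> nat" assume "strict_mono f" "strict_mono g"
    then have "strict_mono (r \<circ> f)" "strict_mono (r \<circ> g)" using r by (auto intro: strict_mono_o)
    then have "norm (\<Sum>i<n. a i *\<^sub>C x (s ((r \<circ> f) i))) \<le> 2 * norm (\<Sum>i<n. a i *\<^sub>C x (s ((r \<circ> g) i)))"
      by (rule P_estimate[OF P])
    then show "norm (\<Sum>i<n. a i *\<^sub>C x ((s \<circ> r) (f i))) \<le> 2 * norm (\<Sum>i<n. a i *\<^sub>C x ((s \<circ> r) (g i)))"
      by simp
  qed
  have diag: "P n (diagseq \<circ> (+) (Suc n))" for n by (rule diagseq_holds[OF stable])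
  \<comment> \<open>the estimate for \<open>n\<close> vectors holds from index \<open>n + 1\<close> on, while it is needed from \<open>n - 1\<close> on\<close>
  define r where "r i = diagseq (i + 2)" for i
  have r: "strict_mono r" using subseq_diagseq by (auto simp: r_def strict_mono_def)
  have "increasing_spreading (x \<circ> r)" unfolding increasing_spreading_def
  proof (intro allI impI)
    fix n and a :: "nat \<Rightarrow> complex" and f g :: "nat \<Rightarrow> nat"
    assume fg: "strict_mono f" "strict_mono g" and n: "n \<le> Suc (f 0)" "n \<le> Suc (g 0)"
    \<comment> \<open>Relative to the tail from n + 1 on, the index f i + 2 becomes f i + 1 - n; the
      condition on f 0 keeps the subtraction exact.\<close>
    have shift: "strict_mono (\<lambda>i. f i + 1 - n) \<and> (\<forall>i. r (f i) = (diagseq \<circ> (+) (Suc n)) (f i + 1 - n))"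
      if f: "strict_mono f" "n \<le> Suc (f 0)" for f :: "nat \<Rightarrow> nat"
    proof -
      have ge: "n \<le> f i + 1" for i using f strict_mono_less_eq[OF f(1), of 0 i] by simp
      have "f i + 1 - n < f j + 1 - n" if "i < j" for i j
        using strict_monoD[OF f(1) that] ge[of i] by linarith
      moreover have "r (f i) = (diagseq \<circ> (+) (Suc n)) (f i + 1 - n)" for i
        unfolding r_def comp_def using ge[of i] by (intro arg_cong[where f = diagseq]) linarith
      ultimately show ?thesis by (simp add: strict_mono_def)
    qed
    have "norm (\<Sum>i<n. a i *\<^sub>C x ((diagseq \<circ> (+) (Suc n)) (f i + 1 - n)))
        \<le> 2 * norm (\<Sum>i<n. a i *\<^sub>C x ((diagseq \<circ> (+) (Suc n)) (g i + 1 - n)))"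
      using shift[OF fg(1) n(1)] shift[OF fg(2) n(2)] by (intro P_estimate[OF diag]) blast+
    moreover have "x (r (f i)) = x ((diagseq \<circ> (+) (Suc n)) (f i + 1 - n))"
      "x (r (g i)) = x ((diagseq \<circ> (+) (Suc n)) (g i + 1 - n))" for i
      using shift[OF fg(1) n(1)] shift[OF fg(2) n(2)] by auto
    ultimately show "norm (\<Sum>i<n. a i *\<^sub>C (x \<circ> r) (f i)) \<le> 2 * norm (\<Sum>i<n. a i *\<^sub>C (x \<circ> r) (g i))"
      by (simp only: comp_def[of x r])
  qed
  then show ?thesis using r by blast
qed

text \<open>Selection after Bessaga and Pelczynski: late terms are small on finitely many
  functionals, and increasing indices are the side condition of Mazur's construction.\<close>

lemma weakly_null_grunblum_subseq:
  fixes x :: "nat \<Rightarrow> 'a::complex_normed_vector"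
  assumes x: "weakly_null x" and c: "0 < c" "\<And>i. c \<le> norm (x i)"
  shows "\<exists>r::nat \<Rightarrow> nat. strict_mono r \<and> grunblum 2 (x \<circ> r)"
proof -
  have step: "\<exists>j. i < j \<and> c \<le> norm (x j) \<and> (\<forall>\<phi>\<in>\<Phi>. cmod (\<phi> (x j)) \<le> \<eta>)"
    if \<Phi>: "finite \<Phi>" "\<Phi> \<subseteq> dual_ball" "0 < \<eta>" for i :: nat and \<eta> and \<Phi> :: "('a \<Rightarrow> complex) set"
  proof -
    have "\<forall>\<^sub>F j in sequentially. \<forall>\<phi>\<in>\<Phi>. cmod (\<phi> (x j)) < \<eta>"
    proof (rule eventually_ball_finite[OF \<Phi>(1)], rule ballI)
      fix \<phi> assume "\<phi> \<in> \<Phi>"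
      then have "(\<lambda>n. \<phi> (x n)) \<longlonglongrightarrow> 0" using x \<Phi>(2) by (auto simp: weakly_null_iff_dual_ball)
      then have "(\<lambda>n. cmod (\<phi> (x n))) \<longlonglongrightarrow> 0" by (rule tendsto_norm_zero)
      then show "\<forall>\<^sub>F j in sequentially. cmod (\<phi> (x j)) < \<eta>" using \<Phi>(3) by (intro order_tendstoD(2)) auto
    qed
    then obtain J where "\<forall>j\<ge>J. \<forall>\<phi>\<in>\<Phi>. cmod (\<phi> (x j)) < \<eta>" by (auto simp: eventually_sequentially)
    then show ?thesis using c(2) by (intro exI[of _ "max J (Suc i)"]) (auto intro: less_imp_le)
  qed
  obtain s where "\<forall>m. s m < s (Suc m)" "\<forall>m. c \<le> norm (x (s m))" "grunblum 2 (x \<circ> s)"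
    by (rule mazur_selection[where P = "\<lambda>_ i j. i < j", OF c(1) step])
  then show ?thesis by (auto simp: strict_mono_Suc_iff)
qed

text \<open>Both properties are stable under subsequences, so the sequences can be treated in turn,
  thinning further each time.\<close>

lemma good_subsequence:
  fixes X :: "nat \<Rightarrow> nat \<Rightarrow> 'a::complex_normed_vector"
  assumes "\<And>j. j < k \<Longrightarrow> weakly_null (X j)" and c: "0 < c"
    and bd: "\<And>j n. j < k \<Longrightarrow> c \<le> norm (X j n) \<and> norm (X j n) \<le> b"
  shows "\<exists>r::nat \<Rightarrow> nat. strict_mono r \<and>
    (\<forall>j<k. grunblum 2 (X j \<circ> r) \<and> increasing_spreading (X j \<circ> r))"
  using assms(1) bd
proof (induction k)
  case 0
  show ?case by (intro exI[of _ id]) (simp add: strict_mono_def)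
next
  case (Suc k)
  then obtain r :: "nat \<Rightarrow> nat" where r: "strict_mono r"
    "\<forall>j<k. grunblum 2 (X j \<circ> r) \<and> increasing_spreading (X j \<circ> r)" by (metis less_SucI)
  have "weakly_null (X k \<circ> r)" using Suc.prems(1) r(1) by (intro weakly_null_subseq) auto
  then obtain s :: "nat \<Rightarrow> nat" where s: "strict_mono s" "grunblum 2 (X k \<circ> r \<circ> s)"
    using weakly_null_grunblum_subseq[of "X k \<circ> r" c] c Suc.prems(2)[of k] by auto
  obtain t :: "nat \<Rightarrow> nat" where t: "strict_mono t" "increasing_spreading (X k \<circ> r \<circ> s \<circ> t)"
    using increasing_spreading_exists[OF s(2) c, of b] Suc.prems(2)[of k] by auto
  have st: "strict_mono (s \<circ> t)" using s(1) t(1) by (rule strict_mono_o)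
  have "grunblum 2 (X j \<circ> (r \<circ> (s \<circ> t))) \<and> increasing_spreading (X j \<circ> (r \<circ> (s \<circ> t)))" if "j < Suc k" for j
  proof (cases "j = k")
    case True
    then show ?thesis using t grunblum_subseq[OF s(2) t(1)] by (simp add: o_assoc)
  next
    case False
    then have "j < k" using that by simp
    then show ?thesis using r(2) grunblum_subseq[OF _ st] increasing_spreading_subseq[OF _ st]
      unfolding o_assoc[of "X j" r] by blast
  qed
  moreover have "strict_mono (r \<circ> (s \<circ> t))" using r(1) st by (rule strict_mono_o)
  ultimately show ?case by blast
qed

section \<open>Compactness of a power\<close>

lemma SP1wI:
  assumes "grunblum 2 x" "increasing_spreading x" "weakly_null x" "0 < c"
    "\<And>n. c \<le> norm (x n) \<and> norm (x n) \<le> b"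
  shows "x \<in> SP1w"
proof -
  have "x n \<noteq> 0" for n using assms(4) assms(5)[of n] by auto
  then have "basic_sequence x" using grunblum_basic[OF assms(1)] by blast
  moreover have "seminormalized x" unfolding seminormalized_def using assms(4,5) by blast
  ultimately show ?thesis
    using assms(3) increasing_spreading_imp_schreier_spreading[OF assms(2)] by (simp add: SP1w_def)
qed

lemma schreier_singular_power_compact:
  fixes S :: "'a::complex_normed_vector \<Rightarrow> 'a"
  assumes HI: "HI fs \<xi> TYPE('a)"
    and fin: "finite ((SP1w :: (nat \<Rightarrow> 'a) set) // schreier_equiv fs \<xi>)"
    and S: "bounded_clinear S" and sing: "schreier_singular fs \<xi> S"
    and b: "\<And>n. norm (x n) \<le> b"
  defines "N \<equiv> card ((SP1w :: (nat \<Rightarrow> 'a) set) // schreier_equiv fs \<xi>)"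
  shows "\<exists>r::nat \<Rightarrow> nat. strict_mono r \<and> Cauchy (\<lambda>n. (S ^^ N) (x (r n)))"
proof (rule ccontr)
  assume neg: "\<not> ?thesis"
  interpret S: bounded_linear S by (rule bounded_clinear_bounded_linear[OF S])
  note SN = bounded_clinear_funpow[OF S]
  obtain K where K: "1 \<le> K" "\<And>v. norm (S v) \<le> K * norm v"
  proof -
    obtain K where K: "0 < K" "\<And>v. norm (S v) \<le> norm v * K" using S.pos_bounded by blast
    have "norm (S v) \<le> max 1 K * norm v" for v
      using K(2)[of v] mult_right_mono[of K "max 1 K" "norm v"] by (simp add: mult.commute)
    then show thesis using that[of "max 1 K"] by simp
  qed
  have KN: "norm ((S ^^ j) v) \<le> K ^ j * norm v" for j v
  proof (induction j)
    case (Suc j)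
    have "norm (S ((S ^^ j) v)) \<le> K * norm ((S ^^ j) v)" by (rule K(2))
    also have "\<dots> \<le> K * (K ^ j * norm v)" using Suc K(1) by (intro mult_left_mono) auto
    finally show ?case by simp
  qed simp
  have nc: "\<not> Cauchy (\<lambda>n. (S ^^ N) (x (r n)))" if "strict_mono r" for r using neg that by blast
  obtain d :: "nat \<Rightarrow> 'a" and \<epsilon> where d: "weakly_null d" "\<forall>n. norm (d n) \<le> 2 * b" "0 < \<epsilon>" "\<forall>n. \<epsilon> \<le> norm ((S ^^ N) (d n))"
    by (rule weakly_null_differences[OF HI b bounded_clinear_bounded_linear[OF SN] nc])
  have b0: "0 \<le> b" using b[of 0] norm_ge_zero order_trans by blast
  define X where "X j n = (S ^^ j) (d n)" for j n
  \<comment> \<open>The remaining applications of S enlarge a vector at most by K^N, so the lower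
    bound for S^N d_n passes back to every S^j d_n.\<close>
  define c where "c = \<epsilon> / K ^ N"
  have c: "0 < c" using d(3) K(1) by (simp add: c_def)
  have bd: "c \<le> norm (X j n) \<and> norm (X j n) \<le> K ^ N * (2 * b)" if j: "j < Suc N" for j n
  proof
    have "\<epsilon> \<le> norm ((S ^^ (N - j)) (X j n))"
      using d(4) j unfolding X_def by (simp add: funpow_add[symmetric, THEN fun_cong, unfolded comp_def])
    also have "\<dots> \<le> K ^ (N - j) * norm (X j n)" by (rule KN)
    also have "\<dots> \<le> K ^ N * norm (X j n)" using K(1) by (intro mult_right_mono power_increasing) auto
    finally show "c \<le> norm (X j n)" using K(1) by (simp add: c_def field_simps)
    have "norm (X j n) \<le> K ^ j * norm (d n)" unfolding X_def by (rule KN)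
    also have "\<dots> \<le> K ^ N * (2 * b)"
      using K(1) j d(2) b0 by (intro mult_mono power_increasing) auto
    finally show "norm (X j n) \<le> K ^ N * (2 * b)" .
  qed
  have wn: "weakly_null (X j)" for j unfolding X_def by (rule weakly_null_image[OF d(1) SN])
  obtain r :: "nat \<Rightarrow> nat" where r: "strict_mono r"
    "\<forall>j<Suc N. grunblum 2 (X j \<circ> r) \<and> increasing_spreading (X j \<circ> r)"
    using good_subsequence[of "Suc N" X c, OF wn c bd] by blast
  have SP: "X j \<circ> r \<in> SP1w" if "j < Suc N" for j
    by (rule SP1wI[of _ c "K ^ N * (2 * b)"]) (use r that c bd[OF that] weakly_null_subseq[OF wn r(1)] in auto)
  let ?R = "schreier_equiv fs \<xi> :: (nat \<Rightarrow> 'a) rel"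
  \<comment> \<open>N + 1 sequences, but only N classes.\<close>
  have "\<not> inj_on (\<lambda>j. ?R `` {X j \<circ> r}) {..<Suc N}"
  proof
    assume inj: "inj_on (\<lambda>j. ?R `` {X j \<circ> r}) {..<Suc N}"
    have "card {..<Suc N} \<le> card ((SP1w :: (nat \<Rightarrow> 'a) set) // ?R)"
      by (rule card_inj_on_le[OF inj _ fin]) (use SP in \<open>auto intro: quotientI\<close>)
    then show False by (simp add: N_def)
  qed
  then obtain i j where ij: "i < j" "j < Suc N" "?R `` {X i \<circ> r} = ?R `` {X j \<circ> r}"
    unfolding inj_on_def by (metis lessThan_iff nat_neq_iff)
  have "(X i \<circ> r, X j \<circ> r) \<in> ?R"
    using eq_equiv_class[OF ij(3) equiv_schreier_equiv] SP[OF ij(2)] by blast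
  then obtain L where L: "1 \<le> L" "\<And>F a. F \<in> schreier fs \<xi> \<Longrightarrow>
      approx_by L (norm (\<Sum>i'\<in>F. a i' *\<^sub>C elt (X i \<circ> r) i')) (norm (\<Sum>i'\<in>F. a i' *\<^sub>C elt (X j \<circ> r) i'))"
    unfolding schreier_equiv_def by blast
  define m where "m = j - i - 1"
  have m: "Suc m + i = j" using ij(1) by (simp add: m_def)
  \<comment> \<open>Compensates the factor K^m of the later applications of S and leaves 1 / (2 L),
    half of what the equivalence requires.\<close>
  define e where "e = 1 / (2 * L * K ^ m)"
  have e: "0 < e" using L(1) K(1) by (simp add: e_def)
  have basic: "basic_sequence (X i \<circ> r)" using SP[of i] ij by (simp add: SP1w_def)
  obtain F a where F: "F \<in> schreier fs \<xi>" "(\<Sum>k\<in>F. a k *\<^sub>C elt (X i \<circ> r) k) \<noteq> 0"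
    "norm (S (\<Sum>k\<in>F. a k *\<^sub>C elt (X i \<circ> r) k)) \<le> e * norm (\<Sum>k\<in>F. a k *\<^sub>C elt (X i \<circ> r) k)"
    using sing basic e unfolding schreier_singular_def by blast
  define z where "z = (\<Sum>k\<in>F. a k *\<^sub>C elt (X i \<circ> r) k)"
  have "(\<Sum>k\<in>F. a k *\<^sub>C elt (X j \<circ> r) k) = (S ^^ Suc m) z"
  proof -
    have "elt (X j \<circ> r) k = (S ^^ Suc m) (elt (X i \<circ> r) k)" for k
      unfolding m[symmetric] X_def elt_def by (simp add: funpow_add)
    then show ?thesis unfolding z_def by (simp only: bounded_clinear_sum[OF SN])
  qed
  moreover have "norm ((S ^^ Suc m) z) \<le> norm z / (2 * L)"
  proof -
    have "(S ^^ Suc m) z = (S ^^ m) (S z)" by (simp only: funpow_Suc_right comp_def)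
    then have "norm ((S ^^ Suc m) z) \<le> K ^ m * norm (S z)" using KN[of m "S z"] by simp
    also have "\<dots> \<le> K ^ m * (e * norm z)" using F(3) K(1) by (intro mult_left_mono) (auto simp: z_def)
    also have "\<dots> = norm z / (2 * L)" using K(1) by (simp add: e_def)
    finally show ?thesis .
  qed
  ultimately have "1 / L * norm z \<le> norm z / (2 * L)"
    using L(2)[OF F(1), of a] unfolding approx_by_def z_def[symmetric] by simp
  then show False using F(2) L(1) by (simp add: z_def[symmetric] field_simps)
qed

section \<open>Hyperinvariant subspaces\<close>

lemma subspace_closure:
  fixes Y :: "'a::complex_normed_vector set"
  assumes Y: "complex_vector.subspace Y"
  shows "complex_vector.subspace (closure Y)"
proof (rule complex_vector.subspaceI)
  show "0 \<in> closure Y" using complex_vector.subspace_0[OF Y] closure_subset by blast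
next
  fix x y assume "x \<in> closure Y" "y \<in> closure Y"
  then obtain u v where uv: "\<And>n. u n \<in> Y" "u \<longlonglongrightarrow> x" "\<And>n. v n \<in> Y" "v \<longlonglongrightarrow> y"
    by (auto simp: closure_sequential)
  have "(\<lambda>n. u n + v n) \<longlonglongrightarrow> x + y" by (intro tendsto_add uv)
  then show "x + y \<in> closure Y"
    unfolding closure_sequential using complex_vector.subspace_add[OF Y uv(1,3)]
    by (intro exI[of _ "\<lambda>n. u n + v n"]) simp
next
  fix c x assume "x \<in> closure Y"
  then obtain u where u: "\<And>n. u n \<in> Y" "u \<longlonglongrightarrow> x" by (auto simp: closure_sequential)
  have "(\<lambda>n. c *\<^sub>C u n) \<longlonglongrightarrow> c *\<^sub>C x"
    by (intro bounded_linear.tendsto[OF bounded_clinear_bounded_linear[OF bounded_clinear_scaleC]] u)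
  then show "c *\<^sub>C x \<in> closure Y"
    unfolding closure_sequential using complex_vector.subspace_scale[OF Y u(1)]
    by (intro exI[of _ "\<lambda>n. c *\<^sub>C u n"]) simp
qed

lemma commute_funpow: "A \<circ> S = S \<circ> A \<Longrightarrow> A ((S ^^ n) v) = (S ^^ n) (A v)"
  by (induction n) (simp_all add: fun_eq_iff)

text \<open>Meant for B = S and B = 1 - z S^N, which commute with everything commuting with S;
  \<open>v\<close> and \<open>w\<close> exclude the two trivial subspaces.\<close>

lemma kernel_hyperinvariant:
  fixes S B :: "'a::complex_normed_vector \<Rightarrow> 'a"
  assumes B: "bounded_clinear B"
    and comm: "\<And>A v. bounded_clinear A \<Longrightarrow> A \<circ> S = S \<circ> A \<Longrightarrow> A (B v) = B (A v)"
    and v: "B v = 0" "v \<noteq> 0" and w: "B w \<noteq> 0"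
  shows "nontrivial_hyperinvariant S {v. B v = 0}"
  unfolding nontrivial_hyperinvariant_def
proof (intro conjI allI impI)
  interpret B: bounded_linear B by (rule bounded_clinear_bounded_linear[OF B])
  show "closed {v. B v = 0}"
    by (intro closed_Collect_eq B.continuous_on continuous_on_id continuous_on_const)
  show "complex_vector.subspace {v. B v = 0}"
    by (rule complex_vector.subspaceI) (simp_all add: B.zero B.add bounded_clinear_scale[OF B])
  show "{v. B v = 0} \<noteq> {0}" using v by auto
  show "{v. B v = 0} \<noteq> UNIV" using w by auto
  fix A assume A: "bounded_clinear A \<and> A \<circ> S = S \<circ> A"
  have "A 0 = 0" using linear_0[OF bounded_linear.linear[OF bounded_clinear_bounded_linear]] A by blast
  then show "A ` {v. B v = 0} \<subseteq> {v. B v = 0}" using comm[of A] A by (auto simp flip: comm)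
qed

definition commutant :: "('a::complex_normed_vector \<Rightarrow> 'a) \<Rightarrow> ('a \<Rightarrow> 'a) set" where
  "commutant S = {A. bounded_clinear A \<and> A \<circ> S = S \<circ> A}"

lemma commutantD:
  assumes "A \<in> commutant S"
  shows commutant_bounded_clinear: "bounded_clinear A"
    and commutant_funpow: "A ((S ^^ n) v) = (S ^^ n) (A v)"
  using assms commute_funpow by (auto simp: commutant_def)

lemma commutant_compose:
  assumes "A \<in> commutant S" "B \<in> commutant S"
  shows "A \<circ> B \<in> commutant S"
proof -
  have "A (B (S v)) = S (A (B v))" for v
    using commutantD(2)[OF assms(1), of 1] commutantD(2)[OF assms(2), of 1] by simp
  then show ?thesis
    using bounded_clinear_compose[OF commutantD(1)[OF assms(1)] commutantD(1)[OF assms(2)]]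
    by (simp add: commutant_def fun_eq_iff comp_def)
qed

text \<open>The closure of the orbit is invariant under the commutant and contains y \<noteq> 0, so
  it has to be the whole space.\<close>

lemma orbit_dense:
  fixes S :: "'a::complex_normed_vector \<Rightarrow> 'a"
  assumes S: "bounded_clinear S" and no: "\<nexists>M. nontrivial_hyperinvariant S M" and y: "y \<noteq> 0"
  shows "closure ((\<lambda>A. A y) ` commutant S) = UNIV"
proof (rule ccontr)
  define Y where "Y = (\<lambda>A. A y) ` commutant S"
  assume "closure ((\<lambda>A. A y) ` commutant S) \<noteq> UNIV"
  then have ne: "closure Y \<noteq> UNIV" by (simp add: Y_def)
  interpret S: bounded_linear S by (rule bounded_clinear_bounded_linear[OF S])
  have sub: "complex_vector.subspace Y"
  proof (rule complex_vector.subspaceI)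
    have "(\<lambda>v. 0) \<in> commutant S"
      using bounded_clinear_scaleC[of 0] by (simp add: commutant_def fun_eq_iff S.zero)
    then show "0 \<in> Y" by (auto simp: Y_def image_iff intro!: bexI[of _ "\<lambda>v. 0"])
  next
    fix u v assume "u \<in> Y" "v \<in> Y"
    then obtain A B where AB: "A \<in> commutant S" "B \<in> commutant S" "u = A y" "v = B y"
      by (auto simp: Y_def)
    have "bounded_clinear (\<lambda>v. A v + B v)"
      using AB(1,2) by (auto simp: commutant_def bounded_clinear_def scaleC_add_right intro: bounded_linear_add)
    then have "(\<lambda>v. A v + B v) \<in> commutant S"
      using AB(1,2) by (simp add: commutant_def fun_eq_iff S.add)
    then show "u + v \<in> Y" unfolding Y_def AB(3,4) by (rule rev_image_eqI) simp
  next
    fix c u assume "u \<in> Y"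
    then obtain A where A: "A \<in> commutant S" "u = A y" by (auto simp: Y_def)
    have "bounded_clinear (\<lambda>v. c *\<^sub>C A v)"
      by (rule bounded_clinear_compose[OF bounded_clinear_scaleC commutantD(1)[OF A(1)]])
    then have "(\<lambda>v. c *\<^sub>C A v) \<in> commutant S"
      using A(1) by (simp add: commutant_def fun_eq_iff bounded_clinear_scale[OF S])
    then show "c *\<^sub>C u \<in> Y" unfolding Y_def A(2) by (rule rev_image_eqI) simp
  qed
  have "nontrivial_hyperinvariant S (closure Y)"
    unfolding nontrivial_hyperinvariant_def
  proof (intro conjI allI impI ne)
    show "complex_vector.subspace (closure Y)" by (rule subspace_closure[OF sub])
    have "(\<lambda>v. v) \<in> commutant S"
      by (simp add: commutant_def bounded_clinear_def bounded_linear_ident fun_eq_iff)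
    then have "y \<in> Y" unfolding Y_def by (rule rev_image_eqI) simp
    then show "closure Y \<noteq> {0}" using y closure_subset by blast
  next
    fix B assume B: "bounded_clinear B \<and> B \<circ> S = S \<circ> B"
    have BS: "B \<in> commutant S" using B by (simp add: commutant_def)
    have "B (A y) \<in> Y" if "A \<in> commutant S" for A
      unfolding Y_def by (rule rev_image_eqI[OF commutant_compose[OF BS that]]) simp
    then have "B ` Y \<subseteq> Y" by (auto simp: Y_def)
    moreover have "B ` closure Y \<subseteq> closure (B ` Y)"
      using B by (intro closure_bounded_linear_image_subset bounded_clinear_bounded_linear) simp
    ultimately show "B ` closure Y \<subseteq> closure Y" using closure_mono by blast
  qed simp
  then show False using no by blast
qed

section \<open>Compact operators and Hilden's argument\<close>

definition compact_operator :: "('a::real_normed_vector \<Rightarrow> 'a) \<Rightarrow> bool" where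
  "compact_operator K \<longleftrightarrow> (\<forall>x b. (\<forall>n. norm (x n) \<le> b) \<longrightarrow>
    (\<exists>r::nat \<Rightarrow> nat. strict_mono r \<and> Cauchy (\<lambda>n. K (x (r n)))))"

lemma compact_operator_closure_image:
  fixes K :: "'a::banach \<Rightarrow> 'a"
  assumes "compact_operator K" "bounded C"
  shows "compact (closure (K ` C))"
  unfolding compact_eq_seq_compact_metric seq_compact_def
proof (intro allI impI)
  fix f :: "nat \<Rightarrow> 'a" assume f: "\<forall>n. f n \<in> closure (K ` C)"
  have "\<exists>v\<in>C. dist (K v) (f n) < inverse (real (Suc n))" for n
  proof -
    have "f n \<in> closure (K ` C)" "0 < inverse (real (Suc n))" using f by simp_all
    then show ?thesis unfolding closure_approachable by blast
  qed
  then obtain v where v: "\<And>n. v n \<in> C" "\<And>n. dist (K (v n)) (f n) < inverse (real (Suc n))" by metis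
  obtain b where "\<forall>n. norm (v n) \<le> b" using assms(2) v(1) by (auto simp: bounded_iff)
  then obtain r :: "nat \<Rightarrow> nat" where r: "strict_mono r" "Cauchy (\<lambda>n. K (v (r n)))"
    using assms(1) unfolding compact_operator_def by blast
  then obtain l where l: "(\<lambda>n. K (v (r n))) \<longlonglongrightarrow> l" using Cauchy_convergent_iff convergent_def by blast
  have "(\<lambda>n. dist (K (v n)) (f n)) \<longlonglongrightarrow> 0"
  proof (rule tendsto_sandwich[OF _ _ tendsto_const LIMSEQ_inverse_real_of_nat])
    show "\<forall>\<^sub>F n in sequentially. dist (K (v n)) (f n) \<le> inverse (real (Suc n))"
      by (intro always_eventually allI less_imp_le v(2))
  qed simp
  from LIMSEQ_subseq_LIMSEQ[OF this r(1)] have "(\<lambda>n. norm (f (r n) - K (v (r n)))) \<longlonglongrightarrow> 0"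
    by (simp add: o_def dist_norm norm_minus_commute)
  then have "(\<lambda>n. f (r n) - K (v (r n))) \<longlonglongrightarrow> 0" by (rule tendsto_norm_zero_cancel)
  from tendsto_add[OF this l] have lim: "(\<lambda>n. f (r n)) \<longlonglongrightarrow> l" by simp
  have "l \<in> closure (K ` C)"
    by (rule closed_sequentially[OF closed_closure _ lim]) (use f in simp)
  with lim show "\<exists>l\<in>closure (K ` C). \<exists>r. strict_mono r \<and> (f \<circ> r) \<longlonglongrightarrow> l"
    using r(1) by (intro bexI[of _ l] exI[of _ r]) (simp_all add: o_def)
qed

text \<open>Riesz's argument: unit vectors almost fixed by z K have a subsequence with convergent
  images, hence converge along it to a fixed vector of norm 1.\<close>

lemma compact_operator_bounded_below:
  fixes K :: "'a::complex_banach \<Rightarrow> 'a"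
  assumes K: "bounded_clinear K" "compact_operator K" and inj: "\<And>v. v = z *\<^sub>C K v \<Longrightarrow> v = 0"
  shows "\<exists>c>0. \<forall>v. c * norm v \<le> norm (v - z *\<^sub>C K v)"
proof (rule ccontr)
  assume neg: "\<not> ?thesis"
  interpret K: bounded_linear K by (rule bounded_clinear_bounded_linear[OF K(1)])
  have "\<exists>v. norm v = 1 \<and> norm (v - z *\<^sub>C K v) < inverse (real (Suc n))" for n
  proof -
    have "0 < inverse (real (Suc n))" by simp
    then obtain v where v: "norm (v - z *\<^sub>C K v) < inverse (real (Suc n)) * norm v"
      using neg by (meson not_less)
    have v0: "0 < norm v"
      using v norm_ge_zero[of "v - z *\<^sub>C K v"] by (cases "v = 0") auto
    define t where "t = complex_of_real (1 / norm v)"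
    have t: "cmod t = 1 / norm v" by (simp add: t_def norm_divide)
    have eq: "t *\<^sub>C v - z *\<^sub>C K (t *\<^sub>C v) = t *\<^sub>C (v - z *\<^sub>C K v)"
      by (simp add: bounded_clinear_scale[OF K(1)] complex_vector.scale_right_diff_distrib scaleC_scaleC mult.commute)
    have "norm (v - z *\<^sub>C K v) / norm v < inverse (real (Suc n))"
      using v v0 by (simp only: pos_divide_less_eq)
    then have "norm (t *\<^sub>C v - z *\<^sub>C K (t *\<^sub>C v)) < inverse (real (Suc n))"
      unfolding eq norm_scaleC t by simp
    moreover have "norm (t *\<^sub>C v) = 1" using v0 by (simp add: norm_scaleC t)
    ultimately show ?thesis by blast
  qed
  then obtain v where v: "\<And>n. norm (v n) = 1" "\<And>n. norm (v n - z *\<^sub>C K (v n)) < inverse (real (Suc n))"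
    by metis
  have "\<forall>n. norm (v n) \<le> 1" using v(1) by simp
  then obtain r :: "nat \<Rightarrow> nat" where r: "strict_mono r" "Cauchy (\<lambda>n. K (v (r n)))"
    using K(2) unfolding compact_operator_def by blast
  then obtain w where w: "(\<lambda>n. K (v (r n))) \<longlonglongrightarrow> w" using Cauchy_convergent_iff convergent_def by blast
  have "(\<lambda>n. norm (v n - z *\<^sub>C K (v n))) \<longlonglongrightarrow> 0"
  proof (rule tendsto_sandwich[OF _ _ tendsto_const LIMSEQ_inverse_real_of_nat])
    show "\<forall>\<^sub>F n in sequentially. norm (v n - z *\<^sub>C K (v n)) \<le> inverse (real (Suc n))"
      by (intro always_eventually allI less_imp_le v(2))
  qed simp
  then have "(\<lambda>n. v n - z *\<^sub>C K (v n)) \<longlonglongrightarrow> 0" by (rule tendsto_norm_zero_cancel)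
  then have d: "(\<lambda>n. v (r n) - z *\<^sub>C K (v (r n))) \<longlonglongrightarrow> 0"
    using LIMSEQ_subseq_LIMSEQ[OF _ r(1)] by (fastforce simp: o_def)
  have zw: "(\<lambda>n. z *\<^sub>C K (v (r n))) \<longlonglongrightarrow> z *\<^sub>C w"
    by (intro bounded_linear.tendsto[OF bounded_clinear_bounded_linear[OF bounded_clinear_scaleC]] w)
  have vr: "(\<lambda>n. v (r n)) \<longlonglongrightarrow> z *\<^sub>C w" using tendsto_add[OF d zw] by simp
  have "K (z *\<^sub>C w) = w" by (rule LIMSEQ_unique[OF K.tendsto[OF vr] w])
  then have "z *\<^sub>C w = 0" by (intro inj) simp
  moreover have "norm (z *\<^sub>C w) = 1"
    using LIMSEQ_unique[OF tendsto_norm[OF vr], of 1] by (simp add: v(1))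
  ultimately show False by (metis norm_zero zero_neq_one)
qed

text \<open>Hilden's argument: since orbits under the commutant are dense, finitely many of its elements
  steer every \<open>K\<^sup>n x\<^sub>0\<close> back to a ball around \<open>x\<^sub>0\<close>, which contradicts quasinilpotency.\<close>

lemma quasinilpotent_hyperinvariant:
  fixes S :: "'a::complex_banach \<Rightarrow> 'a"
  assumes S: "bounded_clinear S" and K: "K = S ^^ N" "compact_operator K" "K x0 \<noteq> 0"
    and inj: "\<And>z v. v = z *\<^sub>C K v \<Longrightarrow> v = 0"
  shows "\<exists>M. nontrivial_hyperinvariant S M"
proof (rule ccontr)
  assume no: "\<not> ?thesis"
  have Kb: "bounded_clinear K" unfolding K(1) by (rule bounded_clinear_funpow[OF S])
  interpret K: bounded_linear K by (rule bounded_clinear_bounded_linear[OF Kb])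
  have Kcomm: "A (K v) = K (A v)" if "A \<in> commutant S" for A v
    unfolding K(1) by (rule commutantD(2)[OF that])
  obtain M where M: "0 < M" "\<And>v. norm (K v) \<le> norm v * M" using K.pos_bounded by blast
  have x0: "x0 \<noteq> 0" using K(3) K.zero by auto
  \<comment> \<open>The first bound keeps 0 away from the ball around x0, the second from the
    closure of the image of that ball under K.\<close>
  define \<rho> where "\<rho> = min (norm x0 / 4) (norm (K x0) / (2 * M))"
  have \<rho>: "0 < \<rho>" "\<rho> \<le> norm x0 / 4" "\<rho> * M \<le> norm (K x0) / 2"
  proof -
    show "0 < \<rho>" using x0 K(3) M(1) by (simp add: \<rho>_def)
    have "\<rho> * M \<le> norm (K x0) / (2 * M) * M" using M(1) by (intro mult_right_mono) (auto simp: \<rho>_def)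
    then show "\<rho> * M \<le> norm (K x0) / 2" using M(1) by simp
  qed (simp add: \<rho>_def)
  define C where "C = closure (K ` cball x0 \<rho>)"
  have "compact C" unfolding C_def by (rule compact_operator_closure_image[OF K(2) bounded_cball])
  have low: "norm (K x0) / 2 \<le> norm y" if "y \<in> C" for y
  proof -
    have "K ` cball x0 \<rho> \<subseteq> {y. norm (K x0) / 2 \<le> norm y}"
    proof clarify
      fix v assume "v \<in> cball x0 \<rho>"
      then have "norm (x0 - v) \<le> \<rho>" by (simp add: dist_norm)
      then have "norm (x0 - v) * M \<le> \<rho> * M" using M(1) by (intro mult_right_mono) auto
      then have "norm (K (x0 - v)) \<le> \<rho> * M" using M(2)[of "x0 - v"] by linarith
      then show "norm (K x0) / 2 \<le> norm (K v)"
        using \<rho>(3) norm_triangle_ineq2[of "K x0" "K x0 - K v"] by (simp add: K.diff)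
    qed
    moreover have "closed {y. norm (K x0) / 2 \<le> norm y}"
      by (intro closed_Collect_le continuous_intros)
    ultimately have "C \<subseteq> {y. norm (K x0) / 2 \<le> norm y}" unfolding C_def by (rule closure_minimal)
    then show ?thesis using that by blast
  qed
  have cover: "\<exists>A\<in>commutant S. A y \<in> ball x0 \<rho>" if "y \<in> C" for y
  proof -
    have "0 < norm y" using low[OF that] K(3) zero_less_norm_iff[of "K x0"] by linarith
    then have "x0 \<in> closure ((\<lambda>A. A y) ` commutant S)" using orbit_dense[OF S no, of y] by simp
    then show ?thesis using \<rho>(1) by (auto simp: closure_approachable dist_commute)
  qed
  obtain \<A> where \<A>: "\<A> \<subseteq> commutant S" "finite \<A>" "C \<subseteq> (\<Union>A\<in>\<A>. A -` ball x0 \<rho>)"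
  proof (rule compactE_image[OF \<open>compact C\<close>, of "commutant S" "\<lambda>A. A -` ball x0 \<rho>"])
    show "open (A -` ball x0 \<rho>)" if "A \<in> commutant S" for A
      using linear_continuous_on[OF bounded_clinear_bounded_linear[OF commutantD(1)[OF that]], of UNIV]
      by (intro open_vimage) auto
    show "C \<subseteq> (\<Union>A\<in>commutant S. A -` ball x0 \<rho>)" using cover by auto
  qed auto
  have "\<exists>L\<ge>1. \<forall>A\<in>\<A>. \<forall>v. norm (A v) \<le> L * norm v"
    using \<A>(2,1)
  proof (induction \<A> rule: finite_induct)
    case (insert A \<A>)
    then obtain L where L: "1 \<le> L" "\<forall>A\<in>\<A>. \<forall>v. norm (A v) \<le> L * norm v" by auto
    have "A \<in> commutant S" using insert.prems by simp
    then have "bounded_linear A" by (intro bounded_clinear_bounded_linear commutantD(1))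
    then obtain l where l: "\<And>v. norm (A v) \<le> norm v * l" using bounded_linear.bounded by blast
    have "norm (B v) \<le> max L l * norm v" if "B \<in> insert A \<A>" for B v
    proof (cases "B = A")
      case True
      have "norm v * l \<le> norm v * max L l" by (intro mult_left_mono) auto
      then show ?thesis using True l[of v] by (simp add: mult.commute)
    next
      case False
      have "L * norm v \<le> max L l * norm v" by (intro mult_right_mono) auto
      then show ?thesis using False that L(2) by (auto intro: order_trans)
    qed
    then show ?case using L(1) by (intro exI[of _ "max L l"]) auto
  qed (auto intro: exI[of _ 1])
  then obtain L where L: "1 \<le> L" "\<And>A v. A \<in> \<A> \<Longrightarrow> norm (A v) \<le> L * norm v" by blast
  \<comment> \<open>Each step applies K and steers back with one of finitely many operators; these
    commute with K and collect in front of K^n, with norm at most L^n.\<close>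
  have walk: "\<exists>B\<in>commutant S. (\<forall>v. norm (B v) \<le> L ^ n * norm v) \<and> B ((K ^^ n) x0) \<in> cball x0 \<rho>" for n
  proof (induction n)
    case 0
    have "(\<lambda>v. v) \<in> commutant S"
      by (simp add: commutant_def bounded_clinear_def bounded_linear_ident fun_eq_iff)
    then show ?case using \<rho>(1) by (intro bexI[of _ "\<lambda>v. v"]) auto
  next
    case (Suc n)
    then obtain B where B: "B \<in> commutant S" "\<And>v. norm (B v) \<le> L ^ n * norm v" "B ((K ^^ n) x0) \<in> cball x0 \<rho>"
      by blast
    have "K (B ((K ^^ n) x0)) \<in> C"
      unfolding C_def by (rule subsetD[OF closure_subset imageI[OF B(3)]])
    then obtain A where A: "A \<in> \<A>" "A (K (B ((K ^^ n) x0))) \<in> ball x0 \<rho>" using \<A>(3) by auto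
    have "(A \<circ> B) ((K ^^ Suc n) x0) \<in> cball x0 \<rho>" using A(2) Kcomm[OF B(1)] by simp
    moreover have "norm ((A \<circ> B) v) \<le> L ^ Suc n * norm v" for v
    proof -
      have "norm (A (B v)) \<le> L * norm (B v)" by (rule L(2)[OF A(1)])
      also have "\<dots> \<le> L * (L ^ n * norm v)" using L(1) by (intro mult_left_mono B(2)) auto
      finally show ?thesis by simp
    qed
    moreover have "A \<circ> B \<in> commutant S" using A(1) \<A>(1) B(1) by (intro commutant_compose) auto
    ultimately show ?case by blast
  qed
  interpret seminormed_operator "scaleC :: complex \<Rightarrow> 'a \<Rightarrow> 'a" UNIV norm K M
    by unfold_locales
      (use M in \<open>auto simp: norm_triangle_ineq norm_scaleC K.add bounded_clinear_scale[OF Kb] mult.commute\<close>)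
  have "\<exists>c>0. \<forall>v\<in>UNIV. c * norm v \<le> norm (v - z *\<^sub>C K v)" for z
    using compact_operator_bounded_below[OF Kb K(2) inj, of z] by auto
  \<comment> \<open>The factor L defeats the growth of the steering operators, the factor 2 makes
    the steered vector too short for the ball around x0.\<close>
  from quasinilpotent[OF this, of "2 * L"] L(1)
  obtain n0 where n0: "\<And>n v. n \<ge> n0 \<Longrightarrow> (2 * L) ^ n * norm ((K ^^ n) v) \<le> norm v" by auto
  define n where "n = Suc n0"
  obtain B where B: "\<And>v. norm (B v) \<le> L ^ n * norm v" "B ((K ^^ n) x0) \<in> cball x0 \<rho>" using walk by blast
  have "2 * norm (B ((K ^^ n) x0)) \<le> 2 ^ n * (L ^ n * norm ((K ^^ n) x0))"
    using L(1) by (intro mult_mono B) (auto simp: n_def)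
  also have "\<dots> \<le> norm x0" using n0[of n x0] by (simp add: n_def power_mult_distrib mult_ac)
  finally have "norm (B ((K ^^ n) x0)) \<le> norm x0 / 2" by simp
  moreover have "norm x0 - \<rho> \<le> norm (B ((K ^^ n) x0))"
    using B(2) norm_triangle_ineq2[of x0 "x0 - B ((K ^^ n) x0)"] by (simp add: dist_norm)
  ultimately show False using \<rho>(2) x0 zero_less_norm_iff[of x0] by linarith
qed

theorem compact_power_hyperinvariant:
  fixes S :: "'a::complex_banach \<Rightarrow> 'a"
  assumes inf: "\<not> cfinite_dim (UNIV :: 'a set)"
    and S: "bounded_clinear S" "S w \<noteq> 0" and K: "compact_operator (S ^^ N)"
  shows "\<exists>M. nontrivial_hyperinvariant S M"
proof -
  obtain s :: "nat \<Rightarrow> 'a" where s: "\<forall>n. norm (s n) = 1" "\<forall>r. strict_mono r \<longrightarrow> \<not> Cauchy (s \<circ> r)"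
    by (rule unit_vectors_without_Cauchy_subseq[OF inf])
  have KS: "bounded_clinear (S ^^ N)" by (rule bounded_clinear_funpow[OF S(1)])
  interpret K: bounded_linear "S ^^ N" by (rule bounded_clinear_bounded_linear[OF KS])
  consider "\<forall>v. (S ^^ N) v = 0" | z v where "v = z *\<^sub>C (S ^^ N) v" "v \<noteq> 0"
    | x0 where "(S ^^ N) x0 \<noteq> 0" "\<forall>z v. v = z *\<^sub>C (S ^^ N) v \<longrightarrow> v = 0"
    by metis
  then show ?thesis
  proof cases
    case 1
    \<comment> \<open>If S were injective, all its powers would be, but S^N vanishes on the unit
      vector \<open>s 0\<close>.\<close>
    have "\<exists>v. S v = 0 \<and> v \<noteq> 0"
    proof (rule ccontr)
      assume "\<not> ?thesis"
      then have "(S ^^ n) (s 0) \<noteq> 0" for n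
        using s(1) by (induction n) (auto dest: spec[of _ 0])
      then show False using 1 by blast
    qed
    then obtain v where v: "S v = 0" "v \<noteq> 0" by blast
    have "nontrivial_hyperinvariant S {v. S v = 0}"
      by (rule kernel_hyperinvariant[OF S(1) _ v S(2)]) (simp add: fun_eq_iff)
    then show ?thesis by blast
  next
    case (2 z v)
    define B where "B v = v - z *\<^sub>C (S ^^ N) v" for v
    have Bb: "bounded_clinear B" unfolding B_def
      using bounded_clinear_diff[OF bounded_clinear_scaleC[of 1] bounded_clinear_compose[OF bounded_clinear_scaleC KS]]
      by (simp add: scaleC_one)
    have comm: "A (B v) = B (A v)" if A: "bounded_clinear A" "A \<circ> S = S \<circ> A" for A v
    proof -
      interpret A: bounded_linear A by (rule bounded_clinear_bounded_linear[OF A(1)])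
      show ?thesis by (simp add: B_def A.diff bounded_clinear_scale[OF A(1)] commute_funpow[OF A(2)])
    qed
    \<comment> \<open>Otherwise z S^N would be the identity, and the separated sequence
      \<open>s\<close> would have a Cauchy subsequence.\<close>
    have "\<exists>u. B u \<noteq> 0"
    proof (rule ccontr)
      assume "\<not> ?thesis"
      then have eq: "u = z *\<^sub>C (S ^^ N) u" for u by (simp add: B_def)
      obtain r :: "nat \<Rightarrow> nat" where r: "strict_mono r" "Cauchy (\<lambda>n. (S ^^ N) (s (r n)))"
        using K[unfolded compact_operator_def, rule_format, of s 1] s(1) by auto
      have "Cauchy (\<lambda>n. z *\<^sub>C (S ^^ N) (s (r n)))"
        by (rule bounded_linear.Cauchy[OF bounded_clinear_bounded_linear[OF bounded_clinear_scaleC] r(2)])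
      then have "Cauchy (s \<circ> r)" by (simp only: comp_def eq[symmetric])
      then show False using s(2) r(1) by blast
    qed
    then obtain u where u: "B u \<noteq> 0" by blast
    have v0: "B v = 0" using 2(1) by (simp add: B_def)
    have "nontrivial_hyperinvariant S {v. B v = 0}"
      by (rule kernel_hyperinvariant[OF Bb comm v0 2(2) u])
    then show ?thesis by blast
  next
    case (3 x0)
    show ?thesis by (rule quasinilpotent_hyperinvariant[OF S(1) refl K 3(1)]) (use 3(2) in blast)
  qed
qed

theorem corollary6p12:
  fixes fs :: "omega1 \<Rightarrow> nat \<Rightarrow> omega1"
    and \<xi> :: omega1
    and T :: "'a::complex_banach \<Rightarrow> 'a"
  assumes "fundamental_sequences fs"
    and "\<not> cfinite_dim (UNIV :: 'a set)"
    and "1 \<le> \<xi>"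
    and "HI fs \<xi> TYPE('a)"
    and "finite ((SP1w :: (nat \<Rightarrow> 'a) set) // schreier_equiv fs \<xi>)"
    and "bounded_clinear T"
    and "\<not> (\<exists>c. T = (\<lambda>x. c *\<^sub>C x))"
  shows "\<exists>M. nontrivial_hyperinvariant T M"
proof -
  obtain \<mu> where sing: "schreier_singular fs \<xi> (\<lambda>x. T x - \<mu> *\<^sub>C x)"
    by (rule HI_decomposition[OF assms(4,2,6)])
  define S where "S x = T x - \<mu> *\<^sub>C x" for x
  have S: "bounded_clinear S" unfolding S_def
    by (intro bounded_clinear_diff bounded_clinear_scaleC assms(6))
  obtain w where w: "S w \<noteq> 0"
  proof -
    have "T \<noteq> (\<lambda>x. \<mu> *\<^sub>C x)" using assms(7) by blast
    then show thesis using that by (auto simp: S_def fun_eq_iff)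
  qed
  define N where "N = card ((SP1w :: (nat \<Rightarrow> 'a) set) // schreier_equiv fs \<xi>)"
  have "compact_operator (S ^^ N)" unfolding compact_operator_def
  proof (intro allI impI)
    fix x :: "nat \<Rightarrow> 'a" and b assume "\<forall>n. norm (x n) \<le> b"
    then have b: "norm (x n) \<le> b" for n by simp
    have singS: "schreier_singular fs \<xi> S" unfolding S_def by (rule sing)
    show "\<exists>r::nat \<Rightarrow> nat. strict_mono r \<and> Cauchy (\<lambda>n. (S ^^ N) (x (r n)))"
      unfolding N_def by (rule schreier_singular_power_compact[OF assms(4,5) S singS b])
  qed
  then obtain M where M: "nontrivial_hyperinvariant S M"
    using compact_power_hyperinvariant[OF assms(2) S w] by blast
  \<comment> \<open>S differs from T by a scalar multiple of the identity, so hyperinvariance for S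
    carries over to T.\<close>
  have "A \<circ> S = S \<circ> A" if A: "bounded_clinear A" "A \<circ> T = T \<circ> A" for A
  proof
    fix v
    interpret A: bounded_linear A by (rule bounded_clinear_bounded_linear[OF A(1)])
    show "(A \<circ> S) v = (S \<circ> A) v"
      using fun_cong[OF A(2), of v] by (simp add: S_def A.diff bounded_clinear_scale[OF A(1)])
  qed
  then have "nontrivial_hyperinvariant T M"
    using M unfolding nontrivial_hyperinvariant_def by blast
  then show ?thesis by blast
qed

end
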